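(* Let $J\neq F_n^\infty$ be a WOT-closed two-sided ideal of $F_n^\infty$ generated by a family of polynomials $\mathcal P_J\subset F_n^\infty$ and let $T:=[T_1,\ldots,T_n]$, $T_i\in B(\mathcal H)$, be a row contraction such that $p(T_1,\ldots,T_n)=0$ for any $p\in\mathcal P_J$. Then the dilation index of $T$ satisfies the equation $$\text{dil-ind}\,(T)=\mathrm{rank}\,\Delta_T.$$
   Context: Let $n\in\{1,2,\dots\}$ and let $F^2(H_n)=\bigoplus_{k\ge 0}H_n^{\otimes k}$ be the full Fock space of an $n$-dimensional complex Hilbert space $H_n$ with orthonormal basis $e_1,\dots,e_n$ (with $H_n^{\otimes 0}=\mathbb C1$). The left creation operators are $S_i\varphi=e_i\otimes\varphi$. $F_n^\infty\subset B(F^2(H_n))$ is the WOT-closed algebra generated by $S_1,\dots,S_n$ and the identity. Polynomials in $F_n^\infty$ are the operators $p(S_1,\dots,S_n)$, $p$ a polynomial in $n$ noncommuting indeterminates; $p(T_1,\dots,T_n)$ is the corresponding evaluation. "Generated by $\mathcal P_J$" means $J$ is the smallest WOT-closed two-sided ideal containing $\mathcal P_J$. Put $\mathcal N_J=F^2(H_n)\ominus\overline{JF^2(H_n)}$ and $B_i=P_{\mathcal N_J}S_i|_{\mathcal N_J}$. $T=[T_1,\dots,T_n]$ is a row contraction if $\sum_iT_iT_i^*\le I$; $\Delta_T=(I-\sum_iT_iT_i^* )^{1/2}$ and $\mathrm{rank}\,\Delta_T=\dim\overline{\Delta_T\mathcal H}$. Let $\mathcal D,\mathcal K$ be Hilbert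 spaces (possibly $\{0\}$) and $Z_i\in B(\mathcal K)$ with $Z_1Z_1^*+\cdots+Z_nZ_n^*=I_{\mathcal K}$. The $n$-tuple $V=[V_1,\dots,V_n]$, $V_i=(B_i\otimes I_{\mathcal D})\oplus Z_i$ on $(\mathcal N_J\otimes\mathcal D)\oplus\mathcal K$, is called a ($J$-)constrained dilation of $T$ if (a) $p(V_1,\dots,V_n)=0$ for any $p\in\mathcal P_J$, and (b) $\mathcal H$ can be identified (via an isometry) with a subspace invariant under $V_1^*,\dots,V_n^*$ such that $T_i=P_{\mathcal H}V_i|_{\mathcal H}$, $i=1,\dots,n$. The dilation index $\text{dil-ind}(T)$ is the minimum dimension of $\mathcal D$ over all such constrained dilations $V$ of $T$. *)

theory Defs
  imports "HOL-Analysis.Analysis" "HOL-Library.Poly_Mapping"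
begin

unbundle cardinal_syntax

section \<open>Complex Hilbert spaces\<close>

text \<open>
  A complex Hilbert space is a complete real inner product space with a compatible complex scalar
  multiplication and a sesquilinear form (linear in the first argument) whose real part is the real
  inner product; in particular \<open>norm x = sqrt (Re (cinner x x))\<close>.  Both the zero space and
  non-separable spaces are allowed.
\<close>

class complex_hilbert = real_inner + complete_space +
  fixes scaleC :: "complex \<Rightarrow> 'a \<Rightarrow> 'a" (infixr \<open>*\<^sub>C\<close> 75)
    and cinner :: "'a \<Rightarrow> 'a \<Rightarrow> complex"
  assumes scaleC_add_right: "c *\<^sub>C (x + y) = c *\<^sub>C x + c *\<^sub>C y"
    and scaleC_add_left: "(c + d) *\<^sub>C x = c *\<^sub>C x + d *\<^sub>C x"
    and scaleC_scaleC: "c *\<^sub>C d *\<^sub>C x = (c * d) *\<^sub>C x"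
    and scaleC_of_real: "complex_of_real r *\<^sub>C x = r *\<^sub>R x"
    and cinner_commute: "cinner x y = cnj (cinner y x)"
    and cinner_add_left: "cinner (x + y) z = cinner x z + cinner y z"
    and cinner_scaleC_left: "cinner (c *\<^sub>C x) y = c * cinner x y"
    and Re_cinner: "Re (cinner x y) = inner x y"

lemma scaleC_one: "1 *\<^sub>C x = (x :: 'a :: complex_hilbert)"
  using scaleC_of_real[of 1 x] by simp

lemma cinner_self: "cinner x x = complex_of_real ((norm (x :: 'a :: complex_hilbert))\<^sup>2)"
proof (rule complex_eqI)
  have "Im (cinner x x) = - Im (cinner x x)"
    using arg_cong[OF cinner_commute[of x x], of Im] by simp
  then show "Im (cinner x x) = Im (complex_of_real ((norm x)\<^sup>2))" by simp
qed (simp add: Re_cinner power2_norm_eq_inner)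

lemma norm_scaleC: "norm (c *\<^sub>C x) = cmod c * norm (x :: 'a :: complex_hilbert)"
proof -
  have "complex_of_real ((norm (c *\<^sub>C x))\<^sup>2) = c * cnj (c * cinner x x)"
    by (metis cinner_self cinner_scaleC_left cinner_commute)
  also have "\<dots> = complex_of_real ((cmod c * norm x)\<^sup>2)"
    by (simp add: cinner_self power_mult_distrib flip: complex_norm_square)
  finally have "(norm (c *\<^sub>C x))\<^sup>2 = (cmod c * norm x)\<^sup>2"
    using of_real_eq_iff by blast
  then show ?thesis by (simp add: power2_eq_iff_nonneg)
qed

instantiation complex :: complex_hilbert
begin
definition scaleC_complex :: "complex \<Rightarrow> complex \<Rightarrow> complex" where
  "scaleC_complex c x = c * x"
definition cinner_complex :: "complex \<Rightarrow> complex \<Rightarrow> complex" where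
  "cinner_complex x y = x * cnj y"
instance
  by standard (auto simp: scaleC_complex_def cinner_complex_def algebra_simps
      inner_complex_def scaleR_conv_of_real)
end

instantiation prod :: (complex_hilbert, complex_hilbert) complex_hilbert
begin
definition scaleC_prod :: "complex \<Rightarrow> 'a \<times> 'b \<Rightarrow> 'a \<times> 'b" where
  "scaleC_prod c x = (c *\<^sub>C fst x, c *\<^sub>C snd x)"
definition cinner_prod :: "'a \<times> 'b \<Rightarrow> 'a \<times> 'b \<Rightarrow> complex" where
  "cinner_prod x y = cinner (fst x) (fst y) + cinner (snd x) (snd y)"
instance
proof
  fix x y :: "'a \<times> 'b"
  show "cinner x y = cnj (cinner y x)"
    unfolding cinner_prod_def complex_cnj_add by (metis cinner_commute)
qed (auto simp: scaleC_prod_def cinner_prod_def scaleC_add_right scaleC_add_left scaleC_scaleC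
      scaleC_of_real cinner_add_left cinner_scaleC_left Re_cinner inner_prod_def algebra_simps
      scaleR_prod_def)
end

section \<open>Square-summable families\<close>

typedef (overloaded) ('i, 'a :: complex_hilbert) l2 =
  "{f :: 'i \<Rightarrow> 'a. (\<lambda>i. (norm (f i))\<^sup>2) summable_on UNIV}"
  morphisms l2_nth Abs_l2
  by (rule exI[of _ "\<lambda>_. 0"]) simp

lemma l2_nth_summable: "(\<lambda>i. (norm (l2_nth f i))\<^sup>2) summable_on UNIV"
  using l2_nth[of f] by simp

lemma l2_eqI: "(\<And>i. l2_nth f i = l2_nth g i) \<Longrightarrow> f = g"
  by (metis l2_nth_inject ext)

lemma square_summable_scale:
  fixes f :: "'i \<Rightarrow> 'a :: complex_hilbert"
  assumes "(\<lambda>i. (norm (f i))\<^sup>2) summable_on UNIV" and "\<And>i. norm (g i) \<le> C * norm (f i)"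
  shows "(\<lambda>i. (norm (g i))\<^sup>2) summable_on UNIV"
proof (rule summable_on_comparison_test)
  show "(\<lambda>i. C\<^sup>2 * (norm (f i))\<^sup>2) summable_on UNIV"
    by (rule summable_on_cmult_right) (rule assms)
  show "(norm (g i))\<^sup>2 \<le> C\<^sup>2 * (norm (f i))\<^sup>2" for i
    using power_mono[OF assms(2)[of i], of 2] by (simp add: power_mult_distrib)
qed auto

lemma square_summable_add:
  fixes f g :: "'i \<Rightarrow> 'a :: complex_hilbert"
  assumes "(\<lambda>i. (norm (f i))\<^sup>2) summable_on UNIV" and "(\<lambda>i. (norm (g i))\<^sup>2) summable_on UNIV"
  shows "(\<lambda>i. (norm (f i + g i))\<^sup>2) summable_on UNIV"
proof (rule summable_on_comparison_test)
  show "(\<lambda>i. 2 * (norm (f i))\<^sup>2 + 2 * (norm (g i))\<^sup>2) summable_on UNIV"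
    by (intro summable_on_add summable_on_cmult_right assms)
  show "(norm (f i + g i))\<^sup>2 \<le> 2 * (norm (f i))\<^sup>2 + 2 * (norm (g i))\<^sup>2" for i
  proof -
    have "(norm (f i + g i))\<^sup>2 \<le> (norm (f i) + norm (g i))\<^sup>2"
      by (intro power_mono norm_triangle_ineq) auto
    also have "\<dots> \<le> 2 * (norm (f i))\<^sup>2 + 2 * (norm (g i))\<^sup>2"
      using sum_squares_bound[of "norm (f i)" "norm (g i)"] by (simp add: power2_sum)
    finally show ?thesis .
  qed
qed auto

lemma norm_cinner_le: "cmod (cinner x y) \<le> 2 * (norm x * norm (y :: 'a :: complex_hilbert))"
proof -
  have "Im (cinner x y) = - Re (cinner (\<i> *\<^sub>C x) y)"
    by (simp add: cinner_scaleC_left)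
  then have "\<bar>Im (cinner x y)\<bar> \<le> norm (\<i> *\<^sub>C x) * norm y"
    by (simp add: Re_cinner Cauchy_Schwarz_ineq2)
  moreover have "\<bar>Re (cinner x y)\<bar> \<le> norm x * norm y"
    by (simp add: Re_cinner Cauchy_Schwarz_ineq2)
  ultimately show ?thesis
    using cmod_le[of "cinner x y"] by (simp add: norm_scaleC)
qed

lemma l2_cinner_summable:
  "(\<lambda>i. cinner (l2_nth f i) (l2_nth g i)) summable_on UNIV"
proof (rule abs_summable_summable, rule summable_on_comparison_test)
  show "(\<lambda>i. (norm (l2_nth f i))\<^sup>2 + (norm (l2_nth g i))\<^sup>2) summable_on UNIV"
    by (intro summable_on_add l2_nth_summable)
  show "cmod (cinner (l2_nth f i) (l2_nth g i)) \<le> (norm (l2_nth f i))\<^sup>2 + (norm (l2_nth g i))\<^sup>2" for i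
    using norm_cinner_le[of "l2_nth f i" "l2_nth g i"]
      sum_squares_bound[of "norm (l2_nth f i)" "norm (l2_nth g i)"] by simp
qed simp

lemma l2_inner_summable: "(\<lambda>i. inner (l2_nth f i) (l2_nth g i)) summable_on UNIV"
  using summable_on_Re[OF l2_cinner_summable[of f g]] by (simp add: Re_cinner)

instantiation l2 :: (type, complex_hilbert) real_vector
begin

definition zero_l2 :: "('a, 'b) l2" where "0 = Abs_l2 (\<lambda>_. 0)"
definition plus_l2 :: "('a, 'b) l2 \<Rightarrow> ('a, 'b) l2 \<Rightarrow> ('a, 'b) l2" where
  "f + g = Abs_l2 (\<lambda>i. l2_nth f i + l2_nth g i)"
definition uminus_l2 :: "('a, 'b) l2 \<Rightarrow> ('a, 'b) l2" where
  "- f = Abs_l2 (\<lambda>i. - l2_nth f i)"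
definition minus_l2 :: "('a, 'b) l2 \<Rightarrow> ('a, 'b) l2 \<Rightarrow> ('a, 'b) l2" where
  "f - g = f + - (g :: ('a, 'b) l2)"
definition scaleR_l2 :: "real \<Rightarrow> ('a, 'b) l2 \<Rightarrow> ('a, 'b) l2" where
  "r *\<^sub>R f = Abs_l2 (\<lambda>i. r *\<^sub>R l2_nth f i)"

lemma l2_nth_zero [simp]: "l2_nth (0 :: ('a, 'b) l2) i = 0"
  by (simp add: zero_l2_def Abs_l2_inverse)

lemma l2_nth_add [simp]: "l2_nth (f + g :: ('a, 'b) l2) i = l2_nth f i + l2_nth g i"
  using square_summable_add[OF l2_nth_summable l2_nth_summable, of f g]
  by (simp add: plus_l2_def Abs_l2_inverse)

lemma l2_nth_uminus [simp]: "l2_nth (- f :: ('a, 'b) l2) i = - l2_nth f i"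
  using l2_nth_summable[of f] by (simp add: uminus_l2_def Abs_l2_inverse)

lemma l2_nth_diff [simp]: "l2_nth (f - g :: ('a, 'b) l2) i = l2_nth f i - l2_nth g i"
  by (simp add: minus_l2_def)

lemma l2_nth_scaleR [simp]: "l2_nth (r *\<^sub>R f :: ('a, 'b) l2) i = r *\<^sub>R l2_nth f i"
proof -
  have "(\<lambda>i. (norm (r *\<^sub>R l2_nth f i))\<^sup>2) summable_on UNIV"
    by (rule square_summable_scale[OF l2_nth_summable[of f], where C = "\<bar>r\<bar>"]) simp
  then show ?thesis by (simp add: scaleR_l2_def Abs_l2_inverse)
qed

instance
  by standard (rule l2_eqI, simp add: algebra_simps)+

end

instantiation l2 :: (type, complex_hilbert) real_inner
begin

definition inner_l2 :: "('a, 'b) l2 \<Rightarrow> ('a, 'b) l2 \<Rightarrow> real" where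
  "inner f g = (\<Sum>\<^sub>\<infinity>i. inner (l2_nth f i) (l2_nth g i))"
definition norm_l2 :: "('a, 'b) l2 \<Rightarrow> real" where
  "norm f = sqrt (inner f (f :: ('a, 'b) l2))"
definition dist_l2 :: "('a, 'b) l2 \<Rightarrow> ('a, 'b) l2 \<Rightarrow> real" where
  "dist f g = norm (f - (g :: ('a, 'b) l2))"
definition sgn_l2 :: "('a, 'b) l2 \<Rightarrow> ('a, 'b) l2" where
  "sgn f = f /\<^sub>R norm (f :: ('a, 'b) l2)"
definition uniformity_l2 :: "(('a, 'b) l2 \<times> ('a, 'b) l2) filter" where
  "uniformity = (INF e\<in>{0 <..}. principal {(f, g :: ('a, 'b) l2). dist f g < e})"
definition open_l2 :: "('a, 'b) l2 set \<Rightarrow> bool" where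
  "open U \<longleftrightarrow> (\<forall>f\<in>U. eventually (\<lambda>(f', g). f' = f \<longrightarrow> g \<in> U)
      (uniformity :: (('a, 'b) l2 \<times> ('a, 'b) l2) filter))"

instance
proof
  fix f g h :: "('a, 'b) l2" and r :: real
  show "sgn f = f /\<^sub>R norm f" by (rule sgn_l2_def)
  show "dist f g = norm (f - g)" by (rule dist_l2_def)
  show "uniformity = (INF e\<in>{0 <..}. principal {(x, y :: ('a, 'b) l2). dist x y < e})"
    by (rule uniformity_l2_def)
  show "norm f = sqrt (inner f f)" by (rule norm_l2_def)
  show "inner f g = inner g f" by (simp add: inner_l2_def inner_commute)
  show "inner (f + g) h = inner f h + inner g h"
    by (simp add: inner_l2_def inner_add_left infsum_add[OF l2_inner_summable l2_inner_summable])
  show "inner (r *\<^sub>R f) g = r * inner f g" by (simp add: inner_l2_def infsum_cmult_right')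
  show "0 \<le> inner f f" by (simp add: inner_l2_def infsum_nonneg)
  show "inner f f = 0 \<longleftrightarrow> f = 0"
  proof
    assume "inner f f = 0"
    then have "inner (l2_nth f i) (l2_nth f i) = 0" for i
      by (intro nonneg_infsum_le_0D[OF _ l2_inner_summable]) (auto simp: inner_l2_def)
    then show "f = 0" by (intro l2_eqI) simp
  qed (simp add: inner_l2_def)
next
  fix U :: "('a, 'b) l2 set"
  show "open U \<longleftrightarrow> (\<forall>x\<in>U. \<forall>\<^sub>F (x', y) in uniformity. x' = x \<longrightarrow> y \<in> U)"
    by (rule open_l2_def)
qed

end

lemma norm_l2_infsum: "(norm f)\<^sup>2 = (\<Sum>\<^sub>\<infinity>i. (norm (l2_nth f i))\<^sup>2)"
  by (simp add: power2_norm_eq_inner inner_l2_def)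

lemma sum_norm_l2_le: "finite F \<Longrightarrow> (\<Sum>i\<in>F. (norm (l2_nth f i))\<^sup>2) \<le> (norm f)\<^sup>2"
  unfolding norm_l2_infsum by (rule finite_sum_le_infsum[OF l2_nth_summable]) auto

lemma norm_l2_nth_le: "norm (l2_nth f i) \<le> norm f"
  by (rule power2_le_imp_le) (use sum_norm_l2_le[of "{i}" f] in simp_all)

lemma l2_complete:
  fixes X :: "nat \<Rightarrow> ('i, 'a :: complex_hilbert) l2"
  assumes "Cauchy X"
  shows "convergent X"
proof -
  have "Cauchy (\<lambda>n. l2_nth (X n) i)" for i
  proof (rule CauchyI)
    fix e :: real assume "0 < e"
    then obtain M where "\<forall>m\<ge>M. \<forall>n\<ge>M. norm (X m - X n) < e"
      using CauchyD[OF assms] by blast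
    then show "\<exists>M. \<forall>m\<ge>M. \<forall>n\<ge>M. norm (l2_nth (X m) i - l2_nth (X n) i) < e"
      using norm_l2_nth_le[of "X m - X n" i for m n] by (metis l2_nth_diff le_less_trans)
  qed
  then have "\<exists>l. (\<lambda>n. l2_nth (X n) i) \<longlonglongrightarrow> l" for i
    using Cauchy_convergent convergent_def by blast
  then obtain l where l: "\<And>i. (\<lambda>n. l2_nth (X n) i) \<longlonglongrightarrow> l i" by metis
  have tail: "\<exists>M. \<forall>m\<ge>M. \<forall>F. finite F \<longrightarrow> (\<Sum>i\<in>F. (norm (l2_nth (X m) i - l i))\<^sup>2) \<le> e\<^sup>2"
    if "0 < e" for e :: real
  proof -
    from that obtain M where M: "\<forall>m\<ge>M. \<forall>n\<ge>M. norm (X m - X n) < e"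
      using CauchyD[OF assms] by blast
    have "(\<Sum>i\<in>F. (norm (l2_nth (X m) i - l i))\<^sup>2) \<le> e\<^sup>2" if "m \<ge> M" "finite F" for m F
    proof (rule LIMSEQ_le_const2)
      show "(\<lambda>n. \<Sum>i\<in>F. (norm (l2_nth (X m) i - l2_nth (X n) i))\<^sup>2)
          \<longlonglongrightarrow> (\<Sum>i\<in>F. (norm (l2_nth (X m) i - l i))\<^sup>2)"
        by (intro tendsto_intros l)
      show "\<exists>N. \<forall>n\<ge>N. (\<Sum>i\<in>F. (norm (l2_nth (X m) i - l2_nth (X n) i))\<^sup>2) \<le> e\<^sup>2"
      proof (intro exI allI impI)
        fix n assume "n \<ge> M"
        then have "(norm (X m - X n))\<^sup>2 \<le> e\<^sup>2"
          using M \<open>m \<ge> M\<close> by (intro power_mono) (simp_all add: less_imp_le)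
        then show "(\<Sum>i\<in>F. (norm (l2_nth (X m) i - l2_nth (X n) i))\<^sup>2) \<le> e\<^sup>2"
          using sum_norm_l2_le[OF \<open>finite F\<close>, of "X m - X n"] by simp
      qed
    qed
    then show ?thesis by blast
  qed
  have diff: "(\<lambda>i. (norm (l2_nth (X m) i - l i))\<^sup>2) summable_on UNIV"
    if "\<forall>F. finite F \<longrightarrow> (\<Sum>i\<in>F. (norm (l2_nth (X m) i - l i))\<^sup>2) \<le> e\<^sup>2" for m e
  proof (rule nonneg_bdd_above_summable_on)
    show "bdd_above (sum (\<lambda>i. (norm (l2_nth (X m) i - l i))\<^sup>2) ` {F. F \<subseteq> UNIV \<and> finite F})"
      using that by (intro bdd_aboveI2[where M = "e\<^sup>2"]) blast
  qed simp
  obtain m1 e1 where "\<forall>F. finite F \<longrightarrow> (\<Sum>i\<in>F. (norm (l2_nth (X m1) i - l i))\<^sup>2) \<le> (e1::real)\<^sup>2"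
    using tail[OF zero_less_one] by blast
  from square_summable_add[OF l2_nth_summable[of "X m1"]
      square_summable_scale[OF diff[OF this], of "\<lambda>i. l i - l2_nth (X m1) i" 1]]
  have "(\<lambda>i. (norm (l i))\<^sup>2) summable_on UNIV"
    by (simp add: norm_minus_commute)
  then have L: "l2_nth (Abs_l2 l) i = l i" for i by (simp add: Abs_l2_inverse)
  have "X \<longlonglongrightarrow> Abs_l2 l"
  proof (rule LIMSEQ_I)
    fix e :: real assume "0 < e"
    then obtain M where M:
      "\<forall>m\<ge>M. \<forall>F. finite F \<longrightarrow> (\<Sum>i\<in>F. (norm (l2_nth (X m) i - l i))\<^sup>2) \<le> (e / 2)\<^sup>2"
      using tail[OF half_gt_zero] by blast
    have "norm (X m - Abs_l2 l) < e" if "m \<ge> M" for m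
    proof -
      have "(norm (X m - Abs_l2 l))\<^sup>2 \<le> (e / 2)\<^sup>2"
        unfolding norm_l2_infsum
      proof (rule infsum_le_finite_sums[OF l2_nth_summable])
        fix F :: "'i set" assume "finite F"
        then show "(\<Sum>i\<in>F. (norm (l2_nth (X m - Abs_l2 l) i))\<^sup>2) \<le> (e / 2)\<^sup>2"
          using M that by (simp add: L)
      qed
      then have "norm (X m - Abs_l2 l) \<le> e / 2"
        by (rule power2_le_imp_le) (use \<open>0 < e\<close> in simp)
      then show ?thesis using \<open>0 < e\<close> by simp
    qed
    then show "\<exists>M. \<forall>m\<ge>M. norm (X m - Abs_l2 l) < e" by blast
  qed
  then show ?thesis by (auto simp: convergent_def)
qed

instantiation l2 :: (type, complex_hilbert) complex_hilbert
begin

definition scaleC_l2 :: "complex \<Rightarrow> ('a, 'b) l2 \<Rightarrow> ('a, 'b) l2" where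
  "c *\<^sub>C f = Abs_l2 (\<lambda>i. c *\<^sub>C l2_nth f i)"
definition cinner_l2 :: "('a, 'b) l2 \<Rightarrow> ('a, 'b) l2 \<Rightarrow> complex" where
  "cinner f g = (\<Sum>\<^sub>\<infinity>i. cinner (l2_nth f i) (l2_nth g i))"

lemma l2_nth_scaleC [simp]: "l2_nth (c *\<^sub>C f :: ('a, 'b) l2) i = c *\<^sub>C l2_nth f i"
proof -
  have "(\<lambda>i. (norm (c *\<^sub>C l2_nth f i))\<^sup>2) summable_on UNIV"
    by (rule square_summable_scale[OF l2_nth_summable[of f], where C = "cmod c"]) (simp add: norm_scaleC)
  then show ?thesis by (simp add: scaleC_l2_def Abs_l2_inverse)
qed

instance
proof
  fix f g h :: "('a, 'b) l2" and r :: real and c d :: complex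
  show "c *\<^sub>C (f + g) = c *\<^sub>C f + c *\<^sub>C g"
    by (rule l2_eqI) (simp add: scaleC_add_right)
  show "(c + d) *\<^sub>C f = c *\<^sub>C f + d *\<^sub>C f"
    by (rule l2_eqI) (simp add: scaleC_add_left)
  show "c *\<^sub>C d *\<^sub>C f = (c * d) *\<^sub>C f"
    by (rule l2_eqI) (simp add: scaleC_scaleC)
  show "complex_of_real r *\<^sub>C f = r *\<^sub>R f"
    by (rule l2_eqI) (simp add: scaleC_of_real)
  show "cinner f g = cnj (cinner g f)"
    unfolding cinner_l2_def infsum_cnj[symmetric] by (metis cinner_commute)
  show "cinner (f + g) h = cinner f h + cinner g h"
    by (simp add: cinner_l2_def cinner_add_left infsum_add[OF l2_cinner_summable l2_cinner_summable])
  show "cinner (c *\<^sub>C f) g = c * cinner f g"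
    by (simp add: cinner_l2_def cinner_scaleC_left infsum_cmult_right')
  show "Re (cinner f g) = inner f g"
    by (simp add: cinner_l2_def inner_l2_def infsum_Re[OF l2_cinner_summable, symmetric] Re_cinner)
qed (rule l2_complete)

end


section \<open>Subspaces, dimension and bounded operators\<close>

definition csubspace :: "'a::complex_hilbert set \<Rightarrow> bool" where
  "csubspace M \<longleftrightarrow> 0 \<in> M \<and> (\<forall>x\<in>M. \<forall>y\<in>M. x + y \<in> M) \<and> (\<forall>c. \<forall>x\<in>M. c *\<^sub>C x \<in> M)"

definition closed_csubspace :: "'a::complex_hilbert set \<Rightarrow> bool" where
  "closed_csubspace M \<longleftrightarrow> csubspace M \<and> closed M"

definition cspan :: "'a::complex_hilbert set \<Rightarrow> 'a set" where
  "cspan B = csubspace hull B"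

definition ocomp :: "'a::complex_hilbert set \<Rightarrow> 'a set" where
  "ocomp M = {y. \<forall>x\<in>M. cinner x y = 0}"

definition proj :: "'a::complex_hilbert set \<Rightarrow> 'a \<Rightarrow> 'a" where
  "proj M x = (THE y. y \<in> M \<and> x - y \<in> ocomp M)"

definition is_onb :: "'a::complex_hilbert set \<Rightarrow> 'a set \<Rightarrow> bool" where
  "is_onb M B \<longleftrightarrow> (\<forall>x\<in>B. \<forall>y\<in>B. cinner x y = (if x = y then 1 else 0)) \<and> closure (cspan B) = M"

text \<open>
  The Hilbert space dimension of a closed subspace, as a cardinal in the sense of \<^const>\<open>card_of\<close>:
  the cardinality of an orthonormal basis, so infinite dimensions are distinguished.  It is
  compared with \<open>\<le>o\<close> and \<open>=o\<close>, also across different types.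
\<close>

definition hdim :: "'a::complex_hilbert set \<Rightarrow> 'a rel" where
  "hdim M = |SOME B. is_onb M B|"

text \<open>
  \<open>bounded_op M A\<close> states that \<open>A\<close> restricts to a bounded complex-linear operator on the subspace
  \<open>M\<close>.  The values of \<open>A\<close> outside \<open>M\<close> never matter.
\<close>

definition bounded_op :: "'a::complex_hilbert set \<Rightarrow> ('a \<Rightarrow> 'a) \<Rightarrow> bool" where
  "bounded_op M A \<longleftrightarrow>
     (\<forall>x\<in>M. A x \<in> M) \<and>
     (\<forall>x\<in>M. \<forall>y\<in>M. A (x + y) = A x + A y) \<and>
     (\<forall>c. \<forall>x\<in>M. A (c *\<^sub>C x) = c *\<^sub>C A x) \<and>
     (\<exists>C. \<forall>x\<in>M. norm (A x) \<le> C * norm x)"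

lemma bounded_op_UNIV_iff:
  "bounded_op UNIV A \<longleftrightarrow> bounded_linear A \<and> (\<forall>c x. A (c *\<^sub>C x) = c *\<^sub>C A x)"
proof
  assume A: "bounded_op UNIV A"
  then obtain C where "\<forall>x. norm (A x) \<le> C * norm x" by (auto simp: bounded_op_def)
  with A have "bounded_linear A"
    by (intro bounded_linear_intro[where K = C])
      (auto simp: bounded_op_def mult.commute simp flip: scaleC_of_real)
  with A show "bounded_linear A \<and> (\<forall>c x. A (c *\<^sub>C x) = c *\<^sub>C A x)" by (auto simp: bounded_op_def)
next
  assume A: "bounded_linear A \<and> (\<forall>c x. A (c *\<^sub>C x) = c *\<^sub>C A x)"
  then obtain C where "\<forall>x. norm (A x) \<le> norm x * C" using bounded_linear.bounded by blast
  with A show "bounded_op UNIV A"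
    by (auto simp: bounded_op_def bounded_linear.linear linear_add mult.commute)
qed

definition cadjoint :: "'a::complex_hilbert set \<Rightarrow> ('a \<Rightarrow> 'a) \<Rightarrow> 'a \<Rightarrow> 'a" where
  "cadjoint M A y = (THE z. z \<in> M \<and> (\<forall>x\<in>M. cinner (A x) y = cinner x z))"

definition positive_op :: "('a::complex_hilbert \<Rightarrow> 'a) \<Rightarrow> bool" where
  "positive_op A \<longleftrightarrow>
     bounded_op UNIV A \<and> (\<forall>x. Im (cinner (A x) x) = 0 \<and> 0 \<le> Re (cinner (A x) x))"

definition op_sqrt :: "('a::complex_hilbert \<Rightarrow> 'a) \<Rightarrow> 'a \<Rightarrow> 'a" where
  "op_sqrt A = (THE R. positive_op R \<and> R \<circ> R = A)"

definition isometry :: "('a::complex_hilbert \<Rightarrow> 'b::complex_hilbert) \<Rightarrow> bool" where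
  "isometry U \<longleftrightarrow> (\<forall>x y. U (x + y) = U x + U y) \<and> (\<forall>c x. U (c *\<^sub>C x) = c *\<^sub>C U x) \<and>
     (\<forall>x. norm (U x) = norm x)"

section \<open>Row contractions\<close>

text \<open>Tuples \<open>[T\<^sub>1, \<dots>, T\<^sub>n]\<close> are indexed by a finite type \<open>'n\<close> with \<open>n = CARD('n)\<close>.\<close>

definition row_defect :: "('n::finite \<Rightarrow> 'a::complex_hilbert \<Rightarrow> 'a) \<Rightarrow> 'a \<Rightarrow> 'a" where
  "row_defect T x = x - (\<Sum>i\<in>UNIV. T i (cadjoint UNIV (T i) x))"

definition row_contraction :: "('n::finite \<Rightarrow> 'a::complex_hilbert \<Rightarrow> 'a) \<Rightarrow> bool" where
  "row_contraction T \<longleftrightarrow> (\<forall>i. bounded_op UNIV (T i)) \<and> positive_op (row_defect T)"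

definition defect_op :: "('n::finite \<Rightarrow> 'a::complex_hilbert \<Rightarrow> 'a) \<Rightarrow> 'a \<Rightarrow> 'a" where
  "defect_op T = op_sqrt (row_defect T)"

definition rank_op :: "('a::complex_hilbert \<Rightarrow> 'a) \<Rightarrow> 'a rel" where
  "rank_op A = hdim (closure (range A))"

section \<open>Noncommutative polynomials\<close>

text \<open>
  A polynomial in the noncommuting indeterminates \<open>X\<^sub>i\<close>, \<open>i :: 'n\<close>, is the finitely supported family
  of its coefficients, indexed by words.
\<close>

type_synonym 'n ncpoly = "'n list \<Rightarrow>\<^sub>0 complex"

definition word_op :: "('n \<Rightarrow> 'a \<Rightarrow> 'a) \<Rightarrow> 'n list \<Rightarrow> 'a \<Rightarrow> 'a" where
  "word_op T w = foldr (\<lambda>i A. T i \<circ> A) w id"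

definition poly_eval :: "('n \<Rightarrow> 'a::complex_hilbert \<Rightarrow> 'a) \<Rightarrow> 'n ncpoly \<Rightarrow> 'a \<Rightarrow> 'a" where
  "poly_eval T p x = (\<Sum>w\<in>Poly_Mapping.keys p. Poly_Mapping.lookup p w *\<^sub>C word_op T w x)"

section \<open>The full Fock space and the noncommutative analytic Toeplitz algebra\<close>

text \<open>
  The full Fock space over the \<open>n\<close>-dimensional Hilbert space with orthonormal basis \<open>(e\<^sub>i)\<close>, in
  coordinates with respect to its orthonormal basis of words: \<open>l2_nth \<phi> [i\<^sub>1, \<dots>, i\<^sub>k]\<close> is the
  coefficient of \<open>\<phi>\<close> at \<open>e\<^bsub>i\<^sub>1\<^esub> \<otimes> \<dots> \<otimes> e\<^bsub>i\<^sub>k\<^esub>\<close>, and the empty word is the vacuum vector \<open>1\<close>.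
\<close>

type_synonym 'n fock = "('n list, complex) l2"

definition creation :: "'n \<Rightarrow> 'n fock \<Rightarrow> 'n fock" where
  "creation i \<phi> = Abs_l2 (\<lambda>w. case w of [] \<Rightarrow> 0 | j # v \<Rightarrow> if j = i then l2_nth \<phi> v else 0)"

lemma l2_nth_creation:
  "l2_nth (creation i \<phi>) w = (case w of [] \<Rightarrow> 0 | j # v \<Rightarrow> if j = i then l2_nth \<phi> v else 0)"
proof -
  let ?f = "\<lambda>w. case w of [] \<Rightarrow> 0 | j # v \<Rightarrow> if j = i then l2_nth \<phi> v else 0"
  have "(\<lambda>w. (norm (?f w))\<^sup>2) summable_on range ((#) i)"
    using l2_nth_summable[of \<phi>] by (subst summable_on_reindex) (simp_all add: o_def)
  also have "?this \<longleftrightarrow> (\<lambda>w. (norm (?f w))\<^sup>2) summable_on UNIV"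
    by (rule summable_on_cong_neutral) (auto split: list.splits)
  finally show ?thesis by (simp add: creation_def Abs_l2_inverse)
qed

definition weak_operator_topology :: "('a::complex_hilbert \<Rightarrow> 'a) topology" where
  "weak_operator_topology =
     pullback_topology (Collect (bounded_op UNIV)) (\<lambda>A (x, y). cinner (A x) y) euclidean"

definition wot_closed_algebra :: "('a::complex_hilbert \<Rightarrow> 'a) set \<Rightarrow> bool" where
  "wot_closed_algebra \<A> \<longleftrightarrow>
     closedin weak_operator_topology \<A> \<and>
     (\<forall>A\<in>\<A>. \<forall>B\<in>\<A>. (\<lambda>x. A x + B x) \<in> \<A> \<and> A \<circ> B \<in> \<A>) \<and>
     (\<forall>c. \<forall>A\<in>\<A>. (\<lambda>x. c *\<^sub>C A x) \<in> \<A>)"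

definition toeplitz_alg :: "('n::finite fock \<Rightarrow> 'n fock) set" where
  "toeplitz_alg = wot_closed_algebra hull (insert id (range creation))"

definition wot_closed_ideal :: "('n::finite fock \<Rightarrow> 'n fock) set \<Rightarrow> bool" where
  "wot_closed_ideal J \<longleftrightarrow>
     J \<subseteq> toeplitz_alg \<and> closedin weak_operator_topology J \<and> (\<lambda>x. 0) \<in> J \<and>
     (\<forall>A\<in>J. \<forall>B\<in>J. (\<lambda>x. A x + B x) \<in> J) \<and>
     (\<forall>c. \<forall>A\<in>J. (\<lambda>x. c *\<^sub>C A x) \<in> J) \<and>
     (\<forall>A\<in>J. \<forall>B\<in>toeplitz_alg. A \<circ> B \<in> J \<and> B \<circ> A \<in> J)"

definition generated_ideal :: "'n::finite ncpoly set \<Rightarrow> ('n fock \<Rightarrow> 'n fock) set" where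
  "generated_ideal P = wot_closed_ideal hull (poly_eval creation ` P)"

definition N_space :: "('n::finite fock \<Rightarrow> 'n fock) set \<Rightarrow> 'n fock set" where
  "N_space J = ocomp (closure (cspan {A \<phi> | A \<phi>. A \<in> J}))"

definition B_shift :: "('n::finite fock \<Rightarrow> 'n fock) set \<Rightarrow> 'n \<Rightarrow> 'n fock \<Rightarrow> 'n fock" where
  "B_shift J i \<phi> = proj (N_space J) (creation i \<phi>)"

section \<open>Hilbert tensor products with the Fock space\<close>

text \<open>
  For closed subspaces \<open>M\<close> of the Fock space and \<open>D\<close> of \<open>'a\<close>, the Hilbert space tensor product of
  \<open>M\<close> and \<open>D\<close> is realised inside the square-summable families of vectors of \<open>'a\<close> indexed by words,
  with \<open>\<phi> \<otimes> d\<close> being \<open>w \<mapsto> \<phi>\<^sub>w d\<close>; thus \<open>\<langle>\<phi> \<otimes> d, \<psi> \<otimes> e\<rangle> = \<langle>\<phi>, \<psi>\<rangle> \<langle>d, e\<rangle>\<close>.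
\<close>

definition tensor :: "'n fock \<Rightarrow> 'a::complex_hilbert \<Rightarrow> ('n list, 'a) l2" where
  "tensor \<phi> d = Abs_l2 (\<lambda>w. l2_nth \<phi> w *\<^sub>C d)"

lemma l2_nth_tensor: "l2_nth (tensor \<phi> d) w = l2_nth \<phi> w *\<^sub>C d"
proof -
  have "(\<lambda>w. (norm (l2_nth \<phi> w *\<^sub>C d))\<^sup>2) summable_on UNIV"
    using summable_on_cmult_left[OF l2_nth_summable[of \<phi>], of "(norm d)\<^sup>2"]
    by (simp add: norm_scaleC power_mult_distrib)
  then show ?thesis by (simp add: tensor_def Abs_l2_inverse)
qed

lemma cinner_tensor: "cinner (tensor \<phi> d) (tensor \<psi> e) = cinner \<phi> \<psi> * cinner d e"
proof -
  have *: "cinner x (c *\<^sub>C y) = cnj c * cinner x y" for c and x y :: 'b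
    by (metis cinner_commute cinner_scaleC_left complex_cnj_mult complex_cnj_cnj)
  have "cinner (tensor \<phi> d) (tensor \<psi> e)
      = (\<Sum>\<^sub>\<infinity>w. (l2_nth \<phi> w * cnj (l2_nth \<psi> w)) * cinner d e)"
    unfolding cinner_l2_def[of "tensor \<phi> d"]
    by (simp add: l2_nth_tensor cinner_scaleC_left * mult.assoc mult.left_commute)
  also have "\<dots> = cinner \<phi> \<psi> * cinner d e"
    by (subst infsum_cmult_left') (simp add: cinner_l2_def cinner_complex_def)
  finally show ?thesis .
qed

definition htensor :: "'n fock set \<Rightarrow> 'a::complex_hilbert set \<Rightarrow> ('n list, 'a) l2 set" where
  "htensor M D = closure (cspan {tensor \<phi> d | \<phi> d. \<phi> \<in> M \<and> d \<in> D})"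

text \<open>
  \<open>A \<otimes> I\<^sub>D\<close> for a bounded operator \<open>A\<close> on \<open>M\<close>.  On \<open>htensor M D\<close> it is determined by continuity
  and linearity; the choice made by \<open>SOME\<close> only affects values outside \<open>htensor M D\<close>.
\<close>

definition tensor_id ::
  "'n fock set \<Rightarrow> 'a::complex_hilbert set \<Rightarrow> ('n fock \<Rightarrow> 'n fock) \<Rightarrow> ('n list, 'a) l2 \<Rightarrow> ('n list, 'a) l2"
  where
  "tensor_id M D A = (SOME G. bounded_op (htensor M D) G \<and>
     (\<forall>\<phi>\<in>M. \<forall>d\<in>D. G (tensor \<phi> d) = tensor (A \<phi>) d))"

section \<open>Constrained dilations and the dilation index\<close>

definition dil_space ::
  "('n::finite fock \<Rightarrow> 'n fock) set \<Rightarrow> 'a::complex_hilbert set \<Rightarrow> 'b::complex_hilbert set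
    \<Rightarrow> (('n list, 'a) l2 \<times> 'b) set" where
  "dil_space J D K = htensor (N_space J) D \<times> K"

definition dil_op ::
  "('n::finite fock \<Rightarrow> 'n fock) set \<Rightarrow> 'a::complex_hilbert set \<Rightarrow> ('n \<Rightarrow> 'b::complex_hilbert \<Rightarrow> 'b)
    \<Rightarrow> 'n \<Rightarrow> ('n list, 'a) l2 \<times> 'b \<Rightarrow> ('n list, 'a) l2 \<times> 'b" where
  "dil_op J D Z i = (\<lambda>(f, k). (tensor_id (N_space J) D (B_shift J i) f, Z i k))"

text \<open>
  \<open>U\<close> is the isometry identifying the space \<open>'h\<close> with a subspace of the dilation space.
\<close>

definition constrained_dilation ::
  "('n::finite fock \<Rightarrow> 'n fock) set \<Rightarrow> 'n ncpoly set \<Rightarrow> ('n \<Rightarrow> 'h::complex_hilbert \<Rightarrow> 'h)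
    \<Rightarrow> 'a::complex_hilbert set \<Rightarrow> 'b::complex_hilbert set \<Rightarrow> ('n \<Rightarrow> 'b \<Rightarrow> 'b)
    \<Rightarrow> ('h \<Rightarrow> ('n list, 'a) l2 \<times> 'b) \<Rightarrow> bool" where
  "constrained_dilation J P T D K Z U \<longleftrightarrow>
     closed_csubspace D \<and> closed_csubspace K \<and>
     (\<forall>i. bounded_op K (Z i)) \<and>
     (\<forall>k\<in>K. (\<Sum>i\<in>UNIV. Z i (cadjoint K (Z i) k)) = k) \<and>
     (\<forall>p\<in>P. \<forall>v\<in>dil_space J D K. poly_eval (dil_op J D Z) p v = 0) \<and>
     isometry U \<and> range U \<subseteq> dil_space J D K \<and>
     (\<forall>i. \<forall>v\<in>range U. cadjoint (dil_space J D K) (dil_op J D Z i) v \<in> range U) \<and>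
     (\<forall>i h. U (T i h) = proj (range U) (dil_op J D Z i (U h)))"

text \<open>
  HOL cannot quantify over all Hilbert spaces inside a formula, so \<open>D\<close> and \<open>K\<close> range over the closed
  subspaces of a universe \<open>'h \<times> 'u\<close>, where \<open>'u\<close> is an arbitrary Hilbert space type (the factor \<open>'h\<close>
  only ensures that the universe is not too small for the given \<open>T\<close>).  Any pair of
  Hilbert spaces \<open>'d\<close>, \<open>'k\<close> is covered by taking \<open>'u = 'd \<times> 'k\<close>.
\<close>

definition dil_dims ::
  "('n::finite fock \<Rightarrow> 'n fock) set \<Rightarrow> 'n ncpoly set \<Rightarrow> ('n \<Rightarrow> 'h::complex_hilbert \<Rightarrow> 'h)
    \<Rightarrow> ('h \<times> 'u::complex_hilbert) rel set" where
  "dil_dims J P T =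
     {hdim D | D (K :: ('h \<times> 'u) set) Z U. constrained_dilation J P T D K Z U}"

text \<open>The minimum of a set of cardinals, which is unique up to \<open>=o\<close>.\<close>

definition dil_ind ::
  "'u::complex_hilbert itself \<Rightarrow> ('n::finite fock \<Rightarrow> 'n fock) set \<Rightarrow> 'n ncpoly set
    \<Rightarrow> ('n \<Rightarrow> 'h::complex_hilbert \<Rightarrow> 'h) \<Rightarrow> ('h \<times> 'u) rel" where
  "dil_ind _ J P T = (SOME \<kappa>. \<kappa> \<in> dil_dims J P T \<and>
     (\<forall>\<kappa>'\<in>(dil_dims J P T :: ('h \<times> 'u) rel set). \<kappa> \<le>o \<kappa>'))"

end

theory Submission
  imports Defs
begin

text \<open>
  If \<open>V\<close> is a constrained dilation of \<open>T\<close>, then \<open>T\<^sub>i\<^sup>*\<close> is the restriction of \<open>V\<^sub>i\<^sup>*\<close>, and on \<open>\<N>\<^sub>J \<otimes> D\<close>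
  the latter is the restriction of \<open>S\<^sub>i\<^sup>* \<otimes> I\<close>.  So \<open>\<parallel>\<Delta>\<^sub>T h\<parallel>\<^sup>2 = \<parallel>h\<parallel>\<^sup>2 - \<Sum> \<parallel>T\<^sub>i\<^sup>* h\<parallel>\<^sup>2\<close> is the square norm of the
  vacuum component of the image of \<open>h\<close>, a vector of \<open>D\<close>; hence the closure of the range of \<open>\<Delta>\<^sub>T\<close> embeds isometrically
  into \<open>D\<close>.  Conversely, the Poisson kernel \<open>h \<mapsto> \<Sum>\<^sub>w e\<^sub>w \<otimes> \<Delta>\<^sub>T T\<^sub>w\<^sup>* h\<close> maps into \<open>\<N>\<^sub>J \<otimes> D\<close> with
  \<open>D\<close> the closure of the range of \<open>\<Delta>\<^sub>T\<close>, and its defect is absorbed by a tuple \<open>Z\<close> with \<open>\<Sum> Z\<^sub>i Z\<^sub>i\<^sup>* = I\<close>.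
\<close>

text \<open>Adjoints carry the argument. Compressions to N_J \<otimes> D are awkward to multiply,
  whereas their adjoints are plain backward shifts, so polynomial relations are tested weakly, with
  the letters moved one by one to the other side. The relations p(V) = 0 have to be verified on the
  Z part as well; there they are inherited from T by an intertwining of adjoints. The ideal J is
  given only as a hull. That a vector lies in N_J is therefore shown by producing a competing ideal
  whose ranges are orthogonal to it. The operator Q absorbed by Z is the limit of the sums of T_w
  T_w^* over words of length k. Taking it as the complement of K^* K for the Poisson kernel K avoids
  that limit, and \<Sum> T_i Q T_i^* = Q becomes the difference of two norm identities. Dimensions
  are cardinals, so equality is proved as two inequalities, and the minimum exists because a lower
  bound for all dilations is reached by one of them.\<close>

section \<open>Bilinear calculus of the complex inner product\<close>

lemma cinner_add_right: "cinner x (y + z) = cinner x y + cinner x (z :: 'a :: complex_hilbert)"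
  by (metis cinner_add_left cinner_commute complex_cnj_add)

lemma cinner_scaleC_right: "cinner x (c *\<^sub>C y) = cnj c * cinner x (y :: 'a :: complex_hilbert)"
  by (metis cinner_commute cinner_scaleC_left complex_cnj_mult)

lemma bounded_bilinear_cinner:
  "bounded_bilinear (cinner :: 'a::complex_hilbert \<Rightarrow> 'a \<Rightarrow> complex)"
proof (rule bounded_bilinear.intro)
  show "cinner (r *\<^sub>R a) b = r *\<^sub>R cinner a b" "cinner a (r *\<^sub>R b) = r *\<^sub>R cinner a b"
    for r and a b :: 'a
    by (simp_all add: cinner_scaleC_left cinner_scaleC_right scaleR_conv_of_real
        flip: scaleC_of_real)
  show "\<exists>K. \<forall>a b :: 'a. norm (cinner a b) \<le> norm a * norm b * K"
    by (intro exI[of _ 2]) (metis norm_cinner_le mult.commute)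
qed (simp_all add: cinner_add_left cinner_add_right)

lemma bounded_bilinear_scaleC:
  "bounded_bilinear (scaleC :: complex \<Rightarrow> 'a::complex_hilbert \<Rightarrow> 'a)"
proof (rule bounded_bilinear.intro)
  show "(r *\<^sub>R a) *\<^sub>C b = r *\<^sub>R a *\<^sub>C b" "a *\<^sub>C r *\<^sub>R b = r *\<^sub>R a *\<^sub>C b"
    for r a and b :: 'a
    by (simp_all add: scaleC_scaleC scaleR_conv_of_real mult.commute flip: scaleC_of_real)
  show "\<exists>K. \<forall>a (b :: 'a). norm (a *\<^sub>C b) \<le> norm a * norm b * K"
    by (intro exI[of _ 1]) (simp add: norm_scaleC)
qed (simp_all add: scaleC_add_left scaleC_add_right)

interpretation cinner: bounded_bilinear "cinner :: 'a::complex_hilbert \<Rightarrow> 'a \<Rightarrow> complex"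
  by (rule bounded_bilinear_cinner)

interpretation scaleC: bounded_bilinear "scaleC :: complex \<Rightarrow> 'a::complex_hilbert \<Rightarrow> 'a"
  by (rule bounded_bilinear_scaleC)

lemma scaleC_minus_one: "(- 1) *\<^sub>C x = - (x :: 'a :: complex_hilbert)"
  by (simp add: scaleC.minus_left scaleC_one)

lemma cinner_eq_0_commute: "cinner x y = 0 \<longleftrightarrow> cinner y (x :: 'a :: complex_hilbert) = 0"
  by (metis cinner_commute complex_cnj_zero)

lemma norm_add_sq:
  "(norm (x + y))\<^sup>2 = (norm x)\<^sup>2 + 2 * Re (cinner x y) + (norm (y :: 'a :: complex_hilbert))\<^sup>2"
  by (simp add: Re_cinner power2_norm_eq_inner inner_simps inner_commute)

lemma cinner_self_eq_0 [simp]: "cinner x x = 0 \<longleftrightarrow> (x :: 'a :: complex_hilbert) = 0"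
  by (simp add: cinner_self)

lemma cinner_eqI:
  assumes "\<And>x. cinner x y = cinner x (z :: 'a :: complex_hilbert)"
  shows "y = z"
  using assms[of "y - z"] by (metis cinner.diff_right cinner_self_eq_0 eq_iff_diff_eq_0)

section \<open>Subspaces and orthogonal projections\<close>

lemma csubspace_0: "csubspace M \<Longrightarrow> 0 \<in> M"
  and csubspace_add: "csubspace M \<Longrightarrow> x \<in> M \<Longrightarrow> y \<in> M \<Longrightarrow> x + y \<in> M"
  and csubspace_scaleC: "csubspace M \<Longrightarrow> x \<in> M \<Longrightarrow> c *\<^sub>C x \<in> M"
  by (auto simp: csubspace_def)

lemma csubspace_diff: "csubspace M \<Longrightarrow> x \<in> M \<Longrightarrow> y \<in> M \<Longrightarrow> x - y \<in> M"
  using csubspace_add[of M x "- y"] csubspace_scaleC[of M y "-1"] by (simp add: scaleC_minus_one)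

lemma csubspace_sum: "csubspace M \<Longrightarrow> (\<And>i. i \<in> I \<Longrightarrow> f i \<in> M) \<Longrightarrow> (\<Sum>i\<in>I. f i) \<in> M"
  by (induction I rule: infinite_finite_induct) (auto simp: csubspace_0 csubspace_add)

lemma csubspace_cspan: "csubspace (cspan B)"
  unfolding cspan_def by (rule hull_in) (auto simp: csubspace_def)

lemma cspan_superset: "B \<subseteq> cspan B"
  unfolding cspan_def by (rule hull_subset)

lemma cspan_minimal: "B \<subseteq> M \<Longrightarrow> csubspace M \<Longrightarrow> cspan B \<subseteq> M"
  unfolding cspan_def by (rule hull_minimal)

lemma csubspace_closure:
  assumes "csubspace M"
  shows "csubspace (closure M)"
  unfolding csubspace_def
proof (intro conjI ballI allI)
  show "0 \<in> closure M" using csubspace_0[OF assms] closure_subset by blast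
next
  fix x y assume "x \<in> closure M" "y \<in> closure M"
  then obtain f g where "\<forall>n. f n \<in> M" "f \<longlonglongrightarrow> x" "\<forall>n. g n \<in> M" "g \<longlonglongrightarrow> y"
    by (auto simp: closure_sequential)
  then have "\<forall>n. f n + g n \<in> M" "(\<lambda>n. f n + g n) \<longlonglongrightarrow> x + y"
    using csubspace_add[OF assms] by (auto intro: tendsto_add)
  then show "x + y \<in> closure M"
    unfolding closure_sequential by (auto intro!: exI[of _ "\<lambda>n. f n + g n"])
next
  fix c x assume "x \<in> closure M"
  then obtain f where "\<forall>n. f n \<in> M" "f \<longlonglongrightarrow> x"
    by (auto simp: closure_sequential)
  then have "\<forall>n. c *\<^sub>C f n \<in> M" "(\<lambda>n. c *\<^sub>C f n) \<longlonglongrightarrow> c *\<^sub>C x"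
    using csubspace_scaleC[OF assms] by (auto intro: scaleC.tendsto)
  then show "c *\<^sub>C x \<in> closure M"
    unfolding closure_sequential by (auto intro!: exI[of _ "\<lambda>n. c *\<^sub>C f n"])
qed

lemma closed_csubspace_closure: "csubspace M \<Longrightarrow> closed_csubspace (closure M)"
  by (simp add: closed_csubspace_def csubspace_closure)

lemma closed_csubspace_UNIV: "closed_csubspace UNIV"
  by (simp add: closed_csubspace_def csubspace_def)

lemma closed_csubspace_Times:
  "closed_csubspace M \<Longrightarrow> closed_csubspace N \<Longrightarrow> closed_csubspace (M \<times> N)"
  by (auto simp: closed_csubspace_def csubspace_def closed_Times scaleC_prod_def zero_prod_def)

lemma closed_csubspace_minimal:
  "B \<subseteq> M \<Longrightarrow> closed_csubspace M \<Longrightarrow> closure (cspan B) \<subseteq> M"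
  by (simp add: closed_csubspace_def closure_minimal cspan_minimal)

lemma subset_closure_cspan: "B \<subseteq> closure (cspan B)"
  using cspan_superset closure_subset by blast

lemma closed_csubspace_closure_cspan: "closed_csubspace (closure (cspan B))"
  by (intro closed_csubspace_closure csubspace_cspan)

lemma closed_csubspace_ocomp: "closed_csubspace (ocomp M)"
  unfolding closed_csubspace_def
proof
  show "csubspace (ocomp M)"
    by (auto simp: csubspace_def ocomp_def cinner_add_right cinner_scaleC_right cinner.zero_right)
  have "ocomp M = (\<Inter>x\<in>M. {y. cinner x y = 0})" by (auto simp: ocomp_def)
  also have "closed \<dots>"
    by (intro closed_INT ballI closed_Collect_eq cinner.continuous_on continuous_intros)
  finally show "closed (ocomp M)" .
qed

text \<open>The double complement of \<open>B\<close> is a closed subspace containing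
  \<open>B\<close>, hence contains its closed span. Orthogonality can thus be checked on
  generators.\<close>

lemma ocomp_closure_cspan: "ocomp (closure (cspan B)) = ocomp B"
proof
  show "ocomp (closure (cspan B)) \<subseteq> ocomp B"
    using subset_closure_cspan by (fastforce simp: ocomp_def)
  have "B \<subseteq> ocomp (ocomp B)" using cinner_eq_0_commute by (fastforce simp: ocomp_def)
  then have "closure (cspan B) \<subseteq> ocomp (ocomp B)"
    by (rule closed_csubspace_minimal[OF _ closed_csubspace_ocomp])
  then show "ocomp B \<subseteq> ocomp (closure (cspan B))"
    using cinner_eq_0_commute by (fastforce simp: ocomp_def)
qed

lemma closed_csubspace_proj_ex:
  fixes M :: "'a::complex_hilbert set"
  assumes M: "closed_csubspace M"
  shows "\<exists>y\<in>M. x - y \<in> ocomp M"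
proof -
  have cs: "csubspace M" and cl: "closed M" using M by (auto simp: closed_csubspace_def)
  define d where "d = (INF y\<in>M. (norm (x - y))\<^sup>2)"
  have bdd: "bdd_below ((\<lambda>y. (norm (x - y))\<^sup>2) ` M)" by (rule bdd_belowI2[of _ 0]) simp
  have ne: "M \<noteq> {}" using csubspace_0[OF cs] by auto
  have d_le: "d \<le> (norm (x - y))\<^sup>2" if "y \<in> M" for y
    unfolding d_def by (rule cINF_lower[OF bdd that])
  have "\<exists>y\<in>M. (norm (x - y))\<^sup>2 < d + 1 / Suc n" for n
    using cINF_less_iff[OF ne bdd, of "d + 1 / Suc n"] by (simp add: d_def)
  then obtain y where y: "\<And>n. y n \<in> M" "\<And>n. (norm (x - y n))\<^sup>2 < d + 1 / Suc n" by metis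
  \<comment> \<open>Parallelogram law: the midpoint lies in \<open>M\<close>, so its squared
    distance from \<open>x\<close> is at least \<open>d\<close>, while the two points exceed
    \<open>d\<close> by less than \<open>1 / Suc m\<close> and \<open>1 / Suc n\<close>.\<close>
  have par: "(norm (y m - y n))\<^sup>2 \<le> 2 / Suc m + 2 / Suc n" for m n
  proof -
    have "(norm (y m - y n))\<^sup>2 = 2 * (norm (x - y m))\<^sup>2 + 2 * (norm (x - y n))\<^sup>2
        - 4 * (norm (x - (1/2) *\<^sub>R (y m + y n)))\<^sup>2"
      unfolding power2_norm_eq_inner by (simp add: inner_simps inner_commute algebra_simps)
    moreover have "(1/2) *\<^sub>R (y m + y n) \<in> M"
      using csubspace_scaleC[OF cs csubspace_add[OF cs y(1)[of m] y(1)[of n]], of "complex_of_real (1/2)"]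
      by (simp only: scaleC_of_real)
    ultimately show ?thesis using d_le[of "(1/2) *\<^sub>R (y m + y n)"] y(2)[of m] y(2)[of n] by simp
  qed
  have "Cauchy y"
  proof (rule CauchyI)
    fix e :: real assume e: "0 < e"
    then obtain N :: nat where N: "4 / e\<^sup>2 < N" using reals_Archimedean2 by blast
    then have N0: "N > 0" using e by (metis divide_pos_pos gr0I less_asym of_nat_0 zero_less_numeral zero_less_power)
    show "\<exists>N. \<forall>m\<ge>N. \<forall>n\<ge>N. norm (y m - y n) < e"
    proof (intro exI allI impI)
      fix m n assume "m \<ge> N" "n \<ge> N"
      then have "2 / Suc m + 2 / Suc n \<le> 2 / N + 2 / (N::real)"
        using N0 by (intro add_mono divide_left_mono) auto
      also have "\<dots> < e\<^sup>2" using N N0 e by (simp add: field_simps)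
      finally have "(norm (y m - y n))\<^sup>2 < e\<^sup>2" using par[of m n] by simp
      then show "norm (y m - y n) < e" by (rule power_less_imp_less_base) (use e in simp)
    qed
  qed
  then obtain z where z: "y \<longlonglongrightarrow> z" using Cauchy_convergent convergent_def by blast
  have zM: "z \<in> M" using closed_sequentially[OF cl] y(1) z by blast
  have zd: "(norm (x - z))\<^sup>2 \<le> d"
  proof (rule LIMSEQ_le)
    show "(\<lambda>n. (norm (x - y n))\<^sup>2) \<longlonglongrightarrow> (norm (x - z))\<^sup>2" by (intro tendsto_intros z)
    show "(\<lambda>n. d + 1 / Suc n) \<longlonglongrightarrow> d"
      using tendsto_add[OF tendsto_const[of d] LIMSEQ_Suc[OF lim_1_over_n]] by simp
    show "\<exists>N. \<forall>n\<ge>N. (norm (x - y n))\<^sup>2 \<le> d + 1 / Suc n" using y(2) less_imp_le by blast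
  qed
  have re: "inner (x - z) v = 0" if v: "v \<in> M" for v
  proof (cases "v = 0")
    case False
    define t where "t = inner (x - z) v / (norm v)\<^sup>2"
    have "z + t *\<^sub>R v \<in> M"
      using csubspace_add[OF cs zM csubspace_scaleC[OF cs v, of "complex_of_real t"]]
      by (simp add: scaleC_of_real)
    then have "(norm (x - z))\<^sup>2 \<le> (norm (x - (z + t *\<^sub>R v)))\<^sup>2" by (intro order_trans[OF zd] d_le)
    also have "\<dots> = (norm (x - z))\<^sup>2 - 2 * t * inner (x - z) v + t\<^sup>2 * (norm v)\<^sup>2"
      unfolding power2_norm_eq_inner
      by (simp add: inner_simps inner_commute algebra_simps power2_eq_square)
    also have "\<dots> = (norm (x - z))\<^sup>2 - (inner (x - z) v)\<^sup>2 / (norm v)\<^sup>2"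
      using False by (simp add: t_def power2_eq_square field_simps)
    finally have "(inner (x - z) v)\<^sup>2 / (norm v)\<^sup>2 \<le> 0" by simp
    then show ?thesis using False by (simp add: divide_le_0_iff)
  qed simp
  \<comment> \<open>Minimality gives only real orthogonality; applying it to
    \<open>\<i> *\<^sub>C v\<close> yields the imaginary part.\<close>
  have "cinner v (x - z) = 0" if v: "v \<in> M" for v
  proof (rule complex_eqI)
    show "Re (cinner v (x - z)) = Re 0" using re[OF v] by (simp add: Re_cinner inner_commute)
    have "Re (cinner (\<i> *\<^sub>C v) (x - z)) = 0"
      using re[OF csubspace_scaleC[OF cs v]] by (simp add: Re_cinner inner_commute)
    then show "Im (cinner v (x - z)) = Im 0" by (simp add: cinner_scaleC_left)
  qed
  then show ?thesis using zM by (auto simp: ocomp_def)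
qed

lemma proj_eqI:
  assumes "csubspace M" "y \<in> M" "x - y \<in> ocomp M"
  shows "proj M x = y"
  unfolding proj_def
proof (rule the_equality)
  fix z assume z: "z \<in> M \<and> x - z \<in> ocomp M"
  have "csubspace (ocomp M)" using closed_csubspace_ocomp closed_csubspace_def by blast
  from csubspace_diff[OF this] z assms have "(x - y) - (x - z) \<in> ocomp M" by blast
  then have "z - y \<in> ocomp M" by simp
  moreover have "z - y \<in> M" using z assms csubspace_diff by blast
  ultimately have "cinner (z - y) (z - y) = 0" by (simp only: ocomp_def mem_Collect_eq)
  then show "z = y" by simp
qed (use assms in auto)

lemma
  assumes "closed_csubspace M"
  shows proj_in: "proj M x \<in> M" and proj_ocomp: "x - proj M x \<in> ocomp M"
proof -
  obtain y where y: "y \<in> M" "x - y \<in> ocomp M" using closed_csubspace_proj_ex[OF assms] by blast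
  with assms have "proj M x = y" by (intro proj_eqI) (auto simp: closed_csubspace_def)
  with y show "proj M x \<in> M" "x - proj M x \<in> ocomp M" by auto
qed

lemma cinner_proj_left:
  assumes "closed_csubspace M" "y \<in> M"
  shows "cinner (proj M x) y = cinner x y"
proof -
  have "cinner y (x - proj M x) = 0" using proj_ocomp[OF assms(1)] assms(2) by (auto simp: ocomp_def)
  then show ?thesis by (subst (asm) cinner_eq_0_commute) (simp add: cinner.diff_left)
qed

lemma cinner_csubspace_eqI:
  assumes "csubspace M" "y \<in> M" "z \<in> M" "\<And>x. x \<in> M \<Longrightarrow> cinner y x = cinner z x"
  shows "y = z"
  using assms(4)[OF csubspace_diff[OF assms(1-3)]]
  by (metis cinner.diff_left cinner_self_eq_0 eq_iff_diff_eq_0)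

text \<open>The difference is orthogonal to the generators, hence to the closed span in which it
  lies. Equalities in tensor products reduce in this way to elementary tensors.\<close>

lemma closure_cspan_eqI:
  assumes "y \<in> closure (cspan B)" "z \<in> closure (cspan B)" "\<And>x. x \<in> B \<Longrightarrow> cinner y x = cinner z x"
  shows "y = z"
proof -
  have "y - z \<in> ocomp B"
    using assms(3) by (auto simp: ocomp_def cinner.diff_right) (metis cinner_commute)
  then have "y - z \<in> ocomp (closure (cspan B))" by (simp add: ocomp_closure_cspan)
  moreover have "y - z \<in> closure (cspan B)"
    using assms(1,2) closed_csubspace_closure_cspan[of B] csubspace_diff
    by (auto simp: closed_csubspace_def)
  ultimately have "cinner (y - z) (y - z) = 0" by (simp only: ocomp_def mem_Collect_eq)
  then show ?thesis by simp
qed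

lemma bounded_op_proj:
  assumes "closed_csubspace M"
  shows "bounded_op UNIV (proj M)"
proof -
  have cs: "csubspace M" using assms by (simp add: closed_csubspace_def)
  have oc: "csubspace (ocomp M)" using closed_csubspace_ocomp closed_csubspace_def by blast
  have "proj M (x + y) = proj M x + proj M y" for x y
    using csubspace_add[OF oc proj_ocomp[OF assms, of x] proj_ocomp[OF assms, of y]]
    by (intro proj_eqI[OF cs] csubspace_add[OF cs] proj_in[OF assms]) (simp add: algebra_simps)
  moreover have "proj M (c *\<^sub>C x) = c *\<^sub>C proj M x" for c x
    using csubspace_scaleC[OF oc proj_ocomp[OF assms, of x], of c]
    by (intro proj_eqI[OF cs] csubspace_scaleC[OF cs] proj_in[OF assms])
      (simp add: scaleC.diff_right)
  moreover have "norm (proj M x) \<le> norm x" for x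
  proof -
    have "(norm (x - proj M x + proj M x))\<^sup>2 \<ge> (norm (proj M x))\<^sup>2"
      unfolding norm_add_sq using cinner_proj_left[OF assms proj_in[OF assms], of x x]
      by (simp add: cinner.diff_left)
    then show ?thesis by (simp add: power2_le_iff_abs_le)
  qed
  ultimately show ?thesis unfolding bounded_op_def by (auto intro: exI[of _ 1])
qed

section \<open>Riesz representation and adjoints\<close>

text \<open>The kernel \<open>N\<close> is closed, and when \<open>f\<close> is nonzero its
  complement in \<open>M\<close> is spanned by one vector \<open>u\<close>; the representing vector
  is a multiple of \<open>u\<close>. The form relative to \<open>M\<close> suits operators that
  carry meaning only on a subspace.\<close>

lemma riesz_representation:
  fixes M :: "'a::complex_hilbert set"
  assumes M: "closed_csubspace M"
    and add: "\<And>x y. x \<in> M \<Longrightarrow> y \<in> M \<Longrightarrow> f (x + y) = f x + f y"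
    and scale: "\<And>c x. x \<in> M \<Longrightarrow> f (c *\<^sub>C x) = c * f x"
    and bound: "\<And>x. x \<in> M \<Longrightarrow> cmod (f x) \<le> C * norm x"
  shows "\<exists>z\<in>M. \<forall>x\<in>M. f x = cinner x z"
proof -
  have cs: "csubspace M" and cl: "closed M" using M by (auto simp: closed_csubspace_def)
  have diff: "f (x - y) = f x - f y" if "x \<in> M" "y \<in> M" for x y
    using add[OF that(1) csubspace_scaleC[OF cs that(2)], of "-1"] scale[OF that(2), of "-1"]
    by (simp add: scaleC_minus_one)
  define N where "N = {x\<in>M. f x = 0}"
  have "csubspace N"
    using csubspace_0[OF cs] csubspace_add[OF cs] csubspace_scaleC[OF cs] add scale diff[of 0 0]
    by (auto simp: N_def csubspace_def)
  moreover have "closed N"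
    unfolding closed_sequential_limits
  proof (intro allI impI, elim conjE)
    fix x l assume x: "\<forall>n. x n \<in> N" and l: "x \<longlonglongrightarrow> l"
    have lM: "l \<in> M" using closed_sequentially[OF cl _ l] x by (auto simp: N_def)
    have "cmod (f l) \<le> 0"
    proof (rule LIMSEQ_le_const)
      show "(\<lambda>n. C * norm (l - x n)) \<longlonglongrightarrow> 0"
        using tendsto_mult[OF tendsto_const tendsto_norm[OF tendsto_diff[OF tendsto_const l]], of C l]
        by simp
      have "cmod (f l) \<le> C * norm (l - x n)" for n
        using bound[OF csubspace_diff[OF cs lM, of "x n"]] diff[OF lM, of "x n"] x
        by (auto simp: N_def)
      then show "\<exists>N. \<forall>n\<ge>N. cmod (f l) \<le> C * norm (l - x n)" by blast
    qed
    then show "l \<in> N" using lM by (simp add: N_def)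
  qed
  ultimately have N: "closed_csubspace N" by (simp add: closed_csubspace_def)
  show ?thesis
  proof (cases "\<forall>x\<in>M. f x = 0")
    case True
    then show ?thesis using csubspace_0[OF cs] by (auto intro!: bexI[of _ 0] simp: cinner.zero_right)
  next
    case False
    then obtain x0 where x0: "x0 \<in> M" "f x0 \<noteq> 0" by blast
    define u where "u = x0 - proj N x0"
    have pN: "proj N x0 \<in> N" by (rule proj_in[OF N])
    then have uM: "u \<in> M" using x0 csubspace_diff[OF cs] by (auto simp: u_def N_def)
    have fu: "f u \<noteq> 0" using diff[OF x0(1), of "proj N x0"] pN x0 by (auto simp: u_def N_def)
    have uo: "u \<in> ocomp N" unfolding u_def by (rule proj_ocomp[OF N])
    have u0: "cinner u u \<noteq> 0"
      using fu diff[OF csubspace_0[OF cs] csubspace_0[OF cs]] by auto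
    define z where "z = cnj (f u / cinner u u) *\<^sub>C u"
    have "f x = cinner x z" if x: "x \<in> M" for x
    proof -
      have "f u *\<^sub>C x - f x *\<^sub>C u \<in> N"
        using x uM csubspace_diff[OF cs] csubspace_scaleC[OF cs] by (simp add: N_def diff scale)
      then have "cinner (f u *\<^sub>C x - f x *\<^sub>C u) u = 0" using uo by (simp add: ocomp_def)
      then have "f u * cinner x u = f x * cinner u u"
        by (simp add: cinner.diff_left cinner_scaleC_left)
      then show ?thesis using u0 by (simp add: z_def cinner_scaleC_right field_simps)
    qed
    then show ?thesis using csubspace_scaleC[OF cs uM] by (auto simp: z_def)
  qed
qed

lemma cadjoint_eqI:
  assumes "csubspace M" "z \<in> M" "\<And>x. x \<in> M \<Longrightarrow> cinner (A x) y = cinner x z"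
  shows "cadjoint M A y = z"
  unfolding cadjoint_def
proof (rule the_equality)
  fix z' assume z': "z' \<in> M \<and> (\<forall>x\<in>M. cinner (A x) y = cinner x z')"
  have "cinner x z' = cinner x z" if "x \<in> M" for x using assms z' that by metis
  then show "z' = z"
    using z' assms by (intro cinner_csubspace_eqI[of M]) (metis cinner_commute)+
qed (use assms in auto)

lemma
  assumes M: "closed_csubspace M" and A: "bounded_op M A"
  shows cadjoint_in: "cadjoint M A y \<in> M"
    and cinner_cadjoint: "x \<in> M \<Longrightarrow> cinner (A x) y = cinner x (cadjoint M A y)"
proof -
  obtain C where C: "\<And>x. x \<in> M \<Longrightarrow> norm (A x) \<le> C * norm x"
    using A unfolding bounded_op_def by metis
  have "\<exists>z\<in>M. \<forall>x\<in>M. cinner (A x) y = cinner x z"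
  proof (rule riesz_representation[OF M, where C = "C * norm y * 2"])
    fix x assume "x \<in> M"
    then have "norm (A x) * norm y \<le> C * norm x * norm y"
      by (intro mult_right_mono C norm_ge_zero)
    then show "cmod (cinner (A x) y) \<le> C * norm y * 2 * norm x"
      using norm_cinner_le[of "A x" y] by (simp add: mult_ac)
  qed (use A in \<open>auto simp: bounded_op_def cinner_add_left cinner_scaleC_left\<close>)
  then obtain z where z: "z \<in> M" "\<And>x. x \<in> M \<Longrightarrow> cinner (A x) y = cinner x z" by blast
  have "cadjoint M A y = z" using M z by (intro cadjoint_eqI) (auto simp: closed_csubspace_def)
  with z show "cadjoint M A y \<in> M" "x \<in> M \<Longrightarrow> cinner (A x) y = cinner x (cadjoint M A y)" by auto
qed

lemma cinner_cadjoint_UNIV: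
  assumes "bounded_op UNIV A"
  shows "cinner (A x) y = cinner x (cadjoint UNIV A y)" "cinner (cadjoint UNIV A y) x = cinner y (A x)"
  using cinner_cadjoint[OF closed_csubspace_UNIV assms] by (auto, metis cinner_commute)

lemma cadjoint_bounded_op:
  assumes M: "closed_csubspace M" and A: "bounded_op M A"
  shows "bounded_op M (cadjoint M A)"
proof -
  have cs: "csubspace M" using M by (simp add: closed_csubspace_def)
  note c = cadjoint_in[OF M A] cinner_cadjoint[OF M A]
  obtain C where C: "\<And>x. x \<in> M \<Longrightarrow> norm (A x) \<le> C * norm x"
    using A unfolding bounded_op_def by metis
  show ?thesis
    unfolding bounded_op_def
  proof (intro conjI ballI allI exI)
    fix x y assume "x \<in> M" "y \<in> M"
    show "cadjoint M A (x + y) = cadjoint M A x + cadjoint M A y"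
      by (rule cadjoint_eqI[OF cs csubspace_add[OF cs c(1) c(1)]]) (simp add: cinner_add_right c)
  next
    fix k x assume "x \<in> M"
    show "cadjoint M A (k *\<^sub>C x) = k *\<^sub>C cadjoint M A x"
      by (rule cadjoint_eqI[OF cs csubspace_scaleC[OF cs c(1)]]) (simp add: cinner_scaleC_right c)
  next
    fix y assume "y \<in> M"
    let ?z = "cadjoint M A y"
    have "(norm ?z)\<^sup>2 = Re (cinner (A ?z) y)" using c(2)[OF c(1), of y y] by (simp add: cinner_self)
    also have "\<dots> \<le> norm (A ?z) * norm y" by (simp add: Re_cinner norm_cauchy_schwarz)
    also have "\<dots> \<le> C * norm ?z * norm y" by (intro mult_right_mono C c(1) norm_ge_zero)
    finally have "norm ?z * norm ?z \<le> norm ?z * (C * norm y)" by (simp add: power2_eq_square mult_ac)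
    then have "norm ?z \<le> C * norm y \<or> norm ?z = 0" by (auto simp: mult_le_cancel_left)
    \<comment> \<open>The constant \<open>C\<close> may be negative when \<open>M\<close> is
      trivial, so the sign is read off from the bound on \<open>A y\<close>.\<close>
    moreover have "C * norm y \<ge> 0" by (rule order_trans[OF norm_ge_zero C[OF \<open>y \<in> M\<close>]])
    ultimately show "norm ?z \<le> C * norm y" by auto
  qed (rule c(1))
qed

section \<open>Hilbert space dimension\<close>

lemma is_onb_subset: "is_onb M B \<Longrightarrow> B \<subseteq> M"
  using subset_closure_cspan by (auto simp: is_onb_def)

lemma is_onb_exists:
  assumes M: "closed_csubspace M"
  shows "\<exists>B. is_onb M B"
proof -
  define \<A> where "\<A> = {B. B \<subseteq> M \<and> (\<forall>x\<in>B. \<forall>y\<in>B. cinner x y = (if x = y then 1 else 0))}"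
  have cs: "csubspace M" using M by (simp add: closed_csubspace_def)
  have "\<exists>B\<in>\<A>. \<forall>X\<in>\<A>. B \<subseteq> X \<longrightarrow> X = B"
  proof (rule subset_Zorn')
    fix C assume C: "subset.chain \<A> C"
    have "cinner x y = (if x = y then 1 else 0)" if "X \<in> C" "x \<in> X" "Y \<in> C" "y \<in> Y" for x y X Y
    proof -
      have "X \<subseteq> Y \<or> Y \<subseteq> X" using C that unfolding subset_chain_def by blast
      then have "\<exists>Z\<in>C. x \<in> Z \<and> y \<in> Z" using that(1-4) by blast
      then show ?thesis using C unfolding subset_chain_def \<A>_def by blast
    qed
    moreover have "\<Union>C \<subseteq> M" using C unfolding subset_chain_def \<A>_def by blast
    ultimately show "\<Union>C \<in> \<A>" unfolding \<A>_def by blast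
  qed
  then obtain B where B: "B \<in> \<A>" and max: "\<And>X. X \<in> \<A> \<Longrightarrow> B \<subseteq> X \<Longrightarrow> X = B" by blast
  let ?N = "closure (cspan B)"
  note N = closed_csubspace_closure_cspan[of B]
  have NM: "?N \<subseteq> M" using B M by (intro closed_csubspace_minimal) (auto simp: \<A>_def)
  moreover have "x \<in> ?N" if x: "x \<in> M" for x
  proof (rule ccontr)
    assume nx: "x \<notin> ?N"
    define u where "u = x - proj ?N x"
    have u0: "u \<noteq> 0" using nx proj_in[OF N, of x] by (auto simp: u_def)
    define e where "e = complex_of_real (1 / norm u) *\<^sub>C u"
    have "u \<in> ocomp B" using proj_ocomp[OF N, of x] by (simp add: u_def ocomp_closure_cspan)
    then have eB: "cinner b e = 0" "cinner e b = 0" if "b \<in> B" for b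
      using that cinner_eq_0_commute[of b e]
      by (auto simp: e_def ocomp_def cinner_scaleC_right)
    have ee: "cinner e e = 1"
      using u0 by (simp add: cinner_self e_def norm_scaleC norm_divide)
    have "u \<in> M" unfolding u_def using NM proj_in[OF N] x by (intro csubspace_diff[OF cs]) auto
    then have "e \<in> M" unfolding e_def by (rule csubspace_scaleC[OF cs])
    then have "insert e B \<in> \<A>" using B eB ee unfolding \<A>_def by auto
    then have "insert e B = B" using max by blast
    then show False using eB ee by fastforce
  qed
  ultimately have "is_onb M B" using B by (auto simp: is_onb_def \<A>_def)
  then show ?thesis by blast
qed

lemma cmod_cinner_commute: "cmod (cinner x y) = cmod (cinner y x)"
  by (metis cinner_commute complex_mod_cnj)

lemma cinner_orthonormal_sum:
  assumes "finite F" "\<forall>x\<in>F. \<forall>y\<in>F. cinner x y = (if x = y then 1 else 0)" "b \<in> F"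
  shows "cinner (\<Sum>x\<in>F. c x *\<^sub>C x) b = c b"
proof -
  have "cinner (\<Sum>x\<in>F. c x *\<^sub>C x) b = (\<Sum>x\<in>F. if x = b then c x else 0)"
    unfolding cinner.sum_left by (rule sum.cong) (use assms in \<open>auto simp: cinner_scaleC_left\<close>)
  then show ?thesis using assms by (simp add: sum.delta)
qed

lemma norm_orthonormal_sum:
  assumes "finite F" "\<forall>x\<in>F. \<forall>y\<in>F. cinner x y = (if x = y then 1 else 0)"
  shows "(norm (\<Sum>x\<in>F. c x *\<^sub>C x))\<^sup>2 = (\<Sum>x\<in>F. (cmod (c x))\<^sup>2)"
proof -
  let ?s = "\<Sum>x\<in>F. c x *\<^sub>C x"
  have "cinner ?s ?s = (\<Sum>x\<in>F. cnj (c x) * cinner ?s x)"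
    unfolding cinner.sum_right[of ?s] cinner_scaleC_right ..
  also have "\<dots> = (\<Sum>x\<in>F. complex_of_real ((cmod (c x))\<^sup>2))"
    by (rule sum.cong)
      (simp_all add: cinner_orthonormal_sum[OF assms] mult.commute flip: complex_norm_square)
  also have "\<dots> = complex_of_real (\<Sum>x\<in>F. (cmod (c x))\<^sup>2)" by simp
  finally show ?thesis unfolding cinner_self by (simp only: of_real_eq_iff)
qed

lemma bessel_inequality:
  assumes "finite F" "\<forall>x\<in>F. \<forall>y\<in>F. cinner x y = (if x = y then 1 else 0)"
  shows "(\<Sum>b\<in>F. (cmod (cinner x b))\<^sup>2) \<le> (norm x)\<^sup>2"
proof -
  define s where "s = (\<Sum>b\<in>F. cinner x b *\<^sub>C b)"
  have "cinner (x - s) b = 0" if "b \<in> F" for b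
    using cinner_orthonormal_sum[OF assms that, of "cinner x"] by (simp add: s_def cinner.diff_left)
  then have "cinner (x - s) s = 0"
    by (subst (2) s_def) (simp add: cinner.sum_right cinner_scaleC_right)
  then have "(norm x)\<^sup>2 = (norm (x - s))\<^sup>2 + (norm s)\<^sup>2" using norm_add_sq[of "x - s" s] by simp
  then show ?thesis using norm_orthonormal_sum[OF assms, of "cinner x"] by (simp add: s_def)
qed

text \<open>Invariance of dimension, infinite cardinals included. For finite \<open>B\<close>, the
  squared moduli of all \<open>cinner x b\<close> are summed in both orders: Parseval on one side,
  Bessel on the other. For infinite \<open>B\<close>, each basis vector sees only countably many
  members of \<open>X\<close>, and every member is seen by some basis vector.\<close>

lemma card_of_orthonormal_le_onb:
  fixes M :: "'a::complex_hilbert set"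
  assumes B: "is_onb M B" and XM: "X \<subseteq> M"
    and X: "\<forall>x\<in>X. \<forall>y\<in>X. cinner x y = (if x = y then 1 else 0)"
  shows "|X| \<le>o |B|"
proof -
  have B_on: "\<forall>x\<in>B. \<forall>y\<in>B. cinner x y = (if x = y then 1 else 0)" and M: "M = closure (cspan B)"
    using B by (auto simp: is_onb_def)
  have X_norm: "(norm x)\<^sup>2 = 1" if "x \<in> X" for x
  proof -
    have "complex_of_real ((norm x)\<^sup>2) = 1" using X that by (metis cinner_self)
    then show ?thesis using of_real_eq_1_iff by blast
  qed
  show ?thesis
  proof (cases "finite B")
    case True
    have B_norm: "(norm b)\<^sup>2 = 1" if "b \<in> B" for b
    proof -
      have "complex_of_real ((norm b)\<^sup>2) = 1" using B_on that by (metis cinner_self)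
      then show ?thesis using of_real_eq_1_iff by blast
    qed
    have bound: "finite F \<and> card F \<le> card B" if F: "F \<subseteq> X" "finite F" for F
    proof -
      have pars: "(norm x)\<^sup>2 = (\<Sum>b\<in>B. (cmod (cinner x b))\<^sup>2)" if "x \<in> X" for x
      proof -
        have "x = (\<Sum>b\<in>B. cinner x b *\<^sub>C b)"
        proof (rule closure_cspan_eqI[of _ B])
          show "x \<in> closure (cspan B)" using that XM M by blast
          show "(\<Sum>b\<in>B. cinner x b *\<^sub>C b) \<in> closure (cspan B)"
            using closed_csubspace_closure_cspan[of B] subset_closure_cspan[of B]
            by (intro csubspace_sum csubspace_scaleC) (auto simp: closed_csubspace_def)
        qed (simp add: cinner_orthonormal_sum[OF True B_on])
        then show ?thesis using norm_orthonormal_sum[OF True B_on, of "cinner x"] by simp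
      qed
      have "real (card F) = (\<Sum>x\<in>F. (norm x)\<^sup>2)" using F X_norm by (simp add: subset_iff)
      also have "\<dots> = (\<Sum>x\<in>F. \<Sum>b\<in>B. (cmod (cinner x b))\<^sup>2)"
        by (rule sum.cong) (use F pars in auto)
      also have "\<dots> = (\<Sum>b\<in>B. \<Sum>x\<in>F. (cmod (cinner b x))\<^sup>2)"
        by (subst sum.swap) (intro sum.cong refl arg_cong[where f = "\<lambda>r. r\<^sup>2"] cmod_cinner_commute)
      also have "\<dots> \<le> (\<Sum>b\<in>B. (norm b)\<^sup>2)"
        by (intro sum_mono bessel_inequality F) (use F X in blast)
      also have "\<dots> = real (card B)" using B_norm by simp
      finally show ?thesis using F by simp
    qed
    have "finite X \<and> card X \<le> card B"
      by (rule finite_if_finite_subsets_card_bdd) (use bound in blast)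
    then obtain f where "inj_on f X" "f ` X \<subseteq> B" using True inj_on_iff_card_le[of X B] by blast
    then show ?thesis using card_of_ordLeq by blast
  next
    case False
    define Y where "Y b = {x\<in>X. (cmod (cinner b x))\<^sup>2 \<noteq> 0}" for b
    have "countable (Y b)" for b
    proof -
      have "(\<lambda>x. (cmod (cinner b x))\<^sup>2) summable_on X"
      proof (rule nonneg_bdd_above_summable_on)
        show "bdd_above (sum (\<lambda>x. (cmod (cinner b x))\<^sup>2) ` {F. F \<subseteq> X \<and> finite F})"
          by (rule bdd_aboveI2[where M = "(norm b)\<^sup>2"])
            (intro bessel_inequality, use X in blast, use X in blast)
      qed simp
      then show ?thesis unfolding Y_def by (rule summable_countable_real)
    qed
    then have "|Y b| \<le>o |UNIV :: nat set|" for b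
      unfolding countable_def using card_of_ordLeq[of "Y b" "UNIV :: nat set"] by blast
    moreover have "|UNIV :: nat set| \<le>o |B|"
      using False infinite_iff_card_of_nat by blast
    ultimately have "|Y b| \<le>o |B|" for b using ordLeq_transitive by blast
    then have "|\<Union>b\<in>B. Y b| \<le>o |B|"
      using False by (intro card_of_UNION_ordLeq_infinite ballI card_of_refl[THEN ordIso_imp_ordLeq])
    moreover have "X \<subseteq> (\<Union>b\<in>B. Y b)"
    proof
      fix x assume x: "x \<in> X"
      show "x \<in> (\<Union>b\<in>B. Y b)"
      proof (rule ccontr)
        assume "x \<notin> (\<Union>b\<in>B. Y b)"
        then have "x \<in> ocomp B" using x by (auto simp: Y_def ocomp_def)
        then have "x \<in> ocomp M" by (simp add: M ocomp_closure_cspan)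
        then have "cinner x x = 0" using x XM unfolding ocomp_def by blast
        then show False using x X by auto
      qed
    qed
    ultimately show ?thesis using card_of_mono1 ordLeq_transitive by blast
  qed
qed

lemma hdim_onb: "closed_csubspace M \<Longrightarrow> \<exists>B. is_onb M B \<and> hdim M = |B|"
  unfolding hdim_def using someI_ex[OF is_onb_exists] by blast

lemma hdim_mono:
  assumes "closed_csubspace M" "closed_csubspace N" "M \<subseteq> N"
  shows "hdim M \<le>o hdim N"
proof -
  obtain B C where "is_onb M B" "hdim M = |B|" "is_onb N C" "hdim N = |C|"
    using hdim_onb assms by metis
  moreover from this have "B \<subseteq> N" using is_onb_subset assms by blast
  ultimately show ?thesis using card_of_orthonormal_le_onb[of N C B] by (simp add: is_onb_def)
qed

section \<open>Linear maps between different spaces\<close>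

text \<open>Unlike \<open>bounded_op\<close>, this allows different domain and codomain, as slices,
  Poisson kernels and vacuum components require; norm bounds are stated separately.\<close>

definition clinear_map :: "('a::complex_hilbert \<Rightarrow> 'b::complex_hilbert) \<Rightarrow> bool" where
  "clinear_map A \<longleftrightarrow> (\<forall>x y. A (x + y) = A x + A y) \<and> (\<forall>c x. A (c *\<^sub>C x) = c *\<^sub>C A x)"

lemma clinear_map_add: "clinear_map A \<Longrightarrow> A (x + y) = A x + A y"
  and clinear_map_scaleC: "clinear_map A \<Longrightarrow> A (c *\<^sub>C x) = c *\<^sub>C A x"
  by (auto simp: clinear_map_def)

lemma clinear_map_0: "clinear_map A \<Longrightarrow> A 0 = 0"
  using clinear_map_scaleC[of A 0 0] by (simp add: scaleC.zero_left)

lemma clinear_map_diff: "clinear_map A \<Longrightarrow> A (x - y) = A x - A y"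
  using clinear_map_add[of A "x - y" y] by simp

lemma clinear_map_sum: "clinear_map A \<Longrightarrow> A (\<Sum>i\<in>I. f i) = (\<Sum>i\<in>I. A (f i))"
  by (induction I rule: infinite_finite_induct) (auto simp: clinear_map_0 clinear_map_add)

lemma clinear_map_compose: "clinear_map A \<Longrightarrow> clinear_map B \<Longrightarrow> clinear_map (\<lambda>x. A (B x))"
  by (simp add: clinear_map_def)

lemma bounded_op_clinear: "bounded_op UNIV A \<Longrightarrow> clinear_map A"
  by (auto simp: bounded_op_def clinear_map_def)

lemma csubspace_range:
  assumes "clinear_map A"
  shows "csubspace (range A)"
  unfolding csubspace_def
proof (intro conjI ballI allI)
  show "0 \<in> range A" by (metis clinear_map_0[OF assms] rangeI)
  show "x + y \<in> range A" if "x \<in> range A" "y \<in> range A" for x y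
    using that by (auto simp flip: clinear_map_add[OF assms])
  show "c *\<^sub>C x \<in> range A" if "x \<in> range A" for c x
    using that by (auto simp flip: clinear_map_scaleC[OF assms])
qed

text \<open>Polarisation: norms of sums determine real parts, and \<open>\<i> *\<^sub>C x\<close> in
  place of \<open>x\<close> gives imaginary parts. The subspace \<open>M\<close> appears because
  some isometries below are defined only on closures of ranges.\<close>

lemma cinner_isometric:
  assumes M: "csubspace M" and x: "x \<in> M" and y: "y \<in> M"
    and add: "\<And>x y. x \<in> M \<Longrightarrow> y \<in> M \<Longrightarrow> W (x + y) = W x + W y"
    and scale: "\<And>c x. x \<in> M \<Longrightarrow> W (c *\<^sub>C x) = c *\<^sub>C W x"
    and norm: "\<And>x. x \<in> M \<Longrightarrow> norm (W x) = norm x"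
  shows "cinner (W x) (W y) = cinner x y"
proof -
  have re: "Re (cinner (W x) (W y)) = Re (cinner x y)" if "x \<in> M" for x
    using norm[OF csubspace_add[OF M that y]] norm_add_sq[of "W x" "W y"] norm_add_sq[of x y]
    by (simp add: add norm that y)
  show ?thesis
    using re[OF x] re[OF csubspace_scaleC[OF M x], of "\<i>"]
    by (intro complex_eqI) (simp_all add: scale x cinner_scaleC_left)
qed

lemma isometry_cinner: "isometry U \<Longrightarrow> cinner (U x) (U y) = cinner x y"
  by (rule cinner_isometric[of UNIV]) (auto simp: isometry_def csubspace_def)

text \<open>Douglas' factorisation \<open>C = W A\<close>.\<close>

lemma contractive_factorisation:
  fixes A :: "'h::complex_hilbert \<Rightarrow> 'a::complex_hilbert" and C :: "'h \<Rightarrow> 'b::complex_hilbert"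
  assumes A: "clinear_map A" and C: "clinear_map C" and le: "\<And>h. norm (C h) \<le> norm (A h)"
  obtains W where "\<And>h. W (A h) = C h"
    and "\<And>x. x \<in> closure (range A) \<Longrightarrow> W x \<in> closure (range C)"
    and "\<And>x y. x \<in> closure (range A) \<Longrightarrow> y \<in> closure (range A) \<Longrightarrow> W (x + y) = W x + W y"
    and "\<And>c x. x \<in> closure (range A) \<Longrightarrow> W (c *\<^sub>C x) = c *\<^sub>C W x"
    and "\<And>x. x \<in> closure (range A) \<Longrightarrow> norm (W x) \<le> norm x"
    and "\<And>x. (\<And>h. norm (C h) = norm (A h)) \<Longrightarrow> x \<in> closure (range A) \<Longrightarrow> norm (W x) = norm x"
proof -
  \<comment> \<open>The closure of the graph of \<open>A h \<mapsto> C h\<close>. Domination of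
    \<open>C\<close> by \<open>A\<close> makes it single-valued, and with completeness also defined
    on the whole closure.\<close>
  define R where "R x y \<longleftrightarrow> (\<exists>h. (\<lambda>n. A (h n)) \<longlonglongrightarrow> x \<and> (\<lambda>n. C (h n)) \<longlonglongrightarrow> y)" for x y
  have ex: "\<exists>y. R x y" if "x \<in> closure (range A)" for x
  proof -
    from that obtain f where f: "\<forall>n. f n \<in> range A" "f \<longlonglongrightarrow> x" by (auto simp: closure_sequential)
    then have "\<forall>n. \<exists>h. f n = A h" by blast
    then obtain h where "\<And>n. f n = A (h n)" by metis
    then have "f = (\<lambda>n. A (h n))" by blast
    with f(2) have h: "(\<lambda>n. A (h n)) \<longlonglongrightarrow> x" by simp
    have "Cauchy (\<lambda>n. C (h n))"
    proof (rule CauchyI)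
      fix e :: real assume "0 < e"
      then obtain N where "\<forall>m\<ge>N. \<forall>n\<ge>N. norm (A (h m) - A (h n)) < e"
        using CauchyD[OF LIMSEQ_imp_Cauchy[OF h]] by blast
      then show "\<exists>N. \<forall>m\<ge>N. \<forall>n\<ge>N. norm (C (h m) - C (h n)) < e"
        using le by (metis (no_types) clinear_map_diff[OF A] clinear_map_diff[OF C] order_le_less_trans)
    qed
    then show ?thesis using h unfolding R_def convergent_def[symmetric]
      using Cauchy_convergent convergent_def by blast
  qed
  have unique: "y = y'" if "R x y" "R x y'" for x y y'
  proof -
    from that obtain h h' where h: "(\<lambda>n. A (h n)) \<longlonglongrightarrow> x" "(\<lambda>n. C (h n)) \<longlonglongrightarrow> y"
      "(\<lambda>n. A (h' n)) \<longlonglongrightarrow> x" "(\<lambda>n. C (h' n)) \<longlonglongrightarrow> y'" by (auto simp: R_def)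
    have "norm (y - y') \<le> norm (x - x)"
    proof (rule LIMSEQ_le)
      show "(\<lambda>n. norm (C (h n) - C (h' n))) \<longlonglongrightarrow> norm (y - y')"
        "(\<lambda>n. norm (A (h n) - A (h' n))) \<longlonglongrightarrow> norm (x - x)" by (intro tendsto_intros h)+
      show "\<exists>N. \<forall>n\<ge>N. norm (C (h n) - C (h' n)) \<le> norm (A (h n) - A (h' n))"
        using le by (simp flip: clinear_map_diff[OF A] clinear_map_diff[OF C])
    qed
    then show ?thesis by simp
  qed
  define W where "W x = (SOME y. R x y)" for x
  have R_W: "R x (W x)" if "x \<in> closure (range A)" for x
    unfolding W_def using someI_ex[OF ex[OF that]] .
  have W_eq: "W x = y" if "R x y" for x y
    unfolding W_def using someI[of "R x", OF that] unique that by blast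
  show ?thesis
  proof
    show "W (A h) = C h" for h by (rule W_eq) (auto simp: R_def intro: exI[of _ "\<lambda>_. h"])
  next
    fix x assume "x \<in> closure (range A)"
    from R_W[OF this] show "W x \<in> closure (range C)"
      by (auto simp: R_def closure_sequential intro: exI[of _ "\<lambda>n. C (h n)" for h])
  next
    fix x y assume "x \<in> closure (range A)" "y \<in> closure (range A)"
    from R_W[OF this(1)] R_W[OF this(2)] obtain h h' where
      "(\<lambda>n. A (h n)) \<longlonglongrightarrow> x" "(\<lambda>n. C (h n)) \<longlonglongrightarrow> W x" "(\<lambda>n. A (h' n)) \<longlonglongrightarrow> y" "(\<lambda>n. C (h' n)) \<longlonglongrightarrow> W y"
      by (auto simp: R_def)
    then have "R (x + y) (W x + W y)" unfolding R_def
      by (intro exI[of _ "\<lambda>n. h n + h' n"])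
        (auto simp: clinear_map_add[OF A] clinear_map_add[OF C] intro: tendsto_add)
    then show "W (x + y) = W x + W y" by (rule W_eq)
  next
    fix c x assume "x \<in> closure (range A)"
    from R_W[OF this] obtain h where "(\<lambda>n. A (h n)) \<longlonglongrightarrow> x" "(\<lambda>n. C (h n)) \<longlonglongrightarrow> W x"
      by (auto simp: R_def)
    then have "R (c *\<^sub>C x) (c *\<^sub>C W x)" unfolding R_def
      by (intro exI[of _ "\<lambda>n. c *\<^sub>C h n"])
        (auto simp: clinear_map_scaleC[OF A] clinear_map_scaleC[OF C]
          intro: scaleC.tendsto[OF tendsto_const])
    then show "W (c *\<^sub>C x) = c *\<^sub>C W x" by (rule W_eq)
  next
    fix x assume "x \<in> closure (range A)"
    from R_W[OF this] obtain h where h: "(\<lambda>n. A (h n)) \<longlonglongrightarrow> x" "(\<lambda>n. C (h n)) \<longlonglongrightarrow> W x"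
      by (auto simp: R_def)
    then show "norm (W x) \<le> norm x"
      by (intro LIMSEQ_le[OF tendsto_norm tendsto_norm]) (use le in blast)+
  next
    fix x assume eq: "\<And>h. norm (C h) = norm (A h)" and "x \<in> closure (range A)"
    from R_W[OF this(2)] obtain h where h: "(\<lambda>n. A (h n)) \<longlonglongrightarrow> x" "(\<lambda>n. C (h n)) \<longlonglongrightarrow> W x"
      by (auto simp: R_def)
    have "(\<lambda>n. norm (C (h n))) \<longlonglongrightarrow> norm x" using tendsto_norm[OF h(1)] by (simp add: eq)
    then show "norm (W x) = norm x" using tendsto_norm[OF h(2)] LIMSEQ_unique by blast
  qed
qed

text \<open>Equal norms make \<open>A h \<mapsto> C h\<close> extend to an isometry between the
  closed ranges, which sends an orthonormal basis to an orthonormal set. This compares dimensions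
  across different types.\<close>

lemma hdim_closure_range_le:
  assumes A: "clinear_map A" and C: "clinear_map C" and eq: "\<And>h. norm (C h) = norm (A h)"
  shows "hdim (closure (range A)) \<le>o hdim (closure (range C))"
proof -
  let ?M = "closure (range A)" and ?N = "closure (range C)"
  have M: "closed_csubspace ?M" and N: "closed_csubspace ?N"
    by (intro closed_csubspace_closure csubspace_range A C)+
  obtain W where W: "\<And>x. x \<in> ?M \<Longrightarrow> W x \<in> ?N"
    "\<And>x y. x \<in> ?M \<Longrightarrow> y \<in> ?M \<Longrightarrow> W (x + y) = W x + W y"
    "\<And>c x. x \<in> ?M \<Longrightarrow> W (c *\<^sub>C x) = c *\<^sub>C W x" "\<And>x. x \<in> ?M \<Longrightarrow> norm (W x) = norm x"
    using contractive_factorisation[OF A C] eq by (metis order_refl)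
  obtain B where B: "is_onb ?M B" "hdim ?M = |B|" using hdim_onb[OF M] by blast
  obtain E where E: "is_onb ?N E" "hdim ?N = |E|" using hdim_onb[OF N] by blast
  have BM: "B \<subseteq> ?M" by (rule is_onb_subset[OF B(1)])
  have W_inner: "cinner (W x) (W y) = cinner x y" if "x \<in> B" "y \<in> B" for x y
    by (rule cinner_isometric[of ?M]) (use that BM W M in \<open>auto simp: closed_csubspace_def\<close>)
  have B_on: "\<forall>x\<in>B. \<forall>y\<in>B. cinner x y = (if x = y then 1 else 0)" using B by (simp add: is_onb_def)
  have inj: "inj_on W B"
    using W_inner B_on by (intro inj_onI) (metis zero_neq_one)
  have "|W ` B| \<le>o |E|"
  proof (rule card_of_orthonormal_le_onb[OF E(1)])
    show "\<forall>x\<in>W ` B. \<forall>y\<in>W ` B. cinner x y = (if x = y then 1 else 0)"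
      using W_inner B_on inj by (auto dest: inj_onD)
  qed (use BM W in auto)
  moreover have "|B| \<le>o |W ` B|" using inj card_of_ordLeq by blast
  ultimately show ?thesis using B E ordLeq_transitive by metis
qed

section \<open>Square roots of positive operators\<close>

lemma positive_op_clinear: "positive_op A \<Longrightarrow> clinear_map A"
  by (simp add: positive_op_def bounded_op_clinear)

lemma positive_op_selfadjoint:
  assumes "positive_op A"
  shows "cinner (A x) y = cinner x (A y)"
proof -
  have A: "clinear_map A" using assms by (rule positive_op_clinear)
  have im: "Im (cinner (A z) z) = 0" for z using assms by (simp add: positive_op_def)
  have a: "Im (cinner (A x) y) + Im (cinner (A y) x) = 0" for x y
    using im[of "x + y"] im[of x] im[of y]
    by (simp add: clinear_map_add[OF A] cinner_add_left cinner_add_right)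
  have im_eq: "Im (cinner (A x) y) = Im (cinner x (A y))" for x y
    using a[of x y] arg_cong[OF cinner_commute[of x "A y"], of Im] by simp
  have "Re (cinner (A x) y) = Re (cinner x (A y))"
    using im_eq[of "\<i> *\<^sub>C x" y] by (simp add: clinear_map_scaleC[OF A] cinner_scaleC_left)
  then show ?thesis using im_eq by (simp add: complex_eqI)
qed

lemma positive_op_zeroD:
  assumes R: "positive_op R" and 0: "cinner (R y) y = 0"
  shows "R y = 0"
proof (rule ccontr)
  assume "R y \<noteq> 0"
  define a where "a = (norm (R y))\<^sup>2"
  define b where "b = Re (cinner (R (R y)) (R y))"
  have a: "a > 0" using \<open>R y \<noteq> 0\<close> by (simp add: a_def)
  have b: "b \<ge> 0" using R by (simp add: positive_op_def b_def)
  have lin: "clinear_map R" using R by (rule positive_op_clinear)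
  \<comment> \<open>Nonnegativity of the form at \<open>y - t R y\<close>. The linear term dominates
    for small positive \<open>t\<close>, and the value \<open>a / (b + 1)\<close> used below is
    small enough even if \<open>b\<close> vanishes.\<close>
  have le: "2 * t * a \<le> t\<^sup>2 * b" for t :: real
  proof -
    let ?c = "complex_of_real (- t)"
    have "0 \<le> Re (cinner (R (y + ?c *\<^sub>C R y)) (y + ?c *\<^sub>C R y))"
      using R by (simp add: positive_op_def del: of_real_minus)
    also have "cinner (R (R y)) y = cinner (R y) (R y)" by (rule positive_op_selfadjoint[OF R])
    then have "Re (cinner (R (y + ?c *\<^sub>C R y)) (y + ?c *\<^sub>C R y)) = - 2 * t * a + t\<^sup>2 * b"
      by (simp add: clinear_map_add[OF lin] clinear_map_scaleC[OF lin] 0 cinner_add_left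
          cinner_add_right cinner_scaleC_left cinner_scaleC_right cinner_self power2_eq_square
          a_def b_def algebra_simps del: of_real_minus)
    finally show ?thesis by simp
  qed
  have "2 * (a / (b + 1)) * a \<le> (a / (b + 1))\<^sup>2 * b" by (rule le)
  then have "(a / (b + 1)) * (2 * a) \<le> (a / (b + 1)) * (a / (b + 1) * b)"
    by (simp add: power2_eq_square mult_ac)
  then have "2 * a \<le> a / (b + 1) * b"
    using a b by (subst (asm) mult_le_cancel_left_pos) auto
  also have "\<dots> \<le> a" using a b by (simp add: field_simps)
  finally show False using a by simp
qed

text \<open>For 0 \<le> A \<le> I one has A - A^2 = (I - A) A (I - A) + A (I - A) A \<ge> 0, so (I -
  A)^2 \<le> I - A \<le> I. This is the norm bound under which the square-root iteration
  starts.\<close>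

lemma positive_op_complement_contractive:
  assumes A: "positive_op A" and le: "\<And>x. Re (cinner (A x) x) \<le> (norm x)\<^sup>2"
  shows "norm (x - A x) \<le> norm x"
proof -
  have lin: "clinear_map A" using A by (rule positive_op_clinear)
  have sa: "inner (A u) v = inner u (A v)" for u v
    using arg_cong[OF positive_op_selfadjoint[OF A, of u v], of Re] by (simp add: Re_cinner)
  let ?b = "x - A x"
  have "0 \<le> inner (A ?b) ?b" using A by (simp add: positive_op_def Re_cinner)
  moreover have "inner (A (A x)) (A x) \<le> inner (A x) (A x)"
    using le[of "A x"] by (simp add: Re_cinner power2_norm_eq_inner)
  moreover have "inner (A x) x \<ge> 0" using A by (simp add: positive_op_def Re_cinner)
  moreover have "inner ?b ?b = inner x x - inner (A x) x
      - (inner (A ?b) ?b + (inner (A x) (A x) - inner (A (A x)) (A x)))"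
    by (simp add: clinear_map_diff[OF lin] inner_simps sa inner_commute)
  ultimately have "(norm ?b)\<^sup>2 \<le> (norm x)\<^sup>2" by (simp add: power2_norm_eq_inner)
  then show ?thesis by (simp add: power2_le_iff_abs_le)
qed

instance complex_hilbert \<subseteq> banach ..

text \<open>
  The iteration \<open>Y \<mapsto> (B + Y\<^sup>2) / 2\<close> converges to a solution of \<open>(1 - Y)\<^sup>2 = 1 - B\<close>; it is dominated
  in norm by the same iteration for the number \<open>1\<close> in place of \<open>B\<close>.
\<close>

primrec sqrt_iter :: "('a::real_normed_vector \<Rightarrow>\<^sub>L 'a) \<Rightarrow> nat \<Rightarrow> ('a \<Rightarrow>\<^sub>L 'a)" where
  "sqrt_iter B 0 = 0"
| "sqrt_iter B (Suc k) = (1/2) *\<^sub>R (B + (sqrt_iter B k o\<^sub>L sqrt_iter B k))"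

primrec sqrt_majorant :: "nat \<Rightarrow> real" where
  "sqrt_majorant 0 = 0"
| "sqrt_majorant (Suc k) = (1 + (sqrt_majorant k)\<^sup>2) / 2"

lemma sqrt_majorant_bounds: "0 \<le> sqrt_majorant k \<and> sqrt_majorant k \<le> 1"
proof (induction k)
  case (Suc k)
  then have "(sqrt_majorant k)\<^sup>2 \<le> 1" by (simp add: power_le_one)
  then show ?case by simp
qed simp

lemma norm_sqrt_iter_le:
  assumes "norm B \<le> 1"
  shows "norm (sqrt_iter B k) \<le> sqrt_majorant k"
proof (induction k)
  case (Suc k)
  have "norm (sqrt_iter B k o\<^sub>L sqrt_iter B k) \<le> norm (sqrt_iter B k) * norm (sqrt_iter B k)"
    by (rule norm_blinfun_compose)
  also have "\<dots> \<le> (sqrt_majorant k)\<^sup>2"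
    unfolding power2_eq_square by (intro mult_mono Suc) (simp_all add: sqrt_majorant_bounds)
  finally show ?case
    using norm_triangle_ineq[of B "(sqrt_iter B k o\<^sub>L sqrt_iter B k)"] assms by simp
qed simp

lemma norm_sqrt_iter_step_le:
  assumes B: "norm B \<le> 1"
  shows "norm (sqrt_iter B (Suc k) - sqrt_iter B k) \<le> sqrt_majorant (Suc k) - sqrt_majorant k"
proof (induction k)
  case 0
  then show ?case using B by simp
next
  case (Suc k)
  define Y Y' where "Y = sqrt_iter B k" and "Y' = sqrt_iter B (Suc k)"
  define y y' where "y = sqrt_majorant k" and "y' = sqrt_majorant (Suc k)"
  have IH: "norm (Y' - Y) \<le> y' - y" using Suc unfolding Y_def Y'_def y_def y'_def .
  have n: "norm Y \<le> y" "norm Y' \<le> y'"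
    unfolding Y_def Y'_def y_def y'_def by (intro norm_sqrt_iter_le[OF B])+
  have "sqrt_iter B (Suc (Suc k)) - sqrt_iter B (Suc k) = (1/2) *\<^sub>R ((Y' o\<^sub>L Y') - (Y o\<^sub>L Y))"
    unfolding Y_def Y'_def by (simp only: sqrt_iter.simps) (simp add: algebra_simps)
  \<comment> \<open>A difference of squares factored without commuting \<open>Y\<close> and
    \<open>Y'\<close>; the scalar majorant obeys the same factorisation.\<close>
  also have "(Y' o\<^sub>L Y') - (Y o\<^sub>L Y) = (Y' o\<^sub>L (Y' - Y)) + ((Y' - Y) o\<^sub>L Y)"
    by (rule blinfun_eqI) (simp add: blinfun.diff_left blinfun.add_left blinfun.diff_right)
  finally have eq: "sqrt_iter B (Suc (Suc k)) - sqrt_iter B (Suc k)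
      = (1/2) *\<^sub>R ((Y' o\<^sub>L (Y' - Y)) + ((Y' - Y) o\<^sub>L Y))" .
  have "norm ((Y' o\<^sub>L (Y' - Y)) + ((Y' - Y) o\<^sub>L Y)) \<le> norm Y' * norm (Y' - Y) + norm (Y' - Y) * norm Y"
    by (intro norm_triangle_le add_mono norm_blinfun_compose)
  also have "\<dots> \<le> y' * (y' - y) + (y' - y) * y"
    using n IH order_trans[OF norm_ge_zero n(1)] order_trans[OF norm_ge_zero n(2)]
      order_trans[OF norm_ge_zero IH]
    by (intro add_mono mult_mono) auto
  also have "\<dots> = y'\<^sup>2 - y\<^sup>2" by (simp add: power2_eq_square algebra_simps)
  finally have "norm (sqrt_iter B (Suc (Suc k)) - sqrt_iter B (Suc k)) \<le> (y'\<^sup>2 - y\<^sup>2) / 2"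
    unfolding eq by simp
  also have "\<dots> = sqrt_majorant (Suc (Suc k)) - sqrt_majorant (Suc k)"
    unfolding y_def y'_def by (simp add: field_simps)
  finally show ?case .
qed

text \<open>The majorant increases and stays below 1, and its increments dominate those of the
  iteration, so the Cauchy property transfers by telescoping.\<close>

lemma sqrt_iter_convergent:
  fixes B :: "'a::banach \<Rightarrow>\<^sub>L 'a"
  assumes B: "norm B \<le> 1"
  shows "convergent (sqrt_iter B)"
proof -
  have step: "sqrt_majorant k \<le> sqrt_majorant (Suc k)" for k
    using order_trans[OF norm_ge_zero norm_sqrt_iter_step_le[OF B, of k]] by linarith
  have "incseq sqrt_majorant" using step by (rule incseq_SucI)
  then have "convergent sqrt_majorant"
    using sqrt_majorant_bounds by (intro Bseq_monoseq_convergent incseq_imp_monoseq BseqI'[where K = 1]) auto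
  then have cau: "Cauchy sqrt_majorant" by (rule convergent_Cauchy)
  have diff: "norm (sqrt_iter B m - sqrt_iter B k) \<le> sqrt_majorant m - sqrt_majorant k" if "k \<le> m" for k m
    using that
  proof (induction m rule: dec_induct)
    case (step m)
    have "norm (sqrt_iter B (Suc m) - sqrt_iter B k)
        \<le> norm (sqrt_iter B (Suc m) - sqrt_iter B m) + norm (sqrt_iter B m - sqrt_iter B k)"
      by (rule norm_diff_triangle_le[OF order_refl order_refl])
    then show ?case using step.IH norm_sqrt_iter_step_le[OF B, of m] by simp
  qed simp
  have diff': "norm (sqrt_iter B m - sqrt_iter B k) \<le> norm (sqrt_majorant m - sqrt_majorant k)" for k m
  proof (cases "k \<le> m")
    case True
    then show ?thesis using diff[OF True] by simp
  next
    case False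
    then show ?thesis using diff[of m k] by (simp add: norm_minus_commute)
  qed
  have "Cauchy (sqrt_iter B)"
  proof (rule CauchyI)
    fix e :: real assume "0 < e"
    then obtain N where "\<forall>m\<ge>N. \<forall>n\<ge>N. norm (sqrt_majorant m - sqrt_majorant n) < e"
      using CauchyD[OF cau] by blast
    then show "\<exists>N. \<forall>m\<ge>N. \<forall>n\<ge>N. norm (sqrt_iter B m - sqrt_iter B n) < e"
      using diff' by (meson order_le_less_trans)
  qed
  then show ?thesis by (rule Cauchy_convergent)
qed

lemma sqrt_iter_commute:
  assumes "(C o\<^sub>L B) = (B o\<^sub>L C)"
  shows "(C o\<^sub>L sqrt_iter B k) = (sqrt_iter B k o\<^sub>L C)"
proof (induction k)
  case 0
  show ?case by (rule blinfun_eqI) simp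
next
  case (Suc k)
  have "C (B x) = B (C x)" for x using assms by (metis blinfun_apply_blinfun_compose)
  moreover have "C (sqrt_iter B k x) = sqrt_iter B k (C x)" for x
    using Suc by (metis blinfun_apply_blinfun_compose)
  ultimately show ?case
    by (intro blinfun_eqI)
      (simp add: blinfun.add_left blinfun.add_right blinfun.scaleR_left blinfun.scaleR_right)
qed

text \<open>The root is the identity minus the limit \<open>Y\<close> of the iteration for
  \<open>B\<close>, the complement of \<open>A\<close>. The commutation clause is included because
  uniqueness rests on it.\<close>

lemma positive_sqrt_exists:
  fixes A :: "'a::complex_hilbert \<Rightarrow> 'a"
  assumes A: "positive_op A" and le: "\<And>x. Re (cinner (A x) x) \<le> (norm x)\<^sup>2"
  shows "\<exists>R. positive_op R \<and> R \<circ> R = A \<and>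
    (\<forall>C. bounded_op UNIV C \<longrightarrow> C \<circ> A = A \<circ> C \<longrightarrow> C \<circ> R = R \<circ> C)"
proof -
  have blA: "bounded_linear A" and scA: "A (c *\<^sub>C x) = c *\<^sub>C A x" for c x
    using A by (auto simp: positive_op_def bounded_op_UNIV_iff)
  define B where "B = id_blinfun - Blinfun A"
  have B_apply: "blinfun_apply B x = x - A x" for x
    by (simp add: B_def blinfun.diff_left bounded_linear_Blinfun_apply[OF blA])
  have nB: "norm B \<le> 1"
    by (rule norm_blinfun_bound) (simp_all add: B_apply positive_op_complement_contractive[OF A le])
  obtain Y where Y: "sqrt_iter B \<longlonglongrightarrow> Y" using sqrt_iter_convergent[OF nB] convergent_def by blast
  have lim: "(\<lambda>k. blinfun_apply (sqrt_iter B k) x) \<longlonglongrightarrow> blinfun_apply Y x" for x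
    by (intro blinfun.tendsto Y tendsto_const)
  have nY: "norm Y \<le> 1"
  proof (rule LIMSEQ_le_const2[OF tendsto_norm[OF Y]])
    show "\<exists>N. \<forall>n\<ge>N. norm (sqrt_iter B n) \<le> 1"
      by (intro exI allI impI order_trans[OF norm_sqrt_iter_le[OF nB]])
        (simp add: sqrt_majorant_bounds)
  qed
  have Y_fix: "Y = (1/2) *\<^sub>R (B + (Y o\<^sub>L Y))"
  proof (rule LIMSEQ_unique)
    show "(\<lambda>k. sqrt_iter B (Suc k)) \<longlonglongrightarrow> Y" using Y by (rule LIMSEQ_Suc)
    show "(\<lambda>k. sqrt_iter B (Suc k)) \<longlonglongrightarrow> (1/2) *\<^sub>R (B + (Y o\<^sub>L Y))"
      unfolding sqrt_iter.simps
      by (intro tendsto_intros Y bounded_bilinear.tendsto[OF bounded_bilinear_blinfun_compose])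
  qed
  have Y_comm: "C (blinfun_apply Y x) = blinfun_apply Y (C x)"
    if C: "bounded_linear C" "\<And>x. C (A x) = A (C x)" for C x
  proof -
    have "(Blinfun C o\<^sub>L B) = (B o\<^sub>L Blinfun C)"
      by (rule blinfun_eqI)
        (simp add: bounded_linear_Blinfun_apply[OF C(1)] B_apply C(2)
          linear_diff[OF bounded_linear.linear[OF C(1)]])
    from sqrt_iter_commute[OF this] have "C (sqrt_iter B k x) = sqrt_iter B k (C x)" for k x
      by (metis blinfun_apply_blinfun_compose bounded_linear_Blinfun_apply[OF C(1)])
    then show ?thesis
      using bounded_linear.tendsto[OF C(1) lim[of x]] lim[of "C x"] LIMSEQ_unique by simp
  qed
  \<comment> \<open>The operators of \<open>blinfun\<close> type are only real-linear. Complex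
    linearity of \<open>Y\<close> comes from its commuting with whatever commutes with
    \<open>A\<close>, here scalar multiplication.\<close>
  have Y_scale: "blinfun_apply Y (c *\<^sub>C x) = c *\<^sub>C blinfun_apply Y x" for c x
    by (rule Y_comm[of "\<lambda>x. c *\<^sub>C x", symmetric]) (simp_all add: scaleC.bounded_linear_right scA)
  have B_sa: "cinner (blinfun_apply B x) z = cinner x (blinfun_apply B z)" for x z
    by (simp add: B_apply cinner.diff_left cinner.diff_right positive_op_selfadjoint[OF A])
  have iter_sa: "cinner (sqrt_iter B k x) z = cinner x (sqrt_iter B k z)" for k x z
  proof (induction k arbitrary: x z)
    case (Suc k)
    then show ?case
      by (simp add: blinfun.add_left blinfun.scaleR_left cinner.scaleR_left cinner.scaleR_right
          cinner_add_left cinner_add_right B_sa)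
  qed (simp add: cinner.zero_left cinner.zero_right)
  have Y_sa: "cinner (blinfun_apply Y x) z = cinner x (blinfun_apply Y z)" for x z
  proof (rule LIMSEQ_unique)
    show "(\<lambda>k. cinner (sqrt_iter B k x) z) \<longlonglongrightarrow> cinner (blinfun_apply Y x) z"
      by (intro cinner.tendsto lim tendsto_const)
    show "(\<lambda>k. cinner (sqrt_iter B k x) z) \<longlonglongrightarrow> cinner x (blinfun_apply Y z)"
      unfolding iter_sa by (intro cinner.tendsto lim tendsto_const)
  qed
  define R where "R x = x - blinfun_apply Y x" for x
  have "bounded_op UNIV R"
    unfolding bounded_op_UNIV_iff R_def
    by (auto intro!: bounded_linear_sub bounded_linear_ident blinfun.bounded_linear_right
        simp: Y_scale scaleC.diff_right)
  moreover have "Im (cinner (R x) x) = 0" for x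
  proof -
    have "cinner (R x) x = cinner x (R x)"
      by (simp add: R_def cinner.diff_left cinner.diff_right Y_sa)
    then show ?thesis using arg_cong[OF cinner_commute[of x "R x"], of Im] by simp
  qed
  moreover have "0 \<le> Re (cinner (R x) x)" for x
  proof -
    have "inner (blinfun_apply Y x) x \<le> norm (blinfun_apply Y x) * norm x" by (rule norm_cauchy_schwarz)
    also have "\<dots> \<le> (1 * norm x) * norm x"
      by (intro mult_right_mono order_trans[OF norm_blinfun] nY norm_ge_zero)
    finally show ?thesis by (simp add: R_def Re_cinner inner_diff_left dot_square_norm power2_eq_square)
  qed
  ultimately have "positive_op R" by (simp add: positive_op_def)
  moreover have "R \<circ> R = A"
  proof
    fix x
    have "2 *\<^sub>R blinfun_apply Y x = B x + Y (Y x)"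
      by (subst Y_fix) (simp add: blinfun.add_left blinfun.scaleR_left)
    then show "(R \<circ> R) x = A x"
      by (simp add: R_def blinfun.diff_right B_apply scaleR_2 algebra_simps)
  qed
  moreover have "C \<circ> R = R \<circ> C" if C: "bounded_op UNIV C" "C \<circ> A = A \<circ> C" for C
  proof
    fix x
    have bl: "bounded_linear C" using C(1) by (simp add: bounded_op_UNIV_iff)
    have "C (A x) = A (C x)" for x using C(2) by (metis comp_apply)
    from Y_comm[OF bl this] show "(C \<circ> R) x = (R \<circ> C) x"
      by (simp add: R_def linear_diff[OF bounded_linear.linear[OF bl]])
  qed
  ultimately show ?thesis by blast
qed

text \<open>By commutation (S + R)(S - R) = S^2 - R^2 = 0, so the nonnegative forms of
  \<open>S\<close> and \<open>R\<close> both vanish at \<open>y = S x - R x\<close>. Then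
  \<open>S y\<close> and \<open>R y\<close> vanish, and \<open>y\<close> is orthogonal to
  itself.\<close>

lemma positive_sqrt_unique:
  assumes S: "positive_op S" "S \<circ> S = A" and R: "positive_op R" "R \<circ> R = A"
    and comm: "R \<circ> S = S \<circ> R"
  shows "R = S"
proof
  fix x
  note linS = positive_op_clinear[OF S(1)] and linR = positive_op_clinear[OF R(1)]
  define y where "y = S x - R x"
  have SR: "S (R z) = R (S z)" "S (S z) = R (R z)" for z
    using comm S(2) R(2) by (metis comp_apply)+
  have "S y + R y = 0"
    by (simp add: y_def clinear_map_diff[OF linS] clinear_map_diff[OF linR] SR)
  then have "cinner (S y) y + cinner (R y) y = 0"
    by (simp add: cinner.zero_left flip: cinner_add_left)
  moreover from this have "Re (cinner (S y) y) + Re (cinner (R y) y) = 0"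
    by (metis plus_complex.sel(1) zero_complex.sel(1))
  moreover have "Re (cinner (S y) y) \<ge> 0" "Re (cinner (R y) y) \<ge> 0"
    "Im (cinner (S y) y) = 0" "Im (cinner (R y) y) = 0"
    using S(1) R(1) by (simp_all add: positive_op_def)
  ultimately have "cinner (S y) y = 0" "cinner (R y) y = 0" by (simp_all add: complex_eq_iff)
  then have "S y = 0" "R y = 0" using positive_op_zeroD S(1) R(1) by blast+
  moreover have "cinner y y = cinner x (S y) - cinner x (R y)"
    by (subst (1) y_def) (simp add: cinner.diff_left positive_op_selfadjoint[OF S(1)]
        positive_op_selfadjoint[OF R(1)])
  ultimately have "cinner y y = 0" by (simp add: cinner.zero_right)
  then show "R x = S x" by (simp add: y_def)
qed

lemma
  assumes A: "positive_op A" and le: "\<And>x. Re (cinner (A x) x) \<le> (norm x)\<^sup>2"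
  shows positive_op_sqrt: "positive_op (op_sqrt A)"
    and op_sqrt_square: "op_sqrt A (op_sqrt A x) = A x"
proof -
  obtain S where S: "positive_op S" "S \<circ> S = A"
    and comm: "\<And>C. bounded_op UNIV C \<Longrightarrow> C \<circ> A = A \<circ> C \<Longrightarrow> C \<circ> S = S \<circ> C"
    using positive_sqrt_exists[OF A le] by blast
  have "op_sqrt A = S"
    unfolding op_sqrt_def
  proof (rule the_equality)
    fix R assume R: "positive_op R \<and> R \<circ> R = A"
    \<comment> \<open>A competing root commutes with its own square \<open>A\<close>, hence with
      \<open>S\<close>.\<close>
    then have "R \<circ> A = A \<circ> R" by (metis comp_assoc)
    with R have "R \<circ> S = S \<circ> R" by (intro comm) (auto simp: positive_op_def)
    with R S show "R = S" using positive_sqrt_unique by blast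
  qed (use S in simp)
  with S show "positive_op (op_sqrt A)" "op_sqrt A (op_sqrt A x) = A x"
    by (simp, metis comp_apply)
qed

lemma norm_op_sqrt:
  assumes A: "positive_op A" and le: "\<And>x. Re (cinner (A x) x) \<le> (norm x)\<^sup>2"
  shows "(norm (op_sqrt A x))\<^sup>2 = Re (cinner (A x) x)"
  using positive_op_selfadjoint[OF positive_op_sqrt[OF A le], of "op_sqrt A x" x]
  by (simp add: op_sqrt_square[OF A le] cinner_self)

section \<open>Shifts on square-summable families indexed by words\<close>

text \<open>The operator S_i \<otimes> I on vector-valued coefficients; scalar coefficients give the
  creation operators, and \<open>backshift\<close> is the adjoint.\<close>

definition shift :: "'n \<Rightarrow> ('n list, 'a::complex_hilbert) l2 \<Rightarrow> ('n list, 'a) l2" where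
  "shift i f = Abs_l2 (\<lambda>w. case w of [] \<Rightarrow> 0 | j # v \<Rightarrow> if j = i then l2_nth f v else 0)"

definition backshift :: "'n \<Rightarrow> ('n list, 'a::complex_hilbert) l2 \<Rightarrow> ('n list, 'a) l2" where
  "backshift i f = Abs_l2 (\<lambda>v. l2_nth f (i # v))"

lemma l2_nth_shift:
  "l2_nth (shift i f) w = (case w of [] \<Rightarrow> 0 | j # v \<Rightarrow> if j = i then l2_nth f v else 0)"
proof -
  let ?f = "\<lambda>w. case w of [] \<Rightarrow> 0 | j # v \<Rightarrow> if j = i then l2_nth f v else 0"
  have "(\<lambda>w. (norm (?f w))\<^sup>2) summable_on range ((#) i)"
    using l2_nth_summable[of f] by (subst summable_on_reindex) (simp_all add: o_def)
  also have "?this \<longleftrightarrow> (\<lambda>w. (norm (?f w))\<^sup>2) summable_on UNIV"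
    by (rule summable_on_cong_neutral) (auto split: list.splits)
  finally show ?thesis by (simp add: shift_def Abs_l2_inverse)
qed

lemma creation_eq_shift: "creation i = shift i"
  by (intro ext l2_eqI) (simp add: l2_nth_creation l2_nth_shift)

lemma l2_nth_backshift [simp]: "l2_nth (backshift i f) v = l2_nth f (i # v)"
proof -
  have "(\<lambda>w. (norm (l2_nth f w))\<^sup>2) summable_on range ((#) i)"
    using l2_nth_summable[of f] by (rule summable_on_subset_banach) simp
  then have "(\<lambda>v. (norm (l2_nth f (i # v)))\<^sup>2) summable_on UNIV"
    by (subst (asm) summable_on_reindex) (simp_all add: o_def)
  then show ?thesis by (simp add: backshift_def Abs_l2_inverse)
qed

lemma cinner_shift: "cinner (shift i f) g = cinner f (backshift i g)"
proof -
  have "cinner (shift i f) g = (\<Sum>\<^sub>\<infinity>w\<in>range ((#) i). cinner (l2_nth (shift i f) w) (l2_nth g w))"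
    unfolding cinner_l2_def
    by (rule infsum_cong_neutral) (auto simp: l2_nth_shift cinner.zero_left split: list.splits)
  also have "\<dots> = cinner f (backshift i g)"
    by (subst infsum_reindex) (simp_all add: o_def cinner_l2_def l2_nth_shift)
  finally show ?thesis .
qed

lemma norm_shift: "norm (shift i f) = norm f"
proof -
  have "backshift i (shift i f) = f" by (rule l2_eqI) (simp add: l2_nth_shift)
  then have "complex_of_real ((norm (shift i f))\<^sup>2) = complex_of_real ((norm f)\<^sup>2)"
    by (simp only: cinner_shift cinner_self[symmetric])
  then show ?thesis by (simp only: of_real_eq_iff power2_eq_iff_nonneg norm_ge_zero)
qed

lemma bounded_op_shift: "bounded_op UNIV (shift i)"
  unfolding bounded_op_def
proof (intro conjI ballI allI exI)
  show "norm (shift i f) \<le> 1 * norm f" for f by (simp add: norm_shift)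
qed (auto intro!: l2_eqI simp: l2_nth_shift scaleC.zero_right split: list.splits)

text \<open>A word is empty or has a unique first letter. In operator form, I - \<Sum> S_i S_i^* is
  the projection onto the vacuum component.\<close>

lemma norm_sq_words:
  fixes f :: "('n::finite list, 'a::complex_hilbert) l2"
  shows "(norm f)\<^sup>2 = (norm (l2_nth f []))\<^sup>2 + (\<Sum>i\<in>UNIV. (norm (backshift i f))\<^sup>2)"
proof -
  let ?g = "\<lambda>w. (norm (l2_nth f w))\<^sup>2"
  have part: "(?g has_sum (norm (backshift i f))\<^sup>2) (range ((#) i))" for i
  proof -
    have "((\<lambda>v. ?g (i # v)) has_sum (norm (backshift i f))\<^sup>2) UNIV"
      using has_sum_infsum[OF l2_nth_summable[of "backshift i f"]] by (simp add: norm_l2_infsum)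
    then show ?thesis by (subst has_sum_reindex) (simp_all add: o_def)
  qed
  have "(?g has_sum (\<Sum>i\<in>F. (norm (backshift i f))\<^sup>2)) (\<Union>i\<in>F. range ((#) i))" if "finite F" for F
    using that
  proof induction
    case (insert i F)
    have "(?g has_sum ((norm (backshift i f))\<^sup>2 + (\<Sum>i\<in>F. (norm (backshift i f))\<^sup>2)))
        (range ((#) i) \<union> (\<Union>i\<in>F. range ((#) i)))"
      by (rule has_sum_Un_disjoint[OF part insert.IH]) (use insert in auto)
    then show ?case using insert by simp
  qed simp
  then have "(?g has_sum (\<Sum>i\<in>UNIV. (norm (backshift i f))\<^sup>2)) (\<Union>i. range ((#) i))" by simp
  moreover have "(?g has_sum ?g []) {[]}" by (rule has_sum_finiteI) auto
  ultimately have "(?g has_sum (?g [] + (\<Sum>i\<in>UNIV. (norm (backshift i f))\<^sup>2))) ({[]} \<union> (\<Union>i. range ((#) i)))"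
    by (intro has_sum_Un_disjoint) auto
  moreover have "w \<in> {[]} \<union> (\<Union>i. range ((#) i))" for w :: "'n list" by (cases w) auto
  then have "{[]} \<union> (\<Union>i. range ((#) i)) = (UNIV :: 'n list set)" by blast
  ultimately show ?thesis by (simp add: norm_l2_infsum infsumI)
qed

section \<open>Slices and Hilbert tensor products\<close>

text \<open>The adjoint of \<open>\<phi> \<mapsto> tensor \<phi> d\<close>. Coordinates and slices
  together characterise \<open>htensor\<close>.\<close>

definition slice :: "'a::complex_hilbert \<Rightarrow> ('n list, 'a) l2 \<Rightarrow> 'n fock" where
  "slice d f = Abs_l2 (\<lambda>w. cinner (l2_nth f w) d)"

lemma l2_nth_slice [simp]: "l2_nth (slice d f) w = cinner (l2_nth f w) d"
proof -
  have "(\<lambda>w. (norm (cinner (l2_nth f w) d))\<^sup>2) summable_on UNIV"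
    by (rule square_summable_scale[OF l2_nth_summable[of f], where C = "2 * norm d"])
      (use norm_cinner_le[of "l2_nth f w" d for w] in \<open>simp add: mult.assoc mult.commute[of "norm d"]\<close>)
  then show ?thesis by (simp add: slice_def Abs_l2_inverse)
qed

lemma clinear_map_slice: "clinear_map (slice d)"
  unfolding clinear_map_def
  by (auto intro!: l2_eqI simp: cinner_add_left cinner_scaleC_left scaleC_complex_def)

lemma slice_backshift: "slice d (backshift i f) = backshift i (slice d f)"
  by (rule l2_eqI) simp

lemma cinner_tensor_left: "cinner (tensor \<phi> d) f = cinner \<phi> (slice d f)"
  unfolding cinner_l2_def
proof (rule infsum_cong)
  show "cinner (l2_nth (tensor \<phi> d) w) (l2_nth f w) = cinner (l2_nth \<phi> w) (l2_nth (slice d f) w)" for w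
    using cinner_commute[of d "l2_nth f w"]
    by (simp add: l2_nth_tensor cinner_scaleC_left cinner_complex_def)
qed

lemma cinner_tensor_right: "cinner f (tensor \<phi> d) = cinner (slice d f) \<phi>"
  by (metis cinner_tensor_left cinner_commute)

lemma shift_tensor: "shift i (tensor \<phi> d) = tensor (shift i \<phi>) d"
  by (rule l2_eqI) (simp add: l2_nth_shift l2_nth_tensor scaleC.zero_left split: list.splits)

lemma backshift_tensor: "backshift i (tensor \<phi> d) = tensor (backshift i \<phi>) d"
  by (rule l2_eqI) (simp add: l2_nth_tensor)

lemma tensor_diff_left: "tensor \<phi> d - tensor \<psi> d = tensor (\<phi> - \<psi>) d"
  by (rule l2_eqI) (simp add: l2_nth_tensor scaleC.diff_left)

lemma closed_csubspace_htensor: "closed_csubspace (htensor M D)"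
  unfolding htensor_def by (rule closed_csubspace_closure_cspan)

lemma tensor_in_htensor: "\<phi> \<in> M \<Longrightarrow> d \<in> D \<Longrightarrow> tensor \<phi> d \<in> htensor M D"
  unfolding htensor_def by (rule subsetD[OF subset_closure_cspan]) blast

lemma bounded_linear_l2_nth: "bounded_linear (\<lambda>f :: ('i, 'a::complex_hilbert) l2. l2_nth f w)"
  by (rule bounded_linear_intro[where K = 1]) (simp_all add: norm_l2_nth_le)

lemma htensor_nth:
  assumes D: "closed_csubspace D" and f: "f \<in> htensor M D"
  shows "l2_nth f w \<in> D"
proof -
  let ?L = "{f. l2_nth f w \<in> D}"
  have "closed ((\<lambda>f. l2_nth f w) -` D)"
    using D by (intro closed_vimage linear_continuous_on bounded_linear_l2_nth)
      (simp add: closed_csubspace_def)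
  then have "closed_csubspace ?L"
    using D by (auto simp: closed_csubspace_def csubspace_def vimage_def)
  moreover have "{tensor \<phi> d | \<phi> d. \<phi> \<in> M \<and> d \<in> D} \<subseteq> ?L"
    using D by (auto simp: l2_nth_tensor closed_csubspace_def csubspace_scaleC)
  ultimately have "htensor M D \<subseteq> ?L"
    unfolding htensor_def by (intro closed_csubspace_minimal)
  then show ?thesis using f by blast
qed

text \<open>A closed subspace is its own double complement, and for \<open>\<psi>\<close> orthogonal
  to \<open>M\<close> the vector \<open>tensor \<psi> d\<close> is orthogonal to every generator of
  \<open>htensor M D\<close>, whatever \<open>d\<close> is.\<close>

lemma htensor_slice:
  assumes M: "closed_csubspace M" and f: "f \<in> htensor M D"
  shows "slice d f \<in> M"
proof -
  have cs: "csubspace M" using M by (simp add: closed_csubspace_def)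
  have "\<psi> \<in> M" if "\<psi> \<in> ocomp (ocomp M)" for \<psi>
  proof -
    have "\<psi> - proj M \<psi> \<in> ocomp M" by (rule proj_ocomp[OF M])
    moreover have "\<psi> - proj M \<psi> \<in> ocomp (ocomp M)"
      using that proj_in[OF M, of \<psi>] closed_csubspace_ocomp[of "ocomp M"] cinner_eq_0_commute
      by (intro csubspace_diff) (fastforce simp: closed_csubspace_def ocomp_def)+
    ultimately have "cinner (\<psi> - proj M \<psi>) (\<psi> - proj M \<psi>) = 0" unfolding ocomp_def by blast
    then have "\<psi> = proj M \<psi>" by simp
    then show ?thesis using proj_in[OF M, of \<psi>] by simp
  qed
  moreover have "slice d f \<in> ocomp (ocomp M)"
    unfolding ocomp_def[of "ocomp M"]
  proof (intro CollectI ballI)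
    fix \<psi> assume \<psi>: "\<psi> \<in> ocomp M"
    have "tensor \<psi> d \<in> ocomp {tensor \<phi> e | \<phi> e. \<phi> \<in> M \<and> e \<in> D}"
      using \<psi> by (auto simp: ocomp_def cinner_tensor)
    then have "tensor \<psi> d \<in> ocomp (htensor M D)" by (simp add: htensor_def ocomp_closure_cspan)
    then have "cinner f (tensor \<psi> d) = 0" using f by (simp add: ocomp_def)
    then have "cinner (tensor \<psi> d) f = 0" by (subst cinner_eq_0_commute)
    then show "cinner \<psi> (slice d f) = 0" by (simp add: cinner_tensor_left)
  qed
  ultimately show ?thesis by blast
qed

text \<open>The component \<open>g\<close> of \<open>f\<close> orthogonal to
  \<open>htensor M D\<close> inherits both conditions, so it can be tested against tensors built
  from its own slices, and this forces it to vanish.\<close>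

lemma htensorI:
  assumes M: "closed_csubspace M" and D: "closed_csubspace D"
    and nth: "\<And>w. l2_nth f w \<in> D" and sl: "\<And>d. d \<in> D \<Longrightarrow> slice d f \<in> M"
  shows "f \<in> htensor M D"
proof -
  let ?N = "htensor M D"
  note N = closed_csubspace_htensor[of M D]
  have csM: "csubspace M" and csD: "csubspace D" using M D by (auto simp: closed_csubspace_def)
  define g where "g = f - proj ?N f"
  have g_nth: "l2_nth g w \<in> D" for w
    using nth[of w] htensor_nth[OF D proj_in[OF N]] csubspace_diff[OF csD] by (simp add: g_def)
  have g_sl: "slice d g \<in> M" if "d \<in> D" for d
    using sl[OF that] htensor_slice[OF M proj_in[OF N]] csubspace_diff[OF csM]
    by (simp add: g_def clinear_map_diff[OF clinear_map_slice])
  have "g \<in> ocomp ?N" unfolding g_def by (rule proj_ocomp[OF N])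
  then have "cinner (slice d g) (slice d g) = 0" if "d \<in> D" for d
    using tensor_in_htensor[OF g_sl[OF that] that] cinner_tensor_left[of "slice d g" d g]
    by (auto simp: ocomp_def)
  then have sl0: "slice d g = 0" if "d \<in> D" for d using that by simp
  \<comment> \<open>The slice direction is the coordinate \<open>l2_nth g w\<close> itself, which
    lies in \<open>D\<close>.\<close>
  have "cinner (l2_nth g w) (l2_nth g w) = 0" for w
    using arg_cong[OF sl0[OF g_nth[of w]], of "\<lambda>\<phi>. l2_nth \<phi> w"] by simp
  then have "g = 0" by (intro l2_eqI) simp
  then show ?thesis using proj_in[OF N, of f] by (simp add: g_def)
qed

text \<open>Elementary tensors determine a bounded operator on their closed span, so the choice made
  in \<open>tensor_id\<close> has a definite value there.\<close>

lemma bounded_op_eq_on_htensor: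
  assumes A: "bounded_op (htensor M D) A" and B: "bounded_op (htensor M D) B"
    and eq: "\<And>\<phi> d. \<phi> \<in> M \<Longrightarrow> d \<in> D \<Longrightarrow> A (tensor \<phi> d) = B (tensor \<phi> d)"
    and f: "f \<in> htensor M D"
  shows "A f = B f"
proof -
  let ?N = "htensor M D"
  have cs: "csubspace ?N" using closed_csubspace_htensor by (auto simp: closed_csubspace_def)
  \<comment> \<open>Both operators have adjoints, and these agree.\<close>
  have "cadjoint ?N A g = cadjoint ?N B g" if "g \<in> ?N" for g
  proof (rule closure_cspan_eqI[of _ "{tensor \<phi> d | \<phi> d. \<phi> \<in> M \<and> d \<in> D}"])
    show "cadjoint ?N A g \<in> closure (cspan {tensor \<phi> d | \<phi> d. \<phi> \<in> M \<and> d \<in> D})"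
      using cadjoint_in[OF closed_csubspace_htensor A] unfolding htensor_def .
    show "cadjoint ?N B g \<in> closure (cspan {tensor \<phi> d | \<phi> d. \<phi> \<in> M \<and> d \<in> D})"
      using cadjoint_in[OF closed_csubspace_htensor B] unfolding htensor_def .
    fix x assume "x \<in> {tensor \<phi> d | \<phi> d. \<phi> \<in> M \<and> d \<in> D}"
    then have "x \<in> ?N" "A x = B x" using tensor_in_htensor eq by auto
    then have "cinner x (cadjoint ?N A g) = cinner x (cadjoint ?N B g)"
      using cinner_cadjoint[OF closed_csubspace_htensor A] cinner_cadjoint[OF closed_csubspace_htensor B]
      by metis
    then show "cinner (cadjoint ?N A g) x = cinner (cadjoint ?N B g) x" by (metis cinner_commute)
  qed
  then show ?thesis
    using f A B cinner_cadjoint[OF closed_csubspace_htensor A f] cinner_cadjoint[OF closed_csubspace_htensor B f]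
    by (intro cinner_csubspace_eqI[OF cs]) (auto simp: bounded_op_def)
qed

section \<open>The noncommutative analytic Toeplitz algebra\<close>

lemma bounded_op_compose:
  assumes "bounded_op M A" "bounded_op M B"
  shows "bounded_op M (A \<circ> B)"
proof -
  obtain a where a: "\<And>x. x \<in> M \<Longrightarrow> norm (A x) \<le> a * norm x" using assms(1) unfolding bounded_op_def by metis
  obtain b where b: "\<And>x. x \<in> M \<Longrightarrow> norm (B x) \<le> b * norm x" using assms(2) unfolding bounded_op_def by metis
  have B: "B x \<in> M" if "x \<in> M" for x using that assms(2) by (simp add: bounded_op_def)
  have "norm (A (B x)) \<le> (\<bar>a\<bar> * b) * norm x" if "x \<in> M" for x
  proof -
    have "norm (A (B x)) \<le> \<bar>a\<bar> * norm (B x)"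
      using a[OF B[OF that]] by (rule order_trans) (intro mult_right_mono; simp)
    also have "\<dots> \<le> \<bar>a\<bar> * (b * norm x)" by (intro mult_left_mono b that) simp
    finally show ?thesis by (simp add: mult.assoc)
  qed
  then have "\<exists>C. \<forall>x\<in>M. norm (A (B x)) \<le> C * norm x" by blast
  then show ?thesis using assms unfolding bounded_op_def by simp
qed

lemma bounded_op_UNIV_restrict:
  assumes "bounded_op UNIV A" "\<And>x. x \<in> M \<Longrightarrow> A x \<in> M"
  shows "bounded_op M A"
  using assms unfolding bounded_op_def by auto

lemma bounded_op_add: "bounded_op UNIV A \<Longrightarrow> bounded_op UNIV B \<Longrightarrow> bounded_op UNIV (\<lambda>x. A x + B x)"
  by (simp add: bounded_op_UNIV_iff bounded_linear_add scaleC_add_right)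

lemma bounded_op_scaleC: "bounded_op UNIV A \<Longrightarrow> bounded_op UNIV (\<lambda>x. c *\<^sub>C A x)"
  by (simp add: bounded_op_UNIV_iff scaleC_scaleC mult.commute
      bounded_linear_compose[OF scaleC.bounded_linear_right])

lemma topspace_wot: "topspace weak_operator_topology = Collect (bounded_op UNIV)"
  by (simp add: weak_operator_topology_def topspace_pullback_topology)

text \<open>Matrix coefficients are WOT-continuous. Both closed sets built for the ideal argument
  are annihilators of this kind within the Toeplitz algebra.\<close>

lemma closedin_wot_annihilator:
  "closedin weak_operator_topology {A. bounded_op UNIV A \<and> (\<forall>(x, y)\<in>X. cinner (A x) y = 0)}"
proof -
  let ?W = "weak_operator_topology :: ('a \<Rightarrow> 'a) topology"
  have "continuous_map ?W euclidean (\<lambda>A. cinner (A x) y)" for x y :: 'a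
  proof -
    have "continuous_map euclidean euclidean (\<lambda>g :: 'a \<times> 'a \<Rightarrow> complex. g (x, y))"
      by (simp add: continuous_on_product_coordinates)
    from continuous_map_pullback[OF this, of "Collect (bounded_op UNIV)" "\<lambda>A (x, y). cinner (A x) y"]
    show ?thesis by (simp add: weak_operator_topology_def o_def)
  qed
  from closedin_continuous_map_preimage[OF this, of "{0}"]
  have "closedin ?W {A. bounded_op UNIV A \<and> cinner (A x) y = 0}" for x y
    by (simp add: topspace_wot)
  \<comment> \<open>Inserting the whole space keeps the intersection within the bounded operators
    when \<open>X\<close> is empty.\<close>
  then have "closedin ?W (\<Inter>(insert (topspace ?W)
      ((\<lambda>(x, y). {A. bounded_op UNIV A \<and> cinner (A x) y = 0}) ` X)))"
    by (intro closedin_Inter) auto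
  also have "\<Inter>(insert (topspace ?W) ((\<lambda>(x, y). {A. bounded_op UNIV A \<and> cinner (A x) y = 0}) ` X))
      = {A. bounded_op UNIV A \<and> (\<forall>(x, y)\<in>X. cinner (A x) y = 0)}"
    by (auto simp: topspace_wot)
  finally show ?thesis .
qed

lemma wot_closed_algebra_bounded_op:
  "wot_closed_algebra (Collect (bounded_op UNIV) :: ('a::complex_hilbert \<Rightarrow> 'a) set)"
  using closedin_topspace[of "weak_operator_topology :: ('a \<Rightarrow> 'a) topology"]
  by (auto simp: wot_closed_algebra_def topspace_wot bounded_op_add bounded_op_compose bounded_op_scaleC)

text \<open>A hull is the intersection of the closed algebras above the generators; the algebra of
  all bounded operators shows that this family is nonempty, as closedness of the intersection
  requires.\<close>

lemma wot_closed_algebra_toeplitz: "wot_closed_algebra (toeplitz_alg :: ('n::finite fock \<Rightarrow> 'n fock) set)"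
proof -
  let ?F = "{t :: ('n fock \<Rightarrow> 'n fock) set. wot_closed_algebra t \<and> insert id (range creation) \<subseteq> t}"
  have "bounded_op UNIV (creation i :: 'n fock \<Rightarrow> _)" for i
    by (simp add: creation_eq_shift bounded_op_shift)
  moreover have "bounded_op UNIV (id :: 'n fock \<Rightarrow> _)"
    by (simp add: bounded_op_UNIV_iff id_def)
  ultimately have "Collect (bounded_op UNIV) \<in> ?F" using wot_closed_algebra_bounded_op by auto
  then have "?F \<noteq> {}" by blast
  then have "closedin weak_operator_topology (\<Inter>?F)"
    by (rule closedin_Inter) (auto simp: wot_closed_algebra_def)
  then show ?thesis
    unfolding toeplitz_alg_def hull_def wot_closed_algebra_def[of "\<Inter>?F"]
    by (auto simp: wot_closed_algebra_def)
qed

lemma toeplitz_bounded_op: "A \<in> toeplitz_alg \<Longrightarrow> bounded_op UNIV A"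
  using wot_closed_algebra_toeplitz closedin_subset topspace_wot
  unfolding wot_closed_algebra_def by blast

lemma toeplitz_add: "A \<in> toeplitz_alg \<Longrightarrow> B \<in> toeplitz_alg \<Longrightarrow> (\<lambda>x. A x + B x) \<in> toeplitz_alg"
  and toeplitz_compose: "A \<in> toeplitz_alg \<Longrightarrow> B \<in> toeplitz_alg \<Longrightarrow> A \<circ> B \<in> toeplitz_alg"
  and toeplitz_scaleC: "A \<in> toeplitz_alg \<Longrightarrow> (\<lambda>x. c *\<^sub>C A x) \<in> toeplitz_alg"
  using wot_closed_algebra_toeplitz by (auto simp: wot_closed_algebra_def)

lemma id_toeplitz: "id \<in> toeplitz_alg" and creation_toeplitz: "creation i \<in> toeplitz_alg"
  using hull_subset[of "insert id (range creation)" wot_closed_algebra]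
  by (auto simp: toeplitz_alg_def)

lemma zero_toeplitz: "(\<lambda>x. 0) \<in> toeplitz_alg"
  using toeplitz_scaleC[OF id_toeplitz, of 0] by (simp add: scaleC.zero_left)

lemma word_op_Nil [simp]: "word_op T [] x = x"
  and word_op_Cons [simp]: "word_op T (i # w) x = T i (word_op T w x)"
  by (simp_all add: word_op_def)

lemma poly_eval_creation_toeplitz: "poly_eval creation p \<in> toeplitz_alg"
proof -
  have w: "word_op creation w \<in> toeplitz_alg" for w :: "'a::finite list"
  proof (induction w)
    case Nil
    have "word_op creation [] = (id :: 'a fock \<Rightarrow> _)" by (rule ext) simp
    then show ?case by (simp only: id_toeplitz)
  next
    case (Cons i w)
    have "word_op creation (i # w) = creation i \<circ> word_op creation w" by (rule ext) simp
    then show ?case by (simp only: toeplitz_compose creation_toeplitz Cons)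
  qed
  have "(\<lambda>x. \<Sum>w\<in>F. c w *\<^sub>C word_op creation w x) \<in> toeplitz_alg" for F :: "'a list set" and c
    by (induction F rule: infinite_finite_induct)
      (simp_all add: zero_toeplitz toeplitz_add toeplitz_scaleC w)
  then show ?thesis unfolding poly_eval_def .
qed

lemma N_space_eq: "N_space J = ocomp {A \<phi> | A \<phi>. A \<in> J}"
  by (simp add: N_space_def ocomp_closure_cspan)

lemma closed_csubspace_N_space: "closed_csubspace (N_space J)"
  unfolding N_space_def by (rule closed_csubspace_ocomp)

lemma N_space_poly:
  assumes "\<phi> \<in> N_space (generated_ideal P)" "p \<in> P"
  shows "cinner (poly_eval creation p \<psi>) \<phi> = 0"
proof -
  have "poly_eval creation p \<in> generated_ideal P"
    using assms(2) hull_subset[of "poly_eval creation ` P" wot_closed_ideal]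
    by (auto simp: generated_ideal_def)
  then show ?thesis using assms(1) by (auto simp: N_space_eq ocomp_def)
qed

text \<open>Absorption of \<open>creation i\<close> from the left makes the range space of the ideal
  shift-invariant, hence its complement invariant under the adjoint.\<close>

lemma N_space_backshift:
  assumes "\<phi> \<in> N_space (generated_ideal P)"
  shows "backshift i \<phi> \<in> N_space (generated_ideal P)"
proof -
  have "cinner (A \<psi>) (backshift i \<phi>) = 0" if "A \<in> generated_ideal P" for A \<psi>
  proof -
    have "creation i \<circ> A \<in> generated_ideal P"
      using that creation_toeplitz[of i]
      unfolding generated_ideal_def hull_def wot_closed_ideal_def by blast
    then have "cinner ((creation i \<circ> A) \<psi>) \<phi> = 0" using assms unfolding N_space_eq ocomp_def by blast
    then show ?thesis by (simp add: creation_eq_shift cinner_shift)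
  qed
  then show ?thesis by (auto simp: N_space_eq ocomp_def)
qed

text \<open>
  The operators in the Toeplitz algebra whose range is orthogonal to \<open>G\<close> form a WOT-closed two-sided
  ideal, since \<open>G\<close> is invariant under the adjoints of the creation operators.
\<close>

lemma subset_N_space:
  fixes G :: "'n::finite fock set"
  assumes inv: "\<And>i \<phi>. \<phi> \<in> G \<Longrightarrow> backshift i \<phi> \<in> G"
    and van: "\<And>p \<psi> \<phi>. p \<in> P \<Longrightarrow> \<phi> \<in> G \<Longrightarrow> cinner (poly_eval creation p \<psi>) \<phi> = 0"
  shows "G \<subseteq> N_space (generated_ideal P)"
proof -
  let ?T = "toeplitz_alg :: ('n fock \<Rightarrow> 'n fock) set"
  define I where "I = {A \<in> ?T. \<forall>\<psi>. \<forall>\<phi>\<in>G. cinner (A \<psi>) \<phi> = 0}"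
  \<comment> \<open>\<open>L\<close> consists of the left multipliers of \<open>I\<close>. Elements
    of the Toeplitz algebra are reached only through its hull, so left absorption is obtained by
    showing that \<open>L\<close> is itself a WOT-closed algebra containing the generators.\<close>
  define L where "L = {B \<in> ?T. \<forall>A\<in>I. \<forall>\<psi>. \<forall>\<phi>\<in>G. cinner (B (A \<psi>)) \<phi> = 0}"
  have T: "closedin weak_operator_topology ?T"
    using wot_closed_algebra_toeplitz by (auto simp: wot_closed_algebra_def)
  have "I = ?T \<inter> {A. bounded_op UNIV A \<and> (\<forall>(x, y)\<in>UNIV \<times> G. cinner (A x) y = 0)}"
    using toeplitz_bounded_op by (auto simp: I_def)
  then have I: "closedin weak_operator_topology I"
    by (simp only: closedin_Int[OF T closedin_wot_annihilator])
  have "L = ?T \<inter> {B. bounded_op UNIV B \<and> (\<forall>(x, y)\<in>{(A \<psi>, \<phi>) | A \<psi> \<phi>. A \<in> I \<and> \<phi> \<in> G}. cinner (B x) y = 0)}"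
    using toeplitz_bounded_op unfolding L_def by fastforce
  then have L: "closedin weak_operator_topology L"
    by (simp only: closedin_Int[OF T closedin_wot_annihilator])
  have LI: "B \<circ> A \<in> I" if "B \<in> L" "A \<in> I" for A B
    using that toeplitz_compose by (auto simp: L_def I_def)
  have "wot_closed_algebra L"
    unfolding wot_closed_algebra_def
  proof (intro conjI ballI allI L)
    fix A B assume AB: "A \<in> L" "B \<in> L"
    show "(\<lambda>x. A x + B x) \<in> L"
      using AB by (auto simp: L_def toeplitz_add cinner_add_left)
    have "cinner (A (B (C \<psi>))) \<phi> = 0" if "C \<in> I" "\<phi> \<in> G" for C \<psi> \<phi>
      using AB(1) LI[OF AB(2) that(1)] that(2) by (auto simp: L_def)
    then show "A \<circ> B \<in> L" using AB by (auto simp: L_def toeplitz_compose)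
  qed (auto simp: L_def toeplitz_scaleC cinner_scaleC_left)
  \<comment> \<open>For a creation operator the adjoint moves to \<open>G\<close>, where invariance
    under \<open>backshift\<close> applies.\<close>
  moreover have "insert id (range creation) \<subseteq> L"
    by (auto simp: L_def id_toeplitz creation_toeplitz I_def) (simp add: creation_eq_shift cinner_shift inv)
  ultimately have TL: "?T \<subseteq> L" unfolding toeplitz_alg_def by (intro hull_minimal)
  have "wot_closed_ideal I"
    unfolding wot_closed_ideal_def
  proof (intro conjI ballI allI I)
    fix A B assume A: "A \<in> I" and B: "B \<in> ?T"
    show "A \<circ> B \<in> I" using A B by (auto simp: I_def toeplitz_compose)
    show "B \<circ> A \<in> I" using LI TL A B by blast
  qed (auto simp: I_def zero_toeplitz toeplitz_add toeplitz_scaleC cinner.zero_left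
      cinner_add_left cinner_scaleC_left)
  moreover have "poly_eval creation ` P \<subseteq> I"
    using van by (auto simp: I_def poly_eval_creation_toeplitz)
  ultimately have "generated_ideal P \<subseteq> I" unfolding generated_ideal_def by (intro hull_minimal)
  then show ?thesis unfolding N_space_eq ocomp_def I_def by blast
qed

section \<open>The dilation operators\<close>

text \<open>B_i \<otimes> I is the compression of S_i \<otimes> I: the right-hand side has the
  values prescribed on elementary tensors, and these determine the operator.\<close>

lemma tensor_id_B_shift:
  assumes D: "closed_csubspace D" and f: "f \<in> htensor (N_space J) D"
  shows "tensor_id (N_space J) D (B_shift J i) f = proj (htensor (N_space J) D) (shift i f)"
proof -
  let ?N = "N_space J" and ?H = "htensor (N_space J) D"
  let ?P = "\<lambda>G. bounded_op ?H G \<and> (\<forall>\<phi>\<in>?N. \<forall>d\<in>D. G (tensor \<phi> d) = tensor (B_shift J i \<phi>) d)"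
  note H = closed_csubspace_htensor[of ?N D]
  have csH: "csubspace ?H" using H by (simp add: closed_csubspace_def)
  have "bounded_op ?H (proj ?H \<circ> shift i)"
    by (rule bounded_op_UNIV_restrict[OF bounded_op_compose[OF bounded_op_proj[OF H] bounded_op_shift]])
      (simp add: proj_in[OF H])
  moreover have "(proj ?H \<circ> shift i) (tensor \<phi> d) = tensor (B_shift J i \<phi>) d"
    if "\<phi> \<in> ?N" "d \<in> D" for \<phi> d
  proof -
    let ?\<psi> = "B_shift J i \<phi>"
    have \<psi>: "?\<psi> \<in> ?N" "shift i \<phi> - ?\<psi> \<in> ocomp ?N"
      unfolding B_shift_def creation_eq_shift
      by (intro proj_in proj_ocomp closed_csubspace_N_space)+
    have "tensor (shift i \<phi> - ?\<psi>) d \<in> ocomp {tensor \<phi> e | \<phi> e. \<phi> \<in> ?N \<and> e \<in> D}"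
      using \<psi>(2) by (auto simp: ocomp_def cinner_tensor)
    then have "shift i (tensor \<phi> d) - tensor ?\<psi> d \<in> ocomp ?H"
      by (simp add: htensor_def ocomp_closure_cspan shift_tensor tensor_diff_left)
    then show ?thesis
      using tensor_in_htensor[OF \<psi>(1) that(2)] by (simp add: proj_eqI[OF csH])
  qed
  ultimately have ex: "?P (proj ?H \<circ> shift i)" by blast
  then have "?P (tensor_id ?N D (B_shift J i))" unfolding tensor_id_def by (rule someI[of ?P])
  then have "tensor_id ?N D (B_shift J i) f = (proj ?H \<circ> shift i) f"
    by (intro bounded_op_eq_on_htensor[OF conjunct1 conjunct1[OF ex] _ f]) (assumption, use ex in metis)
  then show ?thesis by simp
qed

locale constrained_dilation_space =
  fixes J :: "('n::finite fock \<Rightarrow> 'n fock) set" and P :: "'n ncpoly set"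
    and D :: "'a::complex_hilbert set" and K :: "'b::complex_hilbert set" and Z :: "'n \<Rightarrow> 'b \<Rightarrow> 'b"
  assumes J_eq: "J = generated_ideal P"
    and D: "closed_csubspace D" and K: "closed_csubspace K" and Z: "\<And>i. bounded_op K (Z i)"
begin

abbreviation "H \<equiv> htensor (N_space J) D"

lemma H: "closed_csubspace H"
  by (rule closed_csubspace_htensor)

lemma dil_op_eq: "f \<in> H \<Longrightarrow> dil_op J D Z i (f, k) = (proj H (shift i f), Z i k)"
  by (simp add: dil_op_def tensor_id_B_shift[OF D])

lemma closed_csubspace_dil_space: "closed_csubspace (dil_space J D K)"
  unfolding dil_space_def by (intro closed_csubspace_Times H K)

lemma backshift_H: "f \<in> H \<Longrightarrow> backshift i f \<in> H"
  by (rule htensorI[OF closed_csubspace_N_space D])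
    (simp_all add: slice_backshift J_eq N_space_backshift htensor_nth[OF D]
      htensor_slice[OF closed_csubspace_N_space])

lemma cinner_proj_shift: "f \<in> H \<Longrightarrow> cinner (proj H (shift i g)) f = cinner g (backshift i f)"
  by (simp add: cinner_proj_left[OF H] cinner_shift)

lemma cadjoint_dil_op:
  assumes "f \<in> H"
  shows "cadjoint (dil_space J D K) (dil_op J D Z i) (f, k) = (backshift i f, cadjoint K (Z i) k)"
proof (rule cadjoint_eqI)
  show "csubspace (dil_space J D K)" using closed_csubspace_dil_space by (simp add: closed_csubspace_def)
  show "(backshift i f, cadjoint K (Z i) k) \<in> dil_space J D K"
    using backshift_H[OF assms] cadjoint_in[OF K Z] by (simp add: dil_space_def)
  fix x assume "x \<in> dil_space J D K"
  then show "cinner (dil_op J D Z i x) (f, k) = cinner x (backshift i f, cadjoint K (Z i) k)"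
    using assms cinner_cadjoint[OF K Z]
    by (auto simp: dil_space_def dil_op_eq cinner_prod_def cinner_proj_shift)
qed

lemma cinner_dil_op:
  assumes "x \<in> dil_space J D K" "y \<in> dil_space J D K"
  shows "cinner (dil_op J D Z i x) y = cinner x (cadjoint (dil_space J D K) (dil_op J D Z i) y)"
  using assms cinner_cadjoint[OF K Z]
  by (auto simp: dil_space_def cadjoint_dil_op[unfolded dil_space_def] dil_op_eq cinner_prod_def
      cinner_proj_shift)

end

context constrained_dilation_space
begin

text \<open>Each letter moves as a backward shift onto \<open>\<phi>\<close>, which stays in N_J.
  There the projections disappear, and a word in the compressions is tested as a word in the
  creation operators.\<close>

lemma word_op_compression:
  assumes f: "f \<in> H"
  shows "word_op (\<lambda>i f. proj H (shift i f)) w f \<in> H"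
    and "\<phi> \<in> N_space J \<Longrightarrow> d \<in> D \<Longrightarrow>
      cinner (word_op (\<lambda>i f. proj H (shift i f)) w f) (tensor \<phi> d)
      = cinner (word_op creation w (slice d f)) \<phi>"
proof -
  show "word_op (\<lambda>i f. proj H (shift i f)) w f \<in> H" for w
    by (cases w) (simp_all add: f proj_in[OF H])
  show "cinner (word_op (\<lambda>i f. proj H (shift i f)) w f) (tensor \<phi> d)
      = cinner (word_op creation w (slice d f)) \<phi>" if "\<phi> \<in> N_space J" "d \<in> D"
    using that(1)
  proof (induction w arbitrary: \<phi>)
    case Nil
    then show ?case by (simp add: cinner_tensor_right)
  next
    case (Cons i w)
    moreover have "backshift i \<phi> \<in> N_space J" using Cons.prems by (simp add: J_eq N_space_backshift)
    ultimately show ?case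
      by (simp add: cinner_proj_shift tensor_in_htensor that(2) backshift_tensor creation_eq_shift cinner_shift)
  qed
qed

text \<open>Against elementary tensors, p(B) \<otimes> I becomes p(S), whose range is orthogonal to
  N_J.\<close>

lemma poly_eval_compression:
  assumes f: "f \<in> H" and p: "p \<in> P"
  shows "poly_eval (\<lambda>i f. proj H (shift i f)) p f = 0" (is "?x = 0")
proof (rule closure_cspan_eqI[of _ "{tensor \<phi> d | \<phi> d. \<phi> \<in> N_space J \<and> d \<in> D}"])
  have cs: "csubspace H" using H by (simp add: closed_csubspace_def)
  then show "?x \<in> closure (cspan {tensor \<phi> d | \<phi> d. \<phi> \<in> N_space J \<and> d \<in> D})"
    "0 \<in> closure (cspan {tensor \<phi> d | \<phi> d. \<phi> \<in> N_space J \<and> d \<in> D})"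
    unfolding poly_eval_def htensor_def[symmetric]
    by (auto intro!: csubspace_sum csubspace_scaleC word_op_compression f csubspace_0)
  fix x assume "x \<in> {tensor \<phi> d | \<phi> d. \<phi> \<in> N_space J \<and> d \<in> D}"
  then obtain \<phi> d where x: "x = tensor \<phi> d" "\<phi> \<in> N_space J" "d \<in> D" by blast
  have "cinner ?x x = cinner (poly_eval creation p (slice d f)) \<phi>"
    using word_op_compression(2)[OF f x(2,3)]
    by (simp add: poly_eval_def cinner.sum_left cinner_scaleC_left x(1))
  also have "\<dots> = 0" using N_space_poly x(2) p by (simp add: J_eq)
  finally show "cinner ?x x = cinner 0 x" by (simp add: cinner.zero_left)
qed

lemma poly_eval_dil_op:
  assumes f: "f \<in> H" and p: "p \<in> P"
  shows "poly_eval (dil_op J D Z) p (f, k) = (0, poly_eval Z p k)"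
proof -
  let ?G = "\<lambda>i f. proj H (shift i f)"
  have "word_op (dil_op J D Z) w (f, k) = (word_op ?G w f, word_op Z w k)" for w
    by (induction w) (simp_all add: dil_op_eq word_op_compression(1)[OF f])
  then have "poly_eval (dil_op J D Z) p (f, k) = (poly_eval ?G p f, poly_eval Z p k)"
    by (simp add: poly_eval_def scaleC_prod_def sum_prod)
  then show ?thesis by (simp add: poly_eval_compression[OF f p])
qed

end

section \<open>The defect operator\<close>

lemma cinner_row_defect:
  assumes "\<And>i. bounded_op UNIV (T i)"
  shows "cinner (row_defect T x) x
    = complex_of_real ((norm x)\<^sup>2 - (\<Sum>i\<in>UNIV. (norm (cadjoint UNIV (T i) x))\<^sup>2))"
  unfolding row_defect_def
  by (simp add: cinner.diff_left cinner.sum_left cinner_cadjoint_UNIV(1)[OF assms] cinner_self)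

lemma
  fixes T :: "'n::finite \<Rightarrow> 'h::complex_hilbert \<Rightarrow> 'h"
  assumes T: "row_contraction T"
  shows clinear_map_defect_op: "clinear_map (defect_op T)"
    and norm_defect_op:
      "(norm x)\<^sup>2 = (norm (defect_op T x))\<^sup>2 + (\<Sum>i\<in>UNIV. (norm (cadjoint UNIV (T i) x))\<^sup>2)"
proof -
  have b: "bounded_op UNIV (T i)" for i using T by (simp add: row_contraction_def)
  have pos: "positive_op (row_defect T)" using T by (simp add: row_contraction_def)
  have re: "Re (cinner (row_defect T x) x)
      = (norm x)\<^sup>2 - (\<Sum>i\<in>UNIV. (norm (cadjoint UNIV (T i) x))\<^sup>2)" for x
    by (subst cinner_row_defect[OF b]) (simp only: Re_complex_of_real)
  \<comment> \<open>The defect is at most the identity, the normalisation under which square roots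
    were constructed.\<close>
  then have le: "Re (cinner (row_defect T x) x) \<le> (norm x)\<^sup>2" for x by (simp add: sum_nonneg)
  show "clinear_map (defect_op T)"
    unfolding defect_op_def by (rule positive_op_clinear[OF positive_op_sqrt[OF pos le]])
  show "(norm x)\<^sup>2 = (norm (defect_op T x))\<^sup>2 + (\<Sum>i\<in>UNIV. (norm (cadjoint UNIV (T i) x))\<^sup>2)"
    unfolding defect_op_def norm_op_sqrt[OF pos le] re by simp
qed

lemma norm_Pair_sq: "(norm (x, y))\<^sup>2 = (norm x)\<^sup>2 + (norm y)\<^sup>2"
  by (simp add: norm_prod_def)

section \<open>Lower bound for the dilation index\<close>

text \<open>Invariance of the image of \<open>U\<close> gives \<open>V_i^* U h = U g\<close> for
  some \<open>g\<close>; pairing with \<open>U x\<close> and using the compression identity shows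
  that \<open>g\<close> is the adjoint of \<open>T i\<close> at \<open>h\<close>.\<close>

lemma constrained_dilation_adjoint:
  fixes T :: "'n::finite \<Rightarrow> 'h::complex_hilbert \<Rightarrow> 'h"
  assumes J: "J = generated_ideal P" and T: "\<And>i. bounded_op UNIV (T i)"
    and dil: "constrained_dilation J P T D K Z U"
  shows "cadjoint (dil_space J D K) (dil_op J D Z i) (U h) = U (cadjoint UNIV (T i) h)"
proof -
  interpret constrained_dilation_space J P D K Z
    using dil J by unfold_locales (auto simp: constrained_dilation_def)
  have U: "isometry U" "range U \<subseteq> dil_space J D K" using dil by (auto simp: constrained_dilation_def)
  have linU: "clinear_map U" using U(1) by (auto simp: isometry_def clinear_map_def)
  \<comment> \<open>The isometric image of a complete space is closed, which gives
    \<open>proj (range U)\<close> its defining property.\<close>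
  have closedU: "closed_csubspace (range U)"
  proof -
    have "complete (range U)"
      using U(1) by (intro complete_isometric_image[of 1] subspace_UNIV complete_UNIV bounded_linear_intro[where K = 1])
        (auto simp: isometry_def simp flip: scaleC_of_real)
    then show ?thesis by (simp add: closed_csubspace_def csubspace_range[OF linU] complete_imp_closed)
  qed
  obtain g where g: "cadjoint (dil_space J D K) (dil_op J D Z i) (U h) = U g"
    using dil unfolding constrained_dilation_def by blast
  have "cinner x (cadjoint UNIV (T i) h) = cinner x g" for x
  proof -
    have "cinner x (cadjoint UNIV (T i) h) = cinner (U (T i x)) (U h)"
      by (simp add: isometry_cinner[OF U(1)] cinner_cadjoint_UNIV(1)[OF T])
    also have "\<dots> = cinner (dil_op J D Z i (U x)) (U h)"
      using dil by (simp add: constrained_dilation_def cinner_proj_left[OF closedU])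
    also have "\<dots> = cinner (U x) (U g)" using U(2) by (subst cinner_dil_op) (auto simp: g)
    finally show ?thesis by (simp add: isometry_cinner[OF U(1)])
  qed
  then have "cadjoint UNIV (T i) h = g" by (rule cinner_eqI)
  then show ?thesis using g by simp
qed

text \<open>
  The vacuum component of \<open>U h\<close> has the norm of \<open>\<Delta>\<^sub>T h\<close>, since \<open>I - \<Sum> V\<^sub>i V\<^sub>i\<^sup>*\<close> is the compression of
  the projection onto the vacuum component.
\<close>

lemma rank_defect_op_le_hdim:
  fixes T :: "'n::finite \<Rightarrow> 'h::complex_hilbert \<Rightarrow> 'h"
  assumes J: "J = generated_ideal P" and T: "row_contraction T"
    and dil: "constrained_dilation J P T D K Z U"
  shows "rank_op (defect_op T) \<le>o hdim D"
proof -
  interpret constrained_dilation_space J P D K Z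
    using dil J by unfold_locales (auto simp: constrained_dilation_def)
  have U: "isometry U" "range U \<subseteq> dil_space J D K" and ZZ: "\<And>k. k \<in> K \<Longrightarrow> (\<Sum>i\<in>UNIV. Z i (cadjoint K (Z i) k)) = k"
    using dil by (auto simp: constrained_dilation_def)
  have T': "\<And>i. bounded_op UNIV (T i)" using T by (simp add: row_contraction_def)
  define A where "A h = l2_nth (fst (U h)) []" for h
  have UH: "fst (U h) \<in> H" "snd (U h) \<in> K" for h
    using subsetD[OF U(2) rangeI[of U h]] by (simp_all add: dil_space_def mem_Times_iff)
  have A: "clinear_map A"
    using U(1) by (auto simp: clinear_map_def A_def isometry_def scaleC_prod_def)
  have normU: "norm (U h) = norm h" for h using U(1) by (simp add: isometry_def)
  have norm_A: "norm (A h) = norm (defect_op T h)" for h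
  proof -
    obtain f k where fk: "U h = (f, k)" by (cases "U h")
    have fH: "f \<in> H" and kK: "k \<in> K" using UH[of h] by (simp_all add: fk)
    \<comment> \<open>Pairing \<Sum> Z_i Z_i^* k = k with \<open>k\<close> gives a norm identity, so
      the \<open>K\<close> component contributes nothing to the defect and cancels below.\<close>
    have "complex_of_real ((norm k)\<^sup>2) = (\<Sum>i\<in>UNIV. complex_of_real ((norm (cadjoint K (Z i) k))\<^sup>2))"
      unfolding cinner_self[symmetric]
      by (subst (1) ZZ[OF kK, symmetric])
        (simp add: cinner.sum_left cinner_cadjoint[OF K Z cadjoint_in[OF K Z]])
    then have k: "(norm k)\<^sup>2 = (\<Sum>i\<in>UNIV. (norm (cadjoint K (Z i) k))\<^sup>2)"
      by (simp only: of_real_sum[symmetric] of_real_eq_iff)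
    have "(norm (cadjoint UNIV (T i) h))\<^sup>2 = (norm (backshift i f))\<^sup>2 + (norm (cadjoint K (Z i) k))\<^sup>2" for i
      using constrained_dilation_adjoint[OF J T' dil, of i h] normU[of "cadjoint UNIV (T i) h"]
      by (metis fk cadjoint_dil_op[OF fH] norm_Pair_sq)
    then have "(norm h)\<^sup>2 = (norm (defect_op T h))\<^sup>2
        + ((\<Sum>i\<in>UNIV. (norm (backshift i f))\<^sup>2) + (norm k)\<^sup>2)"
      by (subst norm_defect_op[OF T]) (simp add: k sum.distrib)
    moreover have "(norm h)\<^sup>2 = (norm (l2_nth f []))\<^sup>2 + (\<Sum>i\<in>UNIV. (norm (backshift i f))\<^sup>2) + (norm k)\<^sup>2"
      using normU[of h] norm_Pair_sq[of f k] norm_sq_words[of f] by (simp add: fk)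
    ultimately have "(norm (A h))\<^sup>2 = (norm (defect_op T h))\<^sup>2" by (simp add: A_def fk)
    then show ?thesis by simp
  qed
  have "rank_op (defect_op T) \<le>o hdim (closure (range A))"
    unfolding rank_op_def by (intro hdim_closure_range_le clinear_map_defect_op[OF T] A norm_A)
  moreover have "range A \<subseteq> D" using htensor_nth[OF D UH(1)] by (auto simp: A_def)
  then have "closure (range A) \<subseteq> D" using D by (simp add: closed_csubspace_def closure_minimal)
  then have "hdim (closure (range A)) \<le>o hdim D"
    by (intro hdim_mono closed_csubspace_closure csubspace_range A D)
  ultimately show ?thesis using ordLeq_transitive by blast
qed

section \<open>Defect of a contraction and isometric columns\<close>

text \<open>\<open>cadjoint\<close> covers only operators of a space into itself, so A^* A is
  obtained directly from Riesz representation as \<open>G\<close>; \<open>Y\<close> is the square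
  root of I - A^* A.\<close>

lemma defect_of_contraction:
  fixes A :: "'a::complex_hilbert \<Rightarrow> 'b::complex_hilbert"
  assumes A: "clinear_map A" and le: "\<And>x. norm (A x) \<le> norm x"
  obtains Y :: "'a \<Rightarrow> 'a" where "clinear_map Y" "\<And>x. (norm x)\<^sup>2 = (norm (A x))\<^sup>2 + (norm (Y x))\<^sup>2"
proof -
  have "\<exists>z. \<forall>x. cinner (A x) (A y) = cinner x z" for y
  proof -
    have "\<exists>z\<in>UNIV. \<forall>x\<in>UNIV. cinner (A x) (A y) = cinner x z"
    proof (rule riesz_representation[OF closed_csubspace_UNIV, where C = "2 * norm (A y)"])
      show "cmod (cinner (A x) (A y)) \<le> 2 * norm (A y) * norm x" for x
        using norm_cinner_le[of "A x" "A y"] mult_right_mono[OF le[of x] norm_ge_zero[of "A y"]]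
        by (simp add: mult_ac)
    qed (simp_all add: clinear_map_add[OF A] clinear_map_scaleC[OF A] cinner_add_left cinner_scaleC_left)
    then show ?thesis by simp
  qed
  then obtain G where G: "\<And>x y. cinner (A x) (A y) = cinner x (G y)" by metis
  have G_add: "G (x + y) = G x + G y" for x y
    by (rule cinner_eqI) (simp add: cinner_add_right clinear_map_add[OF A] flip: G)
  have G_scale: "G (c *\<^sub>C x) = c *\<^sub>C G x" for c x
    by (rule cinner_eqI) (simp add: cinner_scaleC_right clinear_map_scaleC[OF A] flip: G)
  have G_norm: "norm (G y) \<le> norm y" for y
  proof -
    have "(norm (G y))\<^sup>2 = Re (cinner (A (G y)) (A y))" by (simp add: G cinner_self)
    also have "\<dots> \<le> norm (A (G y)) * norm (A y)" by (simp add: Re_cinner norm_cauchy_schwarz)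
    also have "\<dots> \<le> norm (G y) * norm y" by (intro mult_mono le) auto
    finally show ?thesis by (cases "G y = 0") (simp_all add: power2_eq_square)
  qed
  have "cinner (G x) x = complex_of_real ((norm (A x))\<^sup>2)" for x
    using cinner_commute[of "G x" x] cinner_commute[of "A x" "A x"] by (simp only: G[symmetric] cinner_self)
  then have Q: "cinner (x - G x) x = complex_of_real ((norm x)\<^sup>2 - (norm (A x))\<^sup>2)" for x
    by (simp add: cinner.diff_left cinner_self)
  have "bounded_op UNIV (\<lambda>x. x - G x)"
    unfolding bounded_op_def
  proof (intro conjI ballI allI exI)
    show "norm (x - G x) \<le> 2 * norm x" for x
      using norm_triangle_ineq4[of x "G x"] G_norm[of x] by simp
  qed (simp_all add: G_add G_scale scaleC.diff_right)
  moreover have "(norm (A x))\<^sup>2 \<le> (norm x)\<^sup>2" for x by (intro power_mono le norm_ge_zero)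
  ultimately have pos: "positive_op (\<lambda>x. x - G x)"
    unfolding positive_op_def Q Re_complex_of_real Im_complex_of_real by simp
  have Q_le: "Re (cinner (x - G x) x) \<le> (norm x)\<^sup>2" for x
    unfolding Q Re_complex_of_real by simp
  show ?thesis
  proof
    show "clinear_map (op_sqrt (\<lambda>x. x - G x))"
      by (rule positive_op_clinear[OF positive_op_sqrt[OF pos Q_le]])
    show "(norm x)\<^sup>2 = (norm (A x))\<^sup>2 + (norm (op_sqrt (\<lambda>x. x - G x) x))\<^sup>2" for x
      unfolding norm_op_sqrt[OF pos Q_le] Q Re_complex_of_real by simp
  qed
qed

lemma cinner_isometric_sum:
  assumes A: "clinear_map A" and C: "\<And>i. clinear_map (C i)"
    and eq: "\<And>x. (\<Sum>i\<in>I. (norm (C i x))\<^sup>2) = (norm (A x))\<^sup>2"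
  shows "(\<Sum>i\<in>I. cinner (C i x) (C i y)) = cinner (A x) (A y)"
proof -
  have re: "(\<Sum>i\<in>I. Re (cinner (C i x) (C i y))) = Re (cinner (A x) (A y))" for x
    using eq[of "x + y"] eq[of x] eq[of y]
    by (simp add: clinear_map_add[OF A] clinear_map_add[OF C] norm_add_sq sum.distrib
        flip: sum_distrib_left)
  show ?thesis
    using re[of x] re[of "\<i> *\<^sub>C x"]
    by (intro complex_eqI)
      (simp_all add: clinear_map_scaleC[OF A] clinear_map_scaleC[OF C] cinner_scaleC_left sum_negf)
qed

lemma closure_csubspace_eqI:
  assumes R: "csubspace R" and "y \<in> closure R" "z \<in> closure R" "\<And>x. x \<in> R \<Longrightarrow> cinner y x = cinner z x"
  shows "y = z"
proof -
  have "cspan R = R" using cspan_superset[of R] cspan_minimal[OF order_refl R] by blast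
  then show ?thesis using assms(2-4) closure_cspan_eqI[of y R z] by simp
qed

section \<open>The Poisson kernel\<close>

text \<open>\<open>adj_word T w\<close> is the adjoint of \<open>word_op T w\<close>.\<close>

definition adj_word :: "('n \<Rightarrow> 'h::complex_hilbert \<Rightarrow> 'h) \<Rightarrow> 'n list \<Rightarrow> 'h \<Rightarrow> 'h" where
  "adj_word T w h = foldl (\<lambda>x i. cadjoint UNIV (T i) x) h w"

lemma adj_word_Nil [simp]: "adj_word T [] h = h"
  and adj_word_Cons [simp]: "adj_word T (i # w) h = adj_word T w (cadjoint UNIV (T i) h)"
  by (simp_all add: adj_word_def)

locale row_contractive_tuple =
  fixes T :: "'n::finite \<Rightarrow> 'h::complex_hilbert \<Rightarrow> 'h"
  assumes T: "row_contraction T"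
begin

abbreviation "Tst i \<equiv> cadjoint UNIV (T i)"

lemma bounded_T: "bounded_op UNIV (T i)"
  using T by (simp add: row_contraction_def)

lemma clinear_Tst: "clinear_map (Tst i)"
  by (rule bounded_op_clinear[OF cadjoint_bounded_op[OF closed_csubspace_UNIV bounded_T]])

lemma clinear_adj_word: "clinear_map (adj_word T w)"
proof (induction w)
  case (Cons i w)
  then show ?case using clinear_Tst[of i] by (simp add: clinear_map_def)
qed (simp add: clinear_map_def)

text \<open>The adjoints of the \<open>X i\<close> act on \<open>W h\<close> as those of the
  \<open>T i\<close> act on \<open>h\<close>, so the adjoint of p(X) inherits the vanishing of the
  adjoint of p(T). It serves both slices of the Poisson kernel and the tuple
  \<open>Z\<close>.\<close>

lemma poly_eval_orthogonal:
  assumes W: "clinear_map W" and M: "\<And>i a. a \<in> M \<Longrightarrow> X i a \<in> M"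
    and X: "\<And>i a h. a \<in> M \<Longrightarrow> cinner (X i a) (W h) = cinner a (W (Tst i h))"
    and p: "\<And>x. poly_eval T p x = 0" and a: "a \<in> M"
  shows "cinner (poly_eval X p a) (W h) = 0"
proof -
  have wM: "word_op X w a \<in> M" for w by (induction w) (simp_all add: a M)
  have word: "cinner (word_op X w a) (W h) = cinner a (W (adj_word T w h))" for w h
    by (induction w arbitrary: h) (simp_all add: X wM)
  have wordT: "cinner (word_op T w g) h = cinner g (adj_word T w h)" for w g h
    by (induction w arbitrary: h) (simp_all add: cinner_cadjoint_UNIV(1)[OF bounded_T])
  \<comment> \<open>The adjoint of p(T) applied to \<open>h\<close>; being orthogonal to every
    vector, it vanishes.\<close>
  define z where "z = (\<Sum>w\<in>Poly_Mapping.keys p. cnj (Poly_Mapping.lookup p w) *\<^sub>C adj_word T w h)"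
  have "cinner g z = cinner (poly_eval T p g) h" for g
    by (simp add: z_def poly_eval_def cinner.sum_left cinner.sum_right cinner_scaleC_left
        cinner_scaleC_right wordT)
  then have "cinner z z = 0" by (simp add: p cinner.zero_left)
  then have "z = 0" by simp
  have "cinner (poly_eval X p a) (W h) = cinner a (W z)"
    by (simp add: z_def poly_eval_def cinner.sum_left cinner.sum_right cinner_scaleC_left
        cinner_scaleC_right word clinear_map_sum[OF W] clinear_map_scaleC[OF W])
  then show ?thesis by (simp add: \<open>z = 0\<close> clinear_map_0[OF W] cinner.zero_right)
qed

text \<open>Iterates \<open>norm_defect_op\<close>: nonempty words are split by their first letter,
  which \<open>adj_word\<close> applies first, so the induction hypothesis is used at
  \<open>Tst i h\<close>.\<close>

lemma sum_defect_words_le: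
  "(\<Sum>w | length w \<le> k. (norm (defect_op T (adj_word T w h)))\<^sup>2) \<le> (norm h)\<^sup>2"
proof (induction k arbitrary: h)
  case 0
  have "(norm (defect_op T h))\<^sup>2 \<le> (norm h)\<^sup>2"
    by (subst norm_defect_op[OF T]) (simp add: sum_nonneg)
  then show ?case by simp
next
  case (Suc k)
  let ?W = "{w :: 'n list. length w \<le> k}"
  have fin: "finite ?W" using finite_lists_length_le[of "UNIV :: 'n set" k] by simp
  have eq: "{w :: 'n list. length w \<le> Suc k} = insert [] (\<Union>i. (#) i ` ?W)"
  proof (intro set_eqI)
    show "w \<in> {w. length w \<le> Suc k} \<longleftrightarrow> w \<in> insert [] (\<Union>i. (#) i ` ?W)" for w :: "'n list"
      by (cases w) auto
  qed
  have "(\<Sum>w | length w \<le> Suc k. (norm (defect_op T (adj_word T w h)))\<^sup>2)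
      = (norm (defect_op T h))\<^sup>2 + (\<Sum>i\<in>UNIV. \<Sum>w\<in>(#) i ` ?W. (norm (defect_op T (adj_word T w h)))\<^sup>2)"
    unfolding eq by (subst sum.insert) (auto simp: fin intro!: sum.UNION_disjoint)
  also have "\<dots> = (norm (defect_op T h))\<^sup>2
      + (\<Sum>i\<in>UNIV. \<Sum>w\<in>?W. (norm (defect_op T (adj_word T w (Tst i h))))\<^sup>2)"
    by (simp add: sum.reindex)
  also have "\<dots> \<le> (norm (defect_op T h))\<^sup>2 + (\<Sum>i\<in>UNIV. (norm (Tst i h))\<^sup>2)"
    by (intro add_left_mono sum_mono Suc)
  also have "\<dots> = (norm h)\<^sup>2" by (rule norm_defect_op[OF T, symmetric])
  finally show ?case .
qed

lemma sum_defect_le: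
  assumes "finite F"
  shows "(\<Sum>w\<in>F. (norm (defect_op T (adj_word T w h)))\<^sup>2) \<le> (norm h)\<^sup>2"
proof -
  define k where "k = Max (length ` F)"
  have "F \<subseteq> {w. length w \<le> k}" using assms by (auto simp: k_def)
  moreover have "finite {w :: 'n list. length w \<le> k}"
    using finite_lists_length_le[of "UNIV :: 'n set" k] by simp
  ultimately have "(\<Sum>w\<in>F. (norm (defect_op T (adj_word T w h)))\<^sup>2)
      \<le> (\<Sum>w | length w \<le> k. (norm (defect_op T (adj_word T w h)))\<^sup>2)"
    by (intro sum_mono2) auto
  also note sum_defect_words_le
  finally show ?thesis .
qed

text \<open>Values are padded by 0 because the coefficient space must lie in the universe
  \<open>'h \<times> 'u\<close>.\<close>

definition poisson :: "'h \<Rightarrow> ('n list, 'h \<times> 'u::complex_hilbert) l2" where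
  "poisson h = Abs_l2 (\<lambda>w. (defect_op T (adj_word T w h), 0))"

lemma poisson_nth [simp]:
  "l2_nth (poisson h :: ('n list, 'h \<times> 'u::complex_hilbert) l2) w = (defect_op T (adj_word T w h), 0)"
proof -
  have "(\<lambda>w. (norm (defect_op T (adj_word T w h)))\<^sup>2) summable_on UNIV"
  proof (rule nonneg_bdd_above_summable_on)
    show "bdd_above (sum (\<lambda>w. (norm (defect_op T (adj_word T w h)))\<^sup>2) ` {F. F \<subseteq> UNIV \<and> finite F})"
      by (rule bdd_aboveI2[where M = "(norm h)\<^sup>2"]) (simp add: sum_defect_le)
  qed simp
  then have "(\<lambda>w. (norm (defect_op T (adj_word T w h), 0 :: 'u))\<^sup>2) summable_on UNIV"
    by (simp add: norm_Pair_sq)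
  then show ?thesis by (simp add: poisson_def Abs_l2_inverse)
qed

lemma clinear_poisson: "clinear_map (poisson :: 'h \<Rightarrow> ('n list, 'h \<times> 'u::complex_hilbert) l2)"
  unfolding clinear_map_def
  by (auto intro!: l2_eqI simp: clinear_map_add[OF clinear_adj_word] clinear_map_scaleC[OF clinear_adj_word]
      clinear_map_add[OF clinear_map_defect_op[OF T]] clinear_map_scaleC[OF clinear_map_defect_op[OF T]]
      scaleC_prod_def scaleC.zero_right)

lemma backshift_poisson: "backshift i (poisson h) = poisson (Tst i h)"
  by (rule l2_eqI) simp

lemma norm_poisson_le: "norm (poisson h) \<le> norm h"
proof -
  have "(norm (poisson h))\<^sup>2 \<le> (norm h)\<^sup>2"
    unfolding norm_l2_infsum
    by (rule infsum_le_finite_sums[OF l2_nth_summable]) (simp add: norm_Pair_sq sum_defect_le)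
  then show ?thesis by (simp add: power2_le_iff_abs_le)
qed

text \<open>Compared with \<open>norm_defect_op\<close>, this shows that the part of the norm missed
  by the Poisson kernel is preserved by the column of adjoints.\<close>

lemma norm_poisson_sq:
  defines "K \<equiv> (poisson :: 'h \<Rightarrow> ('n list, 'h \<times> 'u::complex_hilbert) l2)"
  shows "(norm (K h))\<^sup>2 = (norm (defect_op T h))\<^sup>2 + (\<Sum>i\<in>UNIV. (norm (K (Tst i h)))\<^sup>2)"
  unfolding K_def using norm_sq_words[of "poisson h :: ('n list, 'h \<times> 'u) l2"] by (simp add: norm_Pair_sq backshift_poisson)

text \<open>For fixed \<open>d\<close> the slices form a set invariant under backward shifts, which
  act on it as the adjoints of the \<open>T i\<close>; the polynomial relations of \<open>T\<close>
  then give the orthogonality that \<open>subset_N_space\<close> asks for.\<close>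

lemma slice_poisson_in_N_space:
  fixes d :: "'h \<times> 'u::complex_hilbert"
  assumes p: "\<forall>p\<in>P. \<forall>x. poly_eval T p x = 0"
  shows "slice d (poisson h) \<in> N_space (generated_ideal P)"
proof -
  have W: "clinear_map (\<lambda>h. slice d (poisson h))"
    by (rule clinear_map_compose[OF clinear_map_slice clinear_poisson])
  have "range (\<lambda>h. slice d (poisson h)) \<subseteq> N_space (generated_ideal P)"
  proof (rule subset_N_space)
    show "backshift i \<phi> \<in> range (\<lambda>h. slice d (poisson h))"
      if "\<phi> \<in> range (\<lambda>h. slice d (poisson h))" for i \<phi>
      using that by (auto simp: backshift_poisson simp flip: slice_backshift)
    show "cinner (poly_eval creation p \<psi>) \<phi> = 0"
      if pP: "p \<in> P" and G: "\<phi> \<in> range (\<lambda>h. slice d (poisson h))" for p \<psi> \<phi>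
    proof -
      obtain h where \<phi>: "\<phi> = slice d (poisson h)" using G by blast
      show ?thesis
        unfolding \<phi>
        by (rule poly_eval_orthogonal[OF W, where M = UNIV])
          (use p pP in \<open>auto simp: creation_eq_shift cinner_shift backshift_poisson simp flip: slice_backshift\<close>)
    qed
  qed
  then show ?thesis by blast
qed

text \<open>
  The dilation space is \<open>(\<N>\<^sub>J \<otimes> D) \<oplus> K\<close>, with \<open>U h = (K\<^sub>T h, Q\<^sup>1\<^sup>/\<^sup>2 h)\<close> for the Poisson kernel
  \<open>K\<^sub>T\<close> and \<open>Q = I - K\<^sub>T\<^sup>* K\<^sub>T\<close>.  Since \<open>\<Sum> T\<^sub>i Q T\<^sub>i\<^sup>* = Q\<close>, the operators \<open>Q\<^sup>1\<^sup>/\<^sup>2 h \<mapsto> Q\<^sup>1\<^sup>/\<^sup>2 T\<^sub>i\<^sup>* h\<close>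
  form an isometric column, and the \<open>Z\<^sub>i\<close> are their adjoints.
\<close>

lemma constrained_dilation_exists:
  fixes D :: "('h \<times> 'u::complex_hilbert) set"
  assumes p: "\<forall>p\<in>P. \<forall>x. poly_eval T p x = 0"
    and D_def: "D = closure (range (\<lambda>x. (defect_op T x, 0)))"
  shows "\<exists>(K :: ('h \<times> 'u) set) Z U. constrained_dilation (generated_ideal P) P T D K Z U"
proof -
  obtain Y0 where Y0: "clinear_map Y0"
    and norm_Y0: "\<And>x. (norm x)\<^sup>2 = (norm (poisson x :: ('n list, 'h \<times> 'u) l2))\<^sup>2 + (norm (Y0 x :: 'h))\<^sup>2"
    using defect_of_contraction[OF clinear_poisson norm_poisson_le] by blast
  define Y where "Y x = (Y0 x, 0 :: 'u)" for x
  have Y: "clinear_map Y" using Y0 by (simp add: clinear_map_def Y_def scaleC_prod_def scaleC.zero_right)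
  have norm_Y: "(norm x)\<^sup>2 = (norm (poisson x :: ('n list, 'h \<times> 'u) l2))\<^sup>2 + (norm (Y x))\<^sup>2" for x
    using norm_Y0[of x] by (simp add: Y_def norm_Pair_sq)
  have YT: "clinear_map (\<lambda>h. Y (Tst i h))" for i
    by (rule clinear_map_compose[OF Y clinear_Tst])
  have col: "(\<Sum>i\<in>UNIV. (norm (Y (Tst i h)))\<^sup>2) = (norm (Y h))\<^sup>2" for h
  proof -
    have "(\<Sum>i\<in>UNIV. (norm (Tst i h))\<^sup>2)
        = (\<Sum>i\<in>UNIV. (norm (poisson (Tst i h) :: ('n list, 'h \<times> 'u) l2))\<^sup>2) + (\<Sum>i\<in>UNIV. (norm (Y (Tst i h)))\<^sup>2)"
      by (simp add: norm_Y sum.distrib)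
    then show ?thesis
      using norm_defect_op[OF T, of h] norm_Y[of h] norm_poisson_sq[of h, where 'u = 'u] by simp
  qed
  have le: "norm (Y (Tst i h)) \<le> norm (Y h)" for i h
  proof -
    have "(norm (Y (Tst i h)))\<^sup>2 \<le> (\<Sum>i\<in>UNIV. (norm (Y (Tst i h)))\<^sup>2)"
      by (rule member_le_sum) auto
    then show ?thesis by (simp add: col power2_le_iff_abs_le)
  qed
  define K where "K = closure (range Y)"
  have csY: "csubspace (range Y)" by (rule csubspace_range[OF Y])
  have K: "closed_csubspace K" unfolding K_def by (rule closed_csubspace_closure[OF csY])
  have YK: "Y h \<in> K" for h unfolding K_def by (rule subsetD[OF closure_subset rangeI])
  \<comment> \<open>Each entry of the isometric column is contractive, which extends it from the
    range of \<open>Y\<close> to \<open>K\<close>.\<close>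
  have "\<exists>L. (\<forall>h. L (Y h) = Y (Tst i h)) \<and> bounded_op K L" for i
  proof (rule contractive_factorisation[OF Y YT[of i] le[of i], folded K_def])
    fix L
    assume L: "\<And>h. L (Y h) = Y (Tst i h)"
      "\<And>x. x \<in> K \<Longrightarrow> L x \<in> closure (range (\<lambda>h. Y (Tst i h)))"
      "\<And>x y. x \<in> K \<Longrightarrow> y \<in> K \<Longrightarrow> L (x + y) = L x + L y"
      "\<And>c x. x \<in> K \<Longrightarrow> L (c *\<^sub>C x) = c *\<^sub>C L x" "\<And>x. x \<in> K \<Longrightarrow> norm (L x) \<le> norm x"
    have "closure (range (\<lambda>h. Y (Tst i h))) \<subseteq> K" unfolding K_def by (rule closure_mono) auto
    with L(2-) have "bounded_op K L" unfolding bounded_op_def by (auto intro!: exI[of _ 1])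
    with L(1) show ?thesis by blast
  qed
  then obtain L where L: "\<And>i h. L i (Y h) = Y (Tst i h)" "\<And>i. bounded_op K (L i)" by metis
  define Z where "Z i = cadjoint K (L i)" for i
  have Z: "bounded_op K (Z i)" for i unfolding Z_def by (rule cadjoint_bounded_op[OF K L(2)])
  have ZK: "Z i k \<in> K" for i k unfolding Z_def by (rule cadjoint_in[OF K L(2)])
  have LZ: "cinner (L i x) y = cinner x (Z i y)" if "x \<in> K" for i x y
    unfolding Z_def using cinner_cadjoint[OF K L(2) that] .
  then have ZL: "cinner (Z i y) x = cinner y (L i x)" if "x \<in> K" for i x y
    using that by (metis cinner_commute)
  have LK: "L i k \<in> K" if "k \<in> K" for i k using L(2)[of i] that by (simp add: bounded_op_def)
  have Z_adj: "cadjoint K (Z i) k = L i k" if "k \<in> K" for i k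
    using K that by (intro cadjoint_eqI LK ZL) (auto simp: closed_csubspace_def)
  have S_in: "(\<Sum>i\<in>UNIV. Z i (L i k)) \<in> K" for k
    using K ZK by (intro csubspace_sum) (auto simp: closed_csubspace_def)
  have S_Y: "(\<Sum>i\<in>UNIV. Z i (L i (Y g))) = Y g" for g
  proof (rule closure_csubspace_eqI[OF csY])
    fix x assume "x \<in> range Y"
    then obtain h where x: "x = Y h" by blast
    have "cinner (\<Sum>i\<in>UNIV. Z i (L i (Y g))) x = (\<Sum>i\<in>UNIV. cinner (Y (Tst i g)) (Y (Tst i h)))"
      by (simp add: x cinner.sum_left ZL YK L(1))
    also have "\<dots> = cinner (Y g) x" unfolding x by (rule cinner_isometric_sum[OF Y YT col])
    finally show "cinner (\<Sum>i\<in>UNIV. Z i (L i (Y g))) x = cinner (Y g) x" .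
  qed (use S_in YK in \<open>auto simp: K_def\<close>)
  \<comment> \<open>On the closure the identity follows from the symmetry of \<Sum> Z_i L_i: the
    operator moves to the side of \<open>Y h\<close>, where it is known.\<close>
  have S: "(\<Sum>i\<in>UNIV. Z i (L i k)) = k" if k: "k \<in> K" for k
  proof (rule closure_csubspace_eqI[OF csY])
    fix x assume "x \<in> range Y"
    then obtain h where x: "x = Y h" by blast
    have "cinner (\<Sum>i\<in>UNIV. Z i (L i k)) x = cinner k (\<Sum>i\<in>UNIV. Z i (L i x))"
      by (simp add: x cinner.sum_left cinner.sum_right ZL LZ YK k)
    then show "cinner (\<Sum>i\<in>UNIV. Z i (L i k)) x = cinner k x" by (simp add: x S_Y)
  qed (use S_in k in \<open>auto simp: K_def\<close>)
  have D: "closed_csubspace D"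
    unfolding D_def using clinear_map_defect_op[OF T]
    by (intro closed_csubspace_closure csubspace_range)
      (simp add: clinear_map_def scaleC_prod_def scaleC.zero_right)
  let ?J = "generated_ideal P"
  interpret constrained_dilation_space ?J P D K Z by unfold_locales (simp_all add: D K Z)
  have poissonH: "poisson h \<in> H" for h
  proof (rule htensorI[OF closed_csubspace_N_space D])
    show "l2_nth (poisson h) w \<in> D" for w
      unfolding D_def poisson_nth by (rule subsetD[OF closure_subset]) blast
  qed (rule slice_poisson_in_N_space[OF p])
  define U where "U h = (poisson h :: ('n list, 'h \<times> 'u) l2, Y h)" for h
  have U: "isometry U"
    unfolding isometry_def
  proof (intro conjI allI)
    have "(norm (U h))\<^sup>2 = (norm h)\<^sup>2" for h by (simp only: U_def norm_Pair_sq norm_Y)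
    then show "norm (U h) = norm h" for h by (simp add: power2_eq_iff_nonneg)
  qed (simp_all add: U_def clinear_map_add[OF Y] clinear_map_scaleC[OF Y] scaleC_prod_def
      clinear_map_add[OF clinear_poisson] clinear_map_scaleC[OF clinear_poisson])
  have US: "U h \<in> dil_space ?J D K" for h by (simp add: U_def dil_space_def poissonH YK)
  have U_adj: "cadjoint (dil_space ?J D K) (dil_op ?J D Z i) (U h) = U (Tst i h)" for i h
    by (simp add: U_def cadjoint_dil_op poissonH Z_adj YK L(1) backshift_poisson)
  \<comment> \<open>Condition (a) on the second summand: the adjoints \<open>L i\<close> of the
    \<open>Z i\<close> intertwine \<open>Y\<close> with the adjoints of the
    \<open>T i\<close>.\<close>
  have polyZ: "poly_eval Z p k = 0" if "p \<in> P" "k \<in> K" for p k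
  proof (rule closure_csubspace_eqI[OF csY])
    have "csubspace K" using K by (simp add: closed_csubspace_def)
    moreover have "word_op Z w k \<in> K" for w by (cases w) (simp_all add: that ZK)
    ultimately show "poly_eval Z p k \<in> closure (range Y)" "0 \<in> closure (range Y)"
      unfolding poly_eval_def K_def[symmetric] by (auto intro!: csubspace_sum csubspace_scaleC csubspace_0)
    fix x assume "x \<in> range Y"
    then obtain h where x: "x = Y h" by blast
    show "cinner (poly_eval Z p k) x = cinner 0 x"
      unfolding x cinner.zero_left
      by (rule poly_eval_orthogonal[OF Y, where M = K]) (use p that ZK ZL YK L(1) in auto)
  qed
  have "U (T i h) = proj (range U) (dil_op ?J D Z i (U h))" for i h
  proof (rule proj_eqI[symmetric])
    show "csubspace (range U)" using U by (intro csubspace_range) (simp add: isometry_def clinear_map_def)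
    have "cinner (dil_op ?J D Z i (U h)) (U g) = cinner (U (T i h)) (U g)" for g
      by (simp add: cinner_dil_op[OF US US] U_adj isometry_cinner[OF U] cinner_cadjoint_UNIV(1)[OF bounded_T])
    then show "dil_op ?J D Z i (U h) - U (T i h) \<in> ocomp (range U)"
      by (auto simp: ocomp_def cinner.diff_right) (metis cinner_commute)
  qed simp
  moreover have "poly_eval (dil_op ?J D Z) p v = 0" if "p \<in> P" "v \<in> dil_space ?J D K" for p v
    using that by (auto simp: dil_space_def poly_eval_dil_op polyZ zero_prod_def)
  ultimately have "constrained_dilation ?J P T D K Z U"
    unfolding constrained_dilation_def using D K Z S Z_adj U US U_adj by auto
  then show ?thesis by blast
qed

end

theorem corollary2p3:
  fixes J :: "('n::finite fock \<Rightarrow> 'n fock) set"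
    and P :: "'n ncpoly set"
    and T :: "'n \<Rightarrow> 'h::complex_hilbert \<Rightarrow> 'h"
  assumes "J = generated_ideal P"
    and "J \<noteq> toeplitz_alg"
    and "row_contraction T"
    and "\<forall>p\<in>P. \<forall>x. poly_eval T p x = 0"
  shows "dil_ind TYPE('u::complex_hilbert) J P T =o rank_op (defect_op T)"
proof -
  let ?dims = "dil_dims J P T :: ('h \<times> 'u) rel set"
  let ?A = "\<lambda>x. (defect_op T x, 0 :: 'u)"
  interpret row_contractive_tuple T by unfold_locales (rule assms(3))
  have lower: "rank_op (defect_op T) \<le>o \<kappa>" if "\<kappa> \<in> ?dims" for \<kappa>
    using that rank_defect_op_le_hdim[OF assms(1,3)] by (auto simp: dil_dims_def)
  obtain K :: "('h \<times> 'u) set" and Z U where "constrained_dilation J P T (closure (range ?A)) K Z U"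
    using constrained_dilation_exists[OF assms(4) refl] assms(1) by blast
  then have mem: "hdim (closure (range ?A)) \<in> ?dims" by (auto simp: dil_dims_def)
  have "clinear_map ?A"
    using clinear_map_defect_op[OF assms(3)]
    by (simp add: clinear_map_def scaleC_prod_def scaleC.zero_right)
  \<comment> \<open>Padding by 0 preserves norms, so the copy of the defect space inside the
    universe has no larger dimension.\<close>
  then have upper: "hdim (closure (range ?A)) \<le>o rank_op (defect_op T)"
    unfolding rank_op_def
    by (rule hdim_closure_range_le[OF _ clinear_map_defect_op[OF assms(3)]]) (simp add: norm_prod_def)
  \<comment> \<open>The choice in \<open>dil_ind\<close> is justified by a member lying below the
    common lower bound of all members.\<close>
  have "\<exists>\<kappa>. \<kappa> \<in> ?dims \<and> (\<forall>\<kappa>'\<in>?dims. \<kappa> \<le>o \<kappa>')"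
    using mem lower ordLeq_transitive[OF upper] by blast
  then have "dil_ind TYPE('u) J P T \<in> ?dims \<and> (\<forall>\<kappa>'\<in>?dims. dil_ind TYPE('u) J P T \<le>o \<kappa>')"
    unfolding dil_ind_def by (rule someI_ex)
  then have "rank_op (defect_op T) \<le>o dil_ind TYPE('u) J P T"
    and "dil_ind TYPE('u) J P T \<le>o rank_op (defect_op T)"
    using lower mem ordLeq_transitive[OF _ upper] by blast+
  then show ?thesis by (simp add: ordIso_iff_ordLeq)
qed

end
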